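(* The space $T^*(T^* )$ is asymptotic-subsequential-$c_0$ but not asymptotic-$c_0$.
   Context: Tsirelson's space $T$ is the completion of $c_{00}$ under the unique norm satisfying $\|x\|_T=\max\{\|x\|_\infty,\frac12\sup\sum_{j=1}^n\|E_j(x)\|_T\}$, the supremum over all $n$ and finite sets $n\le E_1<E_2<\dots<E_n$ (i.e. $n\le\min E_1$ and $\max E_j<\min E_{j+1}$), where $E(x)=\sum_{j\in E}\lambda_je_j$ for $x=\sum\lambda_je_j$. $T^*$ is its dual, with the $1$-unconditional basis $(e_j)$ of coordinate functionals. For a Banach space $U$ with $1$-unconditional basis $(u_k)$, $U(X)$ is the space of sequences $(x_k)$ in $X$ with $\sum\|x_k\|u_k$ convergent in $U$, normed by $\|(x_k)\|=\|\sum\|x_k\|u_k\|_U$; $T^*(T^* )$ is this with $U=X=T^*$. Two finite basic sequences are $C$-equivalent if there are $A,B>0$ with $AB\le C$ and $\frac1A\|\sum a_ix_i\|\le\|\sum a_iy_i\|\le B\|\sum a_ix_i\|$. For a Banach space $X$ and $N$, $\{X\}_N$ is the set of norms $E$ on $\mathbb R^N$ with unit vector basis $(e_j)$ normalized monotone such that: for every $\varepsilon>0$, for every closed finite-codimensional $X_1$ there is $x_1\in S_{X_1}$, ..., for every closed finite-codimensional $X_N$ there is $x_N\in S_{X_N}$, with $(x_j)_{j=1}^N$ $(1+\varepsilon)$-equivalent to $(e_j)$. $X$ is asymptotic-$c_0$ if for some $c\ge1$ every $E\in\{X\}_k$, $k\in\mathbb N$, has basis $c$-equivalent to the unit vector basis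 of $\ell_\infty^k$. An infinite dimensional $X$ is asymptotic-subsequential-$c_0$ if there is $C\ge1$ such that for every $n$ there is $N$ such that for every $E\in\{X\}_N$ there are $i_1<\dots<i_n$ with $(e_{i_k})_{k=1}^n$ $C$-equivalent to the unit vector basis of $\ell_\infty^n$. *)

theory Defs
  imports "HOL-Analysis.Analysis"
begin

text \<open>Conventions: the basis of all sequence spaces is indexed by nat starting at 0;
  the paper's basis vector e_(j+1) corresponds to coordinate j here.\<close>

definition c00 :: "(nat \<Rightarrow> real) set" where
  "c00 = {x. finite {j. x j \<noteq> 0}}"

definition restr :: "nat set \<Rightarrow> (nat \<Rightarrow> real) \<Rightarrow> (nat \<Rightarrow> real)" where
  "restr E x = (\<lambda>j. if j \<in> E then x j else 0)"

definition sup_norm :: "(nat \<Rightarrow> real) \<Rightarrow> real" where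
  "sup_norm x = Sup (range (\<lambda>j. \<bar>x j\<bar>))"

text \<open>Admissible families n \<le> E_1 < ... < E_n (0-based: paper index = our index + 1).\<close>
definition admissible :: "nat \<Rightarrow> (nat \<Rightarrow> nat set) \<Rightarrow> bool" where
  "admissible n Es \<longleftrightarrow> n \<ge> 1 \<and>
     (\<forall>j<n. finite (Es j) \<and> Es j \<noteq> {}) \<and>
     n \<le> Min (Es 0) + 1 \<and>
     (\<forall>j. Suc j < n \<longrightarrow> Max (Es j) < Min (Es (Suc j)))"

definition is_norm_on_c00 :: "((nat \<Rightarrow> real) \<Rightarrow> real) \<Rightarrow> bool" where
  "is_norm_on_c00 f \<longleftrightarrow>
     (\<forall>x\<in>c00. f x \<ge> 0 \<and> (f x = 0 \<longleftrightarrow> x = (\<lambda>_. 0))) \<and>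
     (\<forall>x\<in>c00. \<forall>c. f (\<lambda>j. c * x j) = \<bar>c\<bar> * f x) \<and>
     (\<forall>x\<in>c00. \<forall>y\<in>c00. f (\<lambda>j. x j + y j) \<le> f x + f y)"

definition tsirelson_eq :: "((nat \<Rightarrow> real) \<Rightarrow> real) \<Rightarrow> bool" where
  "tsirelson_eq f \<longleftrightarrow> (\<forall>x\<in>c00. f x = max (sup_norm x)
       ((1/2) * Sup {(\<Sum>j<n. f (restr (Es j) x)) | n Es. admissible n Es}))"

text \<open>The Tsirelson norm: the unique norm on c00 satisfying the implicit equation
  (extended by 0 outside c00 so that it is a uniquely determined function).\<close>
definition T_norm :: "(nat \<Rightarrow> real) \<Rightarrow> real" where
  "T_norm = (THE f. is_norm_on_c00 f \<and> tsirelson_eq f \<and> (\<forall>x. x \<notin> c00 \<longrightarrow> f x = 0))"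

definition pairing :: "(nat \<Rightarrow> real) \<Rightarrow> (nat \<Rightarrow> real) \<Rightarrow> real" where
  "pairing f x = (\<Sum>j\<in>{j. x j \<noteq> 0}. f j * x j)"

text \<open>T* is identified (via the coordinate functionals e_j^*) with the sequences defining
  bounded functionals on the dense subspace c00 of T.\<close>
definition Tstar :: "(nat \<Rightarrow> real) set" where
  "Tstar = {f. bdd_above {\<bar>pairing f x\<bar> | x. x \<in> c00 \<and> T_norm x \<le> 1}}"

definition Tstar_norm :: "(nat \<Rightarrow> real) \<Rightarrow> real" where
  "Tstar_norm f = Sup {\<bar>pairing f x\<bar> | x. x \<in> c00 \<and> T_norm x \<le> 1}"

definition trunc :: "nat \<Rightarrow> (nat \<Rightarrow> real) \<Rightarrow> (nat \<Rightarrow> real)" where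
  "trunc n a = (\<lambda>j. if j < n then a j else 0)"

definition TT :: "(nat \<Rightarrow> nat \<Rightarrow> real) set" where
  "TT = {x. (\<forall>k. x k \<in> Tstar) \<and>
          (\<exists>s\<in>Tstar. (\<lambda>n. Tstar_norm (\<lambda>j. s j - trunc n (\<lambda>k. Tstar_norm (x k)) j))
                        \<longlonglongrightarrow> 0)}"

definition TT_norm :: "(nat \<Rightarrow> nat \<Rightarrow> real) \<Rightarrow> real" where
  "TT_norm x = Tstar_norm (\<lambda>k. Tstar_norm (x k))"

type_synonym vv = "nat \<Rightarrow> nat \<Rightarrow> real"

definition vlincomb :: "nat \<Rightarrow> (nat \<Rightarrow> real) \<Rightarrow> (nat \<Rightarrow> vv) \<Rightarrow> vv" where
  "vlincomb m a x = (\<lambda>k j. \<Sum>i<m. a i * x i k j)"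

definition vspan :: "vv set \<Rightarrow> vv set" where
  "vspan S = {v. \<exists>m a x. (\<forall>i<m. x i \<in> S) \<and> v = vlincomb m a x}"

definition lin_subspace :: "vv set \<Rightarrow> vv set \<Rightarrow> bool" where
  "lin_subspace V W \<longleftrightarrow> W \<subseteq> V \<and> (\<lambda>k j. 0) \<in> W \<and>
     (\<forall>x\<in>W. \<forall>y\<in>W. (\<lambda>k j. x k j + y k j) \<in> W) \<and>
     (\<forall>x\<in>W. \<forall>c. (\<lambda>k j. c * x k j) \<in> W)"

definition closed_in_space :: "vv set \<Rightarrow> (vv \<Rightarrow> real) \<Rightarrow> vv set \<Rightarrow> bool" where
  "closed_in_space V nrm W \<longleftrightarrow> (\<forall>s x. (\<forall>n. s n \<in> W) \<longrightarrow> x \<in> V \<longrightarrow>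
      (\<lambda>n. nrm (\<lambda>k j. s n k j - x k j)) \<longlonglongrightarrow> 0 \<longrightarrow> x \<in> W)"

definition fin_codim :: "vv set \<Rightarrow> vv set \<Rightarrow> bool" where
  "fin_codim V W \<longleftrightarrow> (\<exists>B. finite B \<and> B \<subseteq> V \<and> V \<subseteq> vspan (W \<union> B))"

definition closed_fincodim :: "vv set \<Rightarrow> (vv \<Rightarrow> real) \<Rightarrow> vv set \<Rightarrow> bool" where
  "closed_fincodim V nrm W \<longleftrightarrow> lin_subspace V W \<and> closed_in_space V nrm W \<and> fin_codim V W"

definition infinite_dim :: "vv set \<Rightarrow> bool" where
  "infinite_dim V \<longleftrightarrow> (\<forall>B. finite B \<longrightarrow> \<not> V \<subseteq> vspan B)"

text \<open>C-equivalence of two finite basic sequences of length N, given by the norms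
  n1 a = ||sum a_i x_i|| and n2 a = ||sum a_i y_i|| on coefficient vectors supported in {..<N}.\<close>
definition equiv_seq :: "real \<Rightarrow> nat \<Rightarrow> ((nat \<Rightarrow> real) \<Rightarrow> real) \<Rightarrow> ((nat \<Rightarrow> real) \<Rightarrow> real) \<Rightarrow> bool" where
  "equiv_seq C N n1 n2 \<longleftrightarrow> (\<exists>A B. A > 0 \<and> B > 0 \<and> A * B \<le> C \<and>
     (\<forall>a. (\<forall>i\<ge>N. a i = 0) \<longrightarrow> (1 / A) * n1 a \<le> n2 a \<and> n2 a \<le> B * n1 a))"

definition supp_in :: "nat \<Rightarrow> (nat \<Rightarrow> real) \<Rightarrow> bool" where
  "supp_in N a \<longleftrightarrow> (\<forall>i\<ge>N. a i = 0)"

definition unitv :: "nat \<Rightarrow> nat \<Rightarrow> real" where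
  "unitv i = (\<lambda>j. if j = i then 1 else 0)"

definition normed_monotone_basis :: "nat \<Rightarrow> ((nat \<Rightarrow> real) \<Rightarrow> real) \<Rightarrow> bool" where
  "normed_monotone_basis N E \<longleftrightarrow>
     (\<forall>a. supp_in N a \<longrightarrow> E a \<ge> 0 \<and> (E a = 0 \<longleftrightarrow> a = (\<lambda>_. 0))) \<and>
     (\<forall>a c. supp_in N a \<longrightarrow> E (\<lambda>j. c * a j) = \<bar>c\<bar> * E a) \<and>
     (\<forall>a b. supp_in N a \<longrightarrow> supp_in N b \<longrightarrow> E (\<lambda>j. a j + b j) \<le> E a + E b) \<and>
     (\<forall>i<N. E (unitv i) = 1) \<and>
     (\<forall>a m. supp_in N a \<longrightarrow> m \<le> N \<longrightarrow> E (trunc m a) \<le> E a)"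

fun asym_game :: "vv set \<Rightarrow> (vv \<Rightarrow> real) \<Rightarrow> ((nat \<Rightarrow> real) \<Rightarrow> real) \<Rightarrow> real \<Rightarrow> nat \<Rightarrow> vv list \<Rightarrow> bool" where
  "asym_game V nrm E eps 0 xs =
     equiv_seq (1 + eps) (length xs) (\<lambda>a. nrm (vlincomb (length xs) a (\<lambda>i. xs ! i))) E"
| "asym_game V nrm E eps (Suc m) xs =
     (\<forall>W. closed_fincodim V nrm W \<longrightarrow>
        (\<exists>x\<in>W. nrm x = 1 \<and> asym_game V nrm E eps m (xs @ [x])))"

definition asym_struct :: "vv set \<Rightarrow> (vv \<Rightarrow> real) \<Rightarrow> nat \<Rightarrow> ((nat \<Rightarrow> real) \<Rightarrow> real) set" where
  "asym_struct V nrm N = {E. normed_monotone_basis N E \<and>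
      (\<forall>eps>0. asym_game V nrm E eps N [])}"

definition linf :: "nat \<Rightarrow> (nat \<Rightarrow> real) \<Rightarrow> real" where
  "linf n a = Max (insert 0 ((\<lambda>i. \<bar>a i\<bar>) ` {..<n}))"

definition asymptotic_c0 :: "vv set \<Rightarrow> (vv \<Rightarrow> real) \<Rightarrow> bool" where
  "asymptotic_c0 V nrm \<longleftrightarrow> (\<exists>c\<ge>1. \<forall>k. \<forall>E\<in>asym_struct V nrm k. equiv_seq c k E (linf k))"

definition asymptotic_subsequential_c0 :: "vv set \<Rightarrow> (vv \<Rightarrow> real) \<Rightarrow> bool" where
  "asymptotic_subsequential_c0 V nrm \<longleftrightarrow> infinite_dim V \<and>
     (\<exists>C\<ge>1. \<forall>n. \<exists>N. \<forall>E\<in>asym_struct V nrm N.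
        \<exists>\<sigma>. (\<forall>k l. k < l \<longrightarrow> l < n \<longrightarrow> \<sigma> k < \<sigma> l) \<and> (\<forall>k<n. \<sigma> k < N) \<and>
            equiv_seq C n (\<lambda>a. E (\<lambda>j. \<Sum>k<n. if \<sigma> k = j then a k else 0)) (linf n))"

end

theory Submission
  imports Defs
begin

text \<open>The Tsirelson norm is the supremum over an inductively generated set of norming functionals. Two facts
  about it carry the proof. First, \<open>T\<close> contains no block copy of \<open>\<ell>\<^sub>1\<close> (James' distortion
  argument), so tails of elements of \<open>T\<^sup>*\<close> tend to zero and the norms of \<open>e\<^sub>1 + \<dots> + e\<^sub>N\<close>
  in \<open>T\<^sup>*\<close> are unbounded. Second, \<open>n\<close> elements of the ball of \<open>T\<^sup>*\<close> supported beyond \<open>2 n + 2\<close>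
  have a lattice maximum of norm at most 8, whatever their relative position.

  Every finite-codimensional subspace meets every row of \<open>T\<^sup>*(T\<^sup>*)\<close>, so the initial segments of the basis of
  \<open>T\<^sup>*\<close> are asymptotic structures, and they are not uniformly \<open>\<ell>\<^sub>\<infinity>\<close>. Conversely, when the subspaces are
  chosen to kill larger and larger corners, the row norms of a sum of vectors are bounded by three times
  the maximum of their row norms. The pigeonhole principle on the first \<open>2 n + 2\<close> rows selects \<open>n\<close>
  vectors whose row norms nearly agree there, and the second fact bounds the maximum on the remaining rows.\<close>

text \<open>The subspaces of the game control only finite corners. The other player may put all
  vectors into the same few rows, in columns further and further out, so the sequences of row norms
  are arbitrary members of the unit ball of \<open>T*\<close>, neither disjoint nor ordered. This is
  why the estimate for maxima must hold in any relative position. It cannot hold on the whole ball: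
  the maximum of the first \<open>n\<close> unit vectors has unbounded norm. Starting beyond
  \<open>2 * n + 2\<close> excludes such configurations, and in the finitely many rows left out
  compactness takes over, which is the only reason for passing to a subsequence.

  Just the upper \<open>c0\<close> estimate concerns the game. The lower estimate holds, with
  constant 2, for every normalized monotone basis.\<close>

section \<open>Finitely supported sequences and the pairing\<close>

definition mag :: "(nat \<Rightarrow> real) \<Rightarrow> (nat \<Rightarrow> real)" where
  "mag x = (\<lambda>j. \<bar>x j\<bar>)"

lemma mag_nonneg [simp]: "0 \<le> mag x j"
  by (simp add: mag_def)

lemma restr_mag: "restr A (mag x) = mag (restr A x)"
  by (auto simp: restr_def mag_def)

lemma c00_mono:
  assumes "x \<in> c00" "\<And>j. x j = 0 \<Longrightarrow> y j = 0"
  shows "y \<in> c00"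
proof -
  have "{j. y j \<noteq> 0} \<subseteq> {j. x j \<noteq> 0}" using assms(2) by auto
  then show ?thesis using assms(1) finite_subset unfolding c00_def by auto
qed

lemma c00_restr [simp]: "x \<in> c00 \<Longrightarrow> restr A x \<in> c00"
  by (erule c00_mono) (simp add: restr_def)

lemma c00_mag [simp]: "x \<in> c00 \<Longrightarrow> mag x \<in> c00"
  by (erule c00_mono) (simp add: mag_def)

lemma c00_add [simp]: "x \<in> c00 \<Longrightarrow> y \<in> c00 \<Longrightarrow> (\<lambda>j. x j + y j) \<in> c00"
proof -
  assume "x \<in> c00" "y \<in> c00"
  moreover have "{j. x j + y j \<noteq> 0} \<subseteq> {j. x j \<noteq> 0} \<union> {j. y j \<noteq> 0}" by auto
  ultimately show ?thesis unfolding c00_def using finite_subset by blast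
qed

lemma c00_scale [simp]: "x \<in> c00 \<Longrightarrow> (\<lambda>j. c * x j) \<in> c00"
  by (erule c00_mono) simp

lemma c00_zero [simp]: "(\<lambda>_. 0) \<in> c00"
  by (simp add: c00_def)

lemma c00_unitv [simp]: "unitv t \<in> c00"
  by (simp add: c00_def unitv_def)

lemma c00_sum: "finite A \<Longrightarrow> (\<And>i. i \<in> A \<Longrightarrow> x i \<in> c00) \<Longrightarrow> (\<lambda>j. \<Sum>i\<in>A. x i j) \<in> c00"
  by (induction A rule: finite_induct) auto

lemma pairing_eq_sum:
  assumes "finite S" "\<And>j. j \<notin> S \<Longrightarrow> x j = 0"
  shows "pairing f x = (\<Sum>j\<in>S. f j * x j)"
  unfolding pairing_def by (rule sum.mono_neutral_left) (use assms in auto)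

lemma c00_bound:
  assumes "x \<in> c00" obtains p where "\<And>j. p \<le> j \<Longrightarrow> x j = 0"
proof -
  have fin: "finite {j. x j \<noteq> 0}" using assms by (simp add: c00_def)
  have "x j = 0" if "Suc (Max {j. x j \<noteq> 0}) \<le> j" for j
  proof (rule ccontr)
    assume "x j \<noteq> 0"
    then have "j \<le> Max {j. x j \<noteq> 0}" using fin by (intro Max_ge) auto
    then show False using that by simp
  qed
  then show ?thesis using that by blast
qed

lemma pairing_add_left: "pairing (\<lambda>j. f j + g j) x = pairing f x + pairing g x"
  by (simp add: pairing_def distrib_right sum.distrib)

lemma pairing_scale_left: "pairing (\<lambda>j. c * f j) x = c * pairing f x"
  by (simp add: pairing_def sum_distrib_left mult.assoc)

lemma pairing_sum_left: "pairing (\<lambda>j. \<Sum>i\<in>A. f i j) x = (\<Sum>i\<in>A. pairing (f i) x)"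
  unfolding pairing_def by (simp add: sum_distrib_right, rule sum.swap)

lemma pairing_add_right:
  assumes "x \<in> c00" "y \<in> c00"
  shows "pairing f (\<lambda>j. x j + y j) = pairing f x + pairing f y"
proof -
  let ?S = "{j. x j \<noteq> 0} \<union> {j. y j \<noteq> 0}"
  have fin: "finite ?S" using assms by (simp add: c00_def)
  show ?thesis
    by (subst (1 2 3) pairing_eq_sum[OF fin]) (auto simp: distrib_left sum.distrib)
qed

lemma pairing_scale_right: "pairing f (\<lambda>j. c * x j) = c * pairing f x"
proof (cases "c = 0")
  case True then show ?thesis by (simp add: pairing_def)
next
  case False then show ?thesis by (simp add: pairing_def sum_distrib_left mult.left_commute)
qed

lemma pairing_sum_right:
  assumes "finite A" "\<And>i. i \<in> A \<Longrightarrow> x i \<in> c00"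
  shows "pairing f (\<lambda>j. \<Sum>i\<in>A. x i j) = (\<Sum>i\<in>A. pairing f (x i))"
  using assms
proof (induction A rule: finite_induct)
  case empty then show ?case by (simp add: pairing_def)
next
  case (insert a A)
  then show ?case by (simp add: pairing_add_right c00_sum)
qed

lemma pairing_restr_swap:
  assumes "x \<in> c00" shows "pairing (restr A f) x = pairing f (restr A x)"
proof -
  have fin: "finite {j. x j \<noteq> 0}" using assms by (simp add: c00_def)
  show ?thesis
    by (subst (1 2) pairing_eq_sum[OF fin]) (auto simp: restr_def intro: sum.cong)
qed

lemma pairing_mono:
  assumes "\<And>j. x j \<noteq> 0 \<Longrightarrow> f j \<le> g j" "\<And>j. 0 \<le> x j"
  shows "pairing f x \<le> pairing g x"
  unfolding pairing_def by (rule sum_mono) (use assms in \<open>auto intro: mult_right_mono\<close>)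

lemma pairing_mono_right:
  assumes "y \<in> c00" "\<And>j. 0 \<le> f j" "\<And>j. 0 \<le> x j" "\<And>j. x j \<le> y j"
  shows "pairing f x \<le> pairing f y"
proof -
  have fin: "finite {j. y j \<noteq> 0}" using assms by (simp add: c00_def)
  have z: "x j = 0" if "y j = 0" for j using assms(3)[of j] assms(4)[of j] that by simp
  show ?thesis
    by (subst (1 2) pairing_eq_sum[OF fin]) (use assms z in \<open>auto intro!: sum_mono mult_left_mono\<close>)
qed

lemma pairing_nonneg: "(\<And>j. 0 \<le> f j) \<Longrightarrow> (\<And>j. 0 \<le> x j) \<Longrightarrow> 0 \<le> pairing f x"
  unfolding pairing_def by (intro sum_nonneg) auto

lemma pairing_zero_left [simp]: "pairing (\<lambda>_. 0) x = 0"
  by (simp add: pairing_def)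

lemma pairing_zero_right [simp]: "pairing f (\<lambda>_. 0) = 0"
  by (simp add: pairing_def)

lemma pairing_unitv:
  assumes "x \<in> c00" shows "pairing (unitv t) x = x t"
proof -
  have fin: "finite {j. x j \<noteq> 0}" using assms by (simp add: c00_def)
  have "pairing (unitv t) x = (\<Sum>j\<in>insert t {j. x j \<noteq> 0}. unitv t j * x j)"
    by (rule pairing_eq_sum) (use fin in auto)
  also have "\<dots> = (\<Sum>j\<in>insert t {j. x j \<noteq> 0}. if j = t then x t else 0)"
    by (intro sum.cong) (auto simp: unitv_def)
  finally show ?thesis using fin by simp
qed

subsection \<open>The Tsirelson norm through its norming functionals\<close>

lemma mag_apply: "mag x j = \<bar>x j\<bar>"
  by (simp add: mag_def)

lemma restr_apply: "restr A x j = (if j \<in> A then x j else 0)"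
  by (simp add: restr_def)

text \<open>Formulated through nonzero entries, so that zero members are allowed anywhere and the
  condition survives restriction to arbitrary sets.\<close>

definition successive :: "nat \<Rightarrow> (nat \<Rightarrow> nat \<Rightarrow> real) \<Rightarrow> bool" where
  "successive k g \<longleftrightarrow>
     (\<forall>l l' i j. l < l' \<longrightarrow> l' < k \<longrightarrow> g l i \<noteq> 0 \<longrightarrow> g l' j \<noteq> 0 \<longrightarrow> i < j)"

text \<open>The usual norming set of Tsirelson's norm, with nonnegative coefficients only, because
  it is always paired with \<open>mag x\<close>. The condition \<open>k \<le> Suc j\<close> is
  admissibility for indices that start at 0.\<close>

primrec norming_level :: "nat \<Rightarrow> (nat \<Rightarrow> real) set" where
  "norming_level 0 = insert (\<lambda>_. 0) (range unitv)"
| "norming_level (Suc m) = norming_level m \<union> {\<lambda>j. 1/2 * (\<Sum>l<k. g l j) | k g. (\<forall>l<k. g l \<in> norming_level m) \<and>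
      (\<forall>l<k. \<forall>j. g l j \<noteq> 0 \<longrightarrow> k \<le> Suc j) \<and> successive k g}"

definition norming :: "(nat \<Rightarrow> real) set" where "norming = (\<Union>m. norming_level m)"

lemma norming_level_mono: "m \<le> m' \<Longrightarrow> norming_level m \<subseteq> norming_level m'"
  by (rule lift_Suc_mono_le[of norming_level]) auto

text \<open>The levels are cumulative, so a member of level \<open>m\<close> may have been formed
  earlier. Monotonicity moves its children up to the level just below \<open>m\<close>, which is
  what an induction on \<open>m\<close> consumes.\<close>

lemma norming_level_cases:
  assumes "g \<in> norming_level m"
  obtains "g = (\<lambda>_. 0)" | t where "g = unitv t"
  | m' k h where "m = Suc m'" "g = (\<lambda>j. 1/2 * (\<Sum>l<k. h l j))" "\<forall>l<k. h l \<in> norming_level m'"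
      "\<forall>l<k. \<forall>j. h l j \<noteq> 0 \<longrightarrow> k \<le> Suc j" "successive k h"
  using assms
proof (induction m arbitrary: thesis)
  case 0 then show ?case by auto
next
  case (Suc m)
  show ?case
  proof (cases "g \<in> norming_level m")
    case True
    show ?thesis
    proof (rule Suc.IH[OF _ _ _ True])
      fix m' k h
      assume *: "m = Suc m'" "g = (\<lambda>j. 1/2 * (\<Sum>l<k. h l j))" "\<forall>l<k. h l \<in> norming_level m'"
        "\<forall>l<k. \<forall>j. h l j \<noteq> 0 \<longrightarrow> k \<le> Suc j" "successive k h"
      have "\<forall>l<k. h l \<in> norming_level m" using *(1,3) by auto
      with * show thesis using Suc.prems(3)[of m h k] by blast
    qed (use Suc.prems in auto)
  next
    case False
    then show ?thesis using Suc.prems by auto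
  qed
qed

lemma successive_sum_single:
  assumes "successive k g" "l < k" "g l j \<noteq> 0"
  shows "(\<Sum>i<k. g i j) = g l j"
proof -
  have "g i j = 0" if "i < k" "i \<noteq> l" for i
    using assms that unfolding successive_def by (metis less_irrefl nat_neq_iff)
  then have "(\<Sum>i<k. g i j) = (\<Sum>i<k. if i = l then g l j else 0)"
    by (intro sum.cong) auto
  then show ?thesis using assms(2) by simp
qed

lemma norming_level_range: "g \<in> norming_level m \<Longrightarrow> 0 \<le> g j \<and> g j \<le> 1"
proof (induction m arbitrary: g j)
  case 0 then show ?case by (auto simp: unitv_def)
next
  case (Suc m)
  from Suc.prems show ?case
  proof (cases rule: norming_level_cases)
    case (3 m' k h)
    have r: "0 \<le> h l j \<and> h l j \<le> 1" if "l < k" for l using Suc.IH 3 that by auto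
    show ?thesis
    proof (cases "\<exists>l<k. h l j \<noteq> 0")
      case True
      then obtain l where "l < k" "h l j \<noteq> 0" by auto
      then show ?thesis using successive_sum_single[OF 3(5)] r[of l] 3(2) by simp
    next
      case False then show ?thesis using 3(2) by simp
    qed
  qed (auto simp: unitv_def)
qed

lemma norming_level_restr: "g \<in> norming_level m \<Longrightarrow> restr A g \<in> norming_level m"
proof (induction m arbitrary: g)
  case 0
  have "restr A (unitv t) = (if t \<in> A then unitv t else (\<lambda>_. 0))" for t
    by (auto simp: restr_def unitv_def)
  moreover have "restr A (\<lambda>_. 0) = (\<lambda>_. 0)" by (auto simp: restr_def)
  ultimately show ?case using 0 by auto
next
  case (Suc m)
  have u: "restr A (unitv t) = (if t \<in> A then unitv t else (\<lambda>_. 0))" for t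
    by (auto simp: restr_def unitv_def)
  have z: "restr A (\<lambda>_. 0) = (\<lambda>_. 0)" by (auto simp: restr_def)
  have b: "(\<lambda>_. 0) \<in> norming_level (Suc m)" "unitv t \<in> norming_level (Suc m)" for t
    using norming_level_mono[of 0 "Suc m"] by auto
  from Suc.prems show ?case
  proof (cases rule: norming_level_cases)
    case (3 m' k h)
    have "restr A g = (\<lambda>j. 1/2 * (\<Sum>l<k. restr A (h l) j))"
      unfolding 3(2) restr_def by auto
    moreover have "\<forall>l<k. restr A (h l) \<in> norming_level m" using 3 Suc.IH by auto
    moreover have "\<forall>l<k. \<forall>j. restr A (h l) j \<noteq> 0 \<longrightarrow> k \<le> Suc j"
      using 3(4) by (auto simp: restr_def)
    moreover have "successive k (\<lambda>l. restr A (h l))"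
      using 3(5) unfolding successive_def restr_def by metis
    ultimately show ?thesis
      by simp (rule disjI2, rule exI[of _ k], rule exI[of _ "\<lambda>l. restr A (h l)"], simp)
  qed (use u z b in auto)
qed

lemma norming_range: "g \<in> norming \<Longrightarrow> 0 \<le> g j \<and> g j \<le> 1"
  using norming_level_range by (auto simp: norming_def)

lemma norming_restr: "g \<in> norming \<Longrightarrow> restr A g \<in> norming"
  using norming_level_restr by (auto simp: norming_def)

lemma norming_zero: "(\<lambda>_. 0) \<in> norming"
  unfolding norming_def by (rule UN_I[of 0]) auto

lemma norming_unitv: "unitv t \<in> norming"
  unfolding norming_def by (rule UN_I[of 0]) auto

lemma norming_common:
  assumes "\<And>i. i < (n::nat) \<Longrightarrow> f i \<in> norming" obtains m where "\<And>i. i < n \<Longrightarrow> f i \<in> norming_level m"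
proof -
  have "\<forall>i. \<exists>m. i < n \<longrightarrow> f i \<in> norming_level m" using assms by (auto simp: norming_def)
  then obtain d where d: "\<And>i. i < n \<Longrightarrow> f i \<in> norming_level (d i)" by metis
  have "f i \<in> norming_level (\<Sum>i<n. d i)" if "i < n" for i
    using d[OF that] norming_level_mono[of "d i" "\<Sum>i<n. d i"] that by (auto intro!: member_le_sum)
  then show ?thesis using that by blast
qed

lemma norming_node:
  assumes "\<And>l. l < k \<Longrightarrow> g l \<in> norming" "\<And>l j. l < k \<Longrightarrow> g l j \<noteq> 0 \<Longrightarrow> k \<le> Suc j" "successive k g"
  shows "(\<lambda>j. 1/2 * (\<Sum>l<k. g l j)) \<in> norming"
proof -
  obtain m where "\<And>i. i < k \<Longrightarrow> g i \<in> norming_level m" using norming_common assms(1) by blast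
  then have "(\<lambda>j. 1/2 * (\<Sum>l<k. g l j)) \<in> norming_level (Suc m)"
    unfolding norming_level.simps
    by (intro UnI2 CollectI exI[of _ k] exI[of _ g] conjI refl allI impI) (use assms in auto)
  then show ?thesis unfolding norming_def by blast
qed

text \<open>The value 0 outside \<open>c00\<close> copies the convention in \<open>T_norm\<close>,
  so that the two functions agree everywhere.\<close>

definition tsir :: "(nat \<Rightarrow> real) \<Rightarrow> real" where
  "tsir x = (if x \<in> c00 then Sup ((\<lambda>g. pairing g (mag x)) ` norming) else 0)"

lemma tsir_bdd:
  assumes "x \<in> c00" shows "bdd_above ((\<lambda>g. pairing g (mag x)) ` norming)"
proof (rule bdd_aboveI)
  fix v assume "v \<in> (\<lambda>g. pairing g (mag x)) ` norming"
  then obtain g where "g \<in> norming" "v = pairing g (mag x)" by auto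
  then show "v \<le> pairing (\<lambda>_. 1) (mag x)"
    using norming_range by (auto intro: pairing_mono)
qed

lemma tsir_upper: "x \<in> c00 \<Longrightarrow> g \<in> norming \<Longrightarrow> pairing g (mag x) \<le> tsir x"
  unfolding tsir_def using tsir_bdd by (auto intro: cSup_upper)

lemma tsir_leI: "x \<in> c00 \<Longrightarrow> (\<And>g. g \<in> norming \<Longrightarrow> pairing g (mag x) \<le> c) \<Longrightarrow> tsir x \<le> c"
  unfolding tsir_def using norming_zero by (auto intro!: cSup_least)

lemma tsir_approx:
  assumes "x \<in> c00" "e > 0"
  obtains g where "g \<in> norming" "tsir x < pairing g (mag x) + e"
proof -
  have "tsir x - e < Sup ((\<lambda>g. pairing g (mag x)) ` norming)" using assms by (simp add: tsir_def)
  then obtain g where "g \<in> norming" "tsir x - e < pairing g (mag x)"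
    using less_cSup_iff[OF _ tsir_bdd[OF assms(1)]] norming_zero by auto
  then show ?thesis using that by simp
qed

lemma tsir_nonneg [simp]: "0 \<le> tsir x"
proof (cases "x \<in> c00")
  case True then show ?thesis using tsir_upper[OF True norming_zero] by simp
qed (simp add: tsir_def)

lemma tsir_coord: "x \<in> c00 \<Longrightarrow> \<bar>x j\<bar> \<le> tsir x"
  using tsir_upper[OF _ norming_unitv[of j]] by (simp add: pairing_unitv) (simp add: mag_apply)

lemma tsir_le_l1:
  assumes "x \<in> c00" shows "tsir x \<le> pairing (\<lambda>_. 1) (mag x)"
  using assms norming_range by (intro tsir_leI) (auto intro: pairing_mono)

lemma tsir_mono:
  assumes "y \<in> c00" "\<And>j. \<bar>x j\<bar> \<le> \<bar>y j\<bar>" shows "tsir x \<le> tsir y"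
proof -
  have x: "x \<in> c00"
  proof (rule c00_mono[OF assms(1)])
    fix j assume "y j = 0" then show "x j = 0" using assms(2)[of j] by simp
  qed
  show ?thesis
  proof (rule tsir_leI[OF x])
    fix g assume g: "g \<in> norming"
    have "pairing g (mag x) \<le> pairing g (mag y)"
      using assms g norming_range by (intro pairing_mono_right) (auto simp: mag_apply)
    then show "pairing g (mag x) \<le> tsir y" using tsir_upper[OF assms(1) g] by simp
  qed
qed

lemma tsir_zero [simp]: "tsir (\<lambda>_. 0) = 0"
  using tsir_le_l1[of "\<lambda>_. 0"] tsir_nonneg[of "\<lambda>_. 0"] by (simp add: mag_def)

lemma tsir_eq_0: "x \<in> c00 \<Longrightarrow> tsir x = 0 \<longleftrightarrow> x = (\<lambda>_. 0)"
proof
  assume x: "x \<in> c00" "tsir x = 0"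
  show "x = (\<lambda>_. 0)" using tsir_coord[OF x(1)] x(2) by (intro ext) simp
qed auto

lemma tsir_scale_le:
  assumes "x \<in> c00" shows "tsir (\<lambda>j. c * x j) \<le> \<bar>c\<bar> * tsir x"
proof (rule tsir_leI)
  fix g assume g: "g \<in> norming"
  have "mag (\<lambda>j. c * x j) = (\<lambda>j. \<bar>c\<bar> * mag x j)" by (simp add: mag_def abs_mult)
  then have "pairing g (mag (\<lambda>j. c * x j)) = \<bar>c\<bar> * pairing g (mag x)"
    by (simp add: pairing_scale_right)
  then show "pairing g (mag (\<lambda>j. c * x j)) \<le> \<bar>c\<bar> * tsir x"
    using tsir_upper[OF assms g] by (simp add: mult_left_mono)
qed (use assms in simp)

lemma tsir_scale:
  assumes "x \<in> c00" shows "tsir (\<lambda>j. c * x j) = \<bar>c\<bar> * tsir x"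
proof (cases "c = 0")
  case False
  have "tsir (\<lambda>j. (1/c) * (c * x j)) \<le> \<bar>1/c\<bar> * tsir (\<lambda>j. c * x j)"
    by (rule tsir_scale_le) (use assms in simp)
  then have "\<bar>c\<bar> * tsir x \<le> tsir (\<lambda>j. c * x j)" using False by (simp add: field_simps)
  then show ?thesis using tsir_scale_le[OF assms, of c] by simp
qed simp

lemma tsir_add:
  assumes "x \<in> c00" "y \<in> c00" shows "tsir (\<lambda>j. x j + y j) \<le> tsir x + tsir y"
proof (rule tsir_leI)
  fix g assume g: "g \<in> norming"
  have "pairing g (mag (\<lambda>j. x j + y j)) \<le> pairing g (\<lambda>j. mag x j + mag y j)"
    using g norming_range by (intro pairing_mono_right c00_add c00_mag assms) (auto simp: mag_apply)
  also have "\<dots> = pairing g (mag x) + pairing g (mag y)"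
    using assms by (simp add: pairing_add_right)
  finally show "pairing g (mag (\<lambda>j. x j + y j)) \<le> tsir x + tsir y"
    using tsir_upper[OF assms(1) g] tsir_upper[OF assms(2) g] by simp
qed (use assms in simp)

lemma tsir_sum:
  "finite A \<Longrightarrow> (\<And>i. i \<in> A \<Longrightarrow> x i \<in> c00) \<Longrightarrow> tsir (\<lambda>j. \<Sum>i\<in>A. x i j) \<le> (\<Sum>i\<in>A. tsir (x i))"
proof (induction A rule: finite_induct)
  case (insert a A)
  then show ?case using tsir_add[of "x a" "\<lambda>j. \<Sum>i\<in>A. x i j"] by (force intro: c00_sum)
qed simp

lemma unitv_apply: "unitv i j = (if j = i then 1 else 0)"
  by (simp add: unitv_def)

lemma tsir_unitv: "tsir (unitv t) = 1"
proof -
  have "pairing (\<lambda>_. 1) (mag (unitv t)) = (\<Sum>j\<in>{t}. 1 * mag (unitv t) j)"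
    by (rule pairing_eq_sum) (auto simp: mag_apply unitv_apply)
  then have "tsir (unitv t) \<le> 1"
    using tsir_le_l1[of "unitv t"] by (simp add: mag_apply unitv_apply)
  then show ?thesis using tsir_coord[of "unitv t" t] by (simp add: unitv_apply)
qed

text \<open>Almost norming functionals of the pieces, cut down to the sets \<open>E l\<close>,
  become the children of a single node; the factor 2 undoes the \<open>1/2\<close> of that node.
  Unlike in \<open>admissible\<close>, the sets may be empty and need not be finite.\<close>

lemma tsir_family:
  assumes x: "x \<in> c00"
    and k: "\<And>l j. l < k \<Longrightarrow> j \<in> E l \<Longrightarrow> k \<le> Suc j"
    and succ: "\<And>l l' i j. l < l' \<Longrightarrow> l' < k \<Longrightarrow> i \<in> E l \<Longrightarrow> j \<in> E l' \<Longrightarrow> i < j"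
  shows "(\<Sum>l<k. tsir (restr (E l) x)) \<le> 2 * tsir x"
proof (rule field_le_epsilon)
  fix e :: real assume e: "e > 0"
  have "\<exists>g. g \<in> norming \<and> tsir (restr (E l) x) < pairing g (mag (restr (E l) x)) + e / Suc k" for l
    using tsir_approx[of "restr (E l) x" "e / Suc k"] x e by (metis c00_restr divide_pos_pos of_nat_0_less_iff zero_less_Suc)
  then obtain g where g: "\<And>l. g l \<in> norming"
      "\<And>l. tsir (restr (E l) x) < pairing (g l) (mag (restr (E l) x)) + e / Suc k" by metis
  let ?h = "\<lambda>j. 1/2 * (\<Sum>l<k. restr (E l) (g l) j)"
  have "?h \<in> norming"
  proof (rule norming_node)
    show "restr (E l) (g l) \<in> norming" for l using g(1) by (rule norming_restr)
    show "k \<le> Suc j" if "l < k" "restr (E l) (g l) j \<noteq> 0" for l j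
      using that k[of l j] by (auto simp: restr_def split: if_splits)
    show "successive k (\<lambda>l. restr (E l) (g l))"
      using succ unfolding successive_def restr_def by metis
  qed
  have "(\<Sum>l<k. tsir (restr (E l) x)) \<le> (\<Sum>l<k. pairing (restr (E l) (g l)) (mag x) + e / Suc k)"
    using g(2) x by (intro sum_mono) (simp add: pairing_restr_swap restr_mag less_imp_le)
  also have "\<dots> = 2 * pairing ?h (mag x) + k * (e / Suc k)"
    unfolding pairing_scale_left pairing_sum_left by (simp add: sum.distrib)
  also have "\<dots> \<le> 2 * tsir x + e"
  proof -
    have "k * (e / Suc k) \<le> e" using e by (simp add: field_simps)
    then show ?thesis using tsir_upper[OF x \<open>?h \<in> norming\<close>] by linarith
  qed
  finally show "(\<Sum>l<k. tsir (restr (E l) x)) \<le> 2 * tsir x + e" .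
qed

section \<open>The implicit equation and its unique solution\<close>

lemma admissible_lt:
  assumes adm: "admissible n Es"
  shows "l < l' \<Longrightarrow> l' < n \<Longrightarrow> i \<in> Es l \<Longrightarrow> j \<in> Es l' \<Longrightarrow> i < j"
proof (induction l' arbitrary: j)
  case (Suc l')
  have fin: "finite (Es l'')" "Es l'' \<noteq> {}" if "l'' < n" for l''
    using adm that unfolding admissible_def by blast+
  have step: "Max (Es l') < Min (Es (Suc l'))" using adm Suc.prems unfolding admissible_def by blast
  have le: "Min (Es (Suc l')) \<le> j" using fin[of "Suc l'"] Suc.prems by simp
  show ?case
  proof (cases "l = l'")
    case True
    then have "i \<le> Max (Es l')" using fin[of l'] Suc.prems by simp
    then show ?thesis using step le by simp
  next
    case False
    have "Max (Es l') \<in> Es l'" using fin[of l'] Suc.prems by simp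
    then have "i < Max (Es l')" using Suc.IH[of "Max (Es l')"] Suc.prems False by simp
    then show ?thesis using step le by simp
  qed
qed simp

lemma admissible_ge:
  assumes adm: "admissible n Es" and "l < n" "j \<in> Es l" shows "n \<le> Suc j"
proof -
  have fin: "finite (Es 0)" "Es 0 \<noteq> {}" and m: "n \<le> Min (Es 0) + 1"
    using adm assms(2) by (auto simp: admissible_def)
  have "Min (Es 0) \<le> j"
  proof (cases "l = 0")
    case True then show ?thesis using fin assms by simp
  next
    case False
    then show ?thesis
      using admissible_lt[OF adm, of 0 l "Min (Es 0)" j] assms fin by simp
  qed
  then show ?thesis using m by simp
qed

lemma sup_norm_bdd: assumes "x \<in> c00" shows "bdd_above (range (\<lambda>j. \<bar>x j\<bar>))"
  using tsir_coord[OF assms] by (rule bdd_aboveI2)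

lemma sup_norm_upper: "x \<in> c00 \<Longrightarrow> \<bar>x j\<bar> \<le> sup_norm x"
  unfolding sup_norm_def by (rule cSup_upper) (auto intro: sup_norm_bdd)

abbreviation adm_sums :: "((nat \<Rightarrow> real) \<Rightarrow> real) \<Rightarrow> (nat \<Rightarrow> real) \<Rightarrow> real set" where
  "adm_sums f x \<equiv> {(\<Sum>j<n. f (restr (Es j) x)) | n Es. admissible n Es}"

lemma adm_sumsE:
  assumes "v \<in> adm_sums f x"
  obtains n Es where "v = (\<Sum>j<n. f (restr (Es j) x))" "admissible n Es"
  using assms unfolding mem_Collect_eq by (elim exE conjE) (rule that)

lemma adm_sums_nonempty: "adm_sums f x \<noteq> {}"
proof -
  have "admissible 1 (\<lambda>_. {0})" by (simp add: admissible_def)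
  then show ?thesis by blast
qed

text \<open>The children of a node need not form an admissible family: some may miss the support of
  \<open>x\<close>, and \<open>admissible\<close> demands nonempty finite sets. Those children
  contribute nothing and are dropped; the others are renumbered increasingly, and having fewer of
  them only relaxes the condition on the first set. The \<open>max\<close> with 0 covers the case
  that no child survives.\<close>

lemma tsir_family_le_Sup:
  assumes x: "x \<in> c00" and b: "bdd_above (adm_sums tsir x)"
    and k: "\<forall>l<k. \<forall>j. h l j \<noteq> 0 \<longrightarrow> k \<le> Suc j" and s: "successive k h"
    and h: "\<And>l. l < k \<Longrightarrow> h l \<in> norming"
  shows "(\<Sum>l<k. pairing (h l) (mag x)) \<le> max (Sup (adm_sums tsir x)) 0"
proof -
  define E where "E l = {j. h l j \<noteq> 0 \<and> x j \<noteq> 0}" for l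
  define P where "P = {l. l < k \<and> E l \<noteq> {}}"
  have finE: "finite (E l)" for l
    by (rule finite_subset[of _ "{j. x j \<noteq> 0}"]) (use x in \<open>auto simp: E_def c00_def\<close>)
  have "finite P" unfolding P_def by simp
  then obtain \<phi> where \<phi>: "bij_betw \<phi> {..<card P} P" "strict_mono_on {..<card P} \<phi>"
    by (rule ex_bij_betw_strict_mono_card)
  have pr: "pairing (h l) (mag x) = pairing (h l) (mag (restr (E l) x))" for l
  proof -
    have fin: "finite {j. x j \<noteq> 0}" using x by (simp add: c00_def)
    show ?thesis
      by (subst (1 2) pairing_eq_sum[OF fin]) (auto simp: restr_apply mag_apply E_def intro: sum.cong)
  qed
  have nil: "pairing (h l) (mag x) = 0" if "l < k" "l \<notin> P" for l
  proof -
    have "E l = {}" using that by (auto simp: P_def)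
    then have "mag (restr (E l) x) = (\<lambda>_. 0)" by (intro ext) (simp add: mag_apply restr_apply)
    then show ?thesis unfolding pr by simp
  qed
  have "(\<Sum>l<k. pairing (h l) (mag x)) = (\<Sum>l\<in>P. pairing (h l) (mag x))"
    using nil by (intro sum.mono_neutral_right) (auto simp: P_def)
  also have "\<dots> \<le> (\<Sum>l\<in>P. tsir (restr (E l) x))"
    unfolding pr by (intro sum_mono tsir_upper) (use x h in \<open>auto simp: P_def\<close>)
  also have "\<dots> = (\<Sum>i<card P. tsir (restr (E (\<phi> i)) x))"
    using sum.reindex_bij_betw[OF \<phi>(1), of "\<lambda>l. tsir (restr (E l) x)"]
    by simp
  also have "\<dots> \<le> max (Sup (adm_sums tsir x)) 0"
  proof (cases "card P = 0")
    case False
    have inP: "\<phi> i \<in> P" if "i < card P" for i using \<phi>(1) that by (auto simp: bij_betw_def)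
    have ne: "E (\<phi> i) \<noteq> {}" if "i < card P" for i using inP[OF that] by (simp add: P_def)
    have lt: "i' < j'" if "i < j" "j < card P" "i' \<in> E (\<phi> i)" "j' \<in> E (\<phi> j)" for i j i' j'
    proof -
      have "\<phi> i < \<phi> j" using \<phi>(2) that by (auto simp: strict_mono_on_def)
      moreover have "\<phi> j < k" using inP that by (auto simp: P_def)
      ultimately show ?thesis using s that unfolding successive_def E_def by blast
    qed
    have "card P \<le> k" using card_mono[of "{..<k}" P] by (auto simp: P_def)
    moreover have "k \<le> Suc (Min (E (\<phi> 0)))"
    proof -
      have "\<phi> 0 \<in> P" using inP False by simp
      then have "Min (E (\<phi> 0)) \<in> E (\<phi> 0)" "\<phi> 0 < k" using finE by (auto simp: P_def)
      then show ?thesis using k by (auto simp: E_def)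
    qed
    moreover have "Max (E (\<phi> i)) < Min (E (\<phi> (Suc i)))" if "Suc i < card P" for i
    proof -
      have "\<phi> i \<in> P" "\<phi> (Suc i) \<in> P" using inP that by auto
      then have "Max (E (\<phi> i)) \<in> E (\<phi> i)" "Min (E (\<phi> (Suc i))) \<in> E (\<phi> (Suc i))"
        using finE by (auto simp: P_def)
      then show ?thesis using lt[of i "Suc i"] that by blast
    qed
    ultimately have "admissible (card P) (\<lambda>i. E (\<phi> i))"
      unfolding admissible_def using False finE ne by (intro conjI) (blast | linarith)+
    then have "(\<Sum>i<card P. tsir (restr (E (\<phi> i)) x)) \<in> adm_sums tsir x"
      by (intro CollectI exI[of _ "card P"] exI[of _ "\<lambda>i. E (\<phi> i)"] conjI refl)
    then show ?thesis using cSup_upper[OF _ b] by (simp add: le_max_iff_disj)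
  qed simp
  finally show ?thesis .
qed

text \<open>Splitting a norming functional at its root gives the upper estimate; single coordinates
  and the gluing in \<open>tsir_family\<close> give the lower one.\<close>

lemma tsir_tsirelson_eq: "tsirelson_eq tsir"
  unfolding tsirelson_eq_def
proof
  fix x :: "nat \<Rightarrow> real" assume x: "x \<in> c00"
  have le2: "v \<le> 2 * tsir x" if "v \<in> adm_sums tsir x" for v
  proof -
    from that obtain n Es where v: "v = (\<Sum>j<n. tsir (restr (Es j) x))" "admissible n Es"
        by (rule adm_sumsE)
    show ?thesis unfolding v(1)
      by (rule tsir_family[OF x]) (rule admissible_ge[OF v(2)] admissible_lt[OF v(2)]; assumption)+
  qed
  have b: "bdd_above (adm_sums tsir x)" using le2 by (rule bdd_aboveI)
  have S: "Sup (adm_sums tsir x) \<le> 2 * tsir x" using adm_sums_nonempty le2 by (rule cSup_least)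
  have sn: "sup_norm x \<le> tsir x" unfolding sup_norm_def
    by (rule cSup_least) (use tsir_coord[OF x] in auto)
  have sn0: "0 \<le> sup_norm x" using sup_norm_upper[OF x, of 0] by simp
  have "tsir x \<le> max (sup_norm x) (1/2 * Sup (adm_sums tsir x))"
  proof (rule tsir_leI[OF x])
    fix g assume "g \<in> norming"
    then obtain m where "g \<in> norming_level m" by (auto simp: norming_def)
    then show "pairing g (mag x) \<le> max (sup_norm x) (1/2 * Sup (adm_sums tsir x))"
    proof (cases rule: norming_level_cases)
      case 1 then show ?thesis using sn0 by simp
    next
      case (2 t)
      then show ?thesis using sup_norm_upper[OF x, of t] x
        by (simp add: pairing_unitv) (simp add: mag_apply)
    next
      case (3 m' k h)
      have "pairing g (mag x) = 1/2 * (\<Sum>l<k. pairing (h l) (mag x))"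
        unfolding 3(2) pairing_scale_left pairing_sum_left ..
      moreover have "(\<Sum>l<k. pairing (h l) (mag x)) \<le> max (Sup (adm_sums tsir x)) 0"
        by (rule tsir_family_le_Sup[OF x b 3(4,5)]) (use 3(3) in \<open>auto simp: norming_def\<close>)
      ultimately show ?thesis using sn0 by linarith
    qed
  qed
  then show "tsir x = max (sup_norm x) (1/2 * Sup (adm_sums tsir x))" using S sn by linarith
qed

text \<open>Different members of an admissible family that meet the support \<open>D\<close> of
  \<open>x\<close> meet it in different sets, so every admissible sum is dominated by the sum over
  all subsets of \<open>D\<close>. This makes the supremum in the implicit equation meaningful for
  any norm, as uniqueness requires.\<close>

lemma norm_adm_sums_bdd:
  assumes g: "is_norm_on_c00 g" and x: "x \<in> c00"
  shows "bdd_above (adm_sums g x)"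
proof (rule bdd_aboveI)
  fix v assume "v \<in> adm_sums g x"
  then obtain n Es where v: "v = (\<Sum>j<n. g (restr (Es j) x))" "admissible n Es"
    by (rule adm_sumsE)
  define D where "D = {j. x j \<noteq> 0}"
  have fin: "finite D" using x by (simp add: D_def c00_def)
  define P where "P = {j. j < n \<and> Es j \<inter> D \<noteq> {}}"
  have g0: "g (\<lambda>_. 0) = 0" using g by (auto simp: is_norm_on_c00_def)
  have gn: "0 \<le> g (restr B x)" for B using g x by (auto simp: is_norm_on_c00_def)
  have eq: "restr A x = restr (A \<inter> D) x" for A by (auto simp: restr_def D_def)
  have inj: "inj_on (\<lambda>j. Es j \<inter> D) P"
  proof (rule inj_onI)
    fix i j assume ij: "i \<in> P" "j \<in> P" "Es i \<inter> D = Es j \<inter> D"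
    then obtain p where "p \<in> Es i" "p \<in> Es j" by (auto simp: P_def)
    then show "i = j"
      using admissible_lt[OF v(2), of i j p p] admissible_lt[OF v(2), of j i p p] ij
      by (cases i j rule: linorder_cases) (auto simp: P_def)
  qed
  have "g (restr (Es j) x) = 0" if "j < n" "j \<notin> P" for j
  proof -
    have "Es j \<inter> D = {}" using that by (auto simp: P_def)
    then have "restr (Es j) x = (\<lambda>_. 0)" unfolding eq[of "Es j"] by (simp add: restr_def)
    then show ?thesis using g0 by simp
  qed
  then have "v = (\<Sum>j\<in>P. g (restr (Es j \<inter> D) x))"
    unfolding v(1) eq[symmetric] by (intro sum.mono_neutral_right) (auto simp: P_def)
  also have "\<dots> = (\<Sum>B\<in>(\<lambda>j. Es j \<inter> D) ` P. g (restr B x))"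
    by (simp add: sum.reindex[OF inj])
  also have "\<dots> \<le> (\<Sum>B\<in>Pow D. g (restr B x))"
    by (rule sum_mono2) (use fin gn in auto)
  finally show "v \<le> (\<Sum>B\<in>Pow D. g (restr B x))" .
qed

text \<open>Induction on the size of the support. The only families out of reach of the induction
  hypothesis are those in which one set contains the whole support; they return \<open>f x\<close>
  itself, and since the equation halves it, this cannot be where a positive value \<open>f x\<close>
  is attained.\<close>

lemma tsirelson_unique_le:
  assumes f: "is_norm_on_c00 f" "tsirelson_eq f" and g: "is_norm_on_c00 g" "tsirelson_eq g"
  shows "x \<in> c00 \<Longrightarrow> f x \<le> g x"
proof (induction "card {j. x j \<noteq> 0}" arbitrary: x rule: less_induct)
  case less
  note x = less.prems
  define D where "D = {j. x j \<noteq> 0}"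
  have fin: "finite D" using x by (simp add: D_def c00_def)
  have f0: "f (\<lambda>_. 0) = 0" using f by (auto simp: is_norm_on_c00_def)
  have g0: "g (\<lambda>_. 0) = 0" using g by (auto simp: is_norm_on_c00_def)
  show ?case
  proof (cases "x = (\<lambda>_. 0)")
    case True then show ?thesis using f0 g0 by simp
  next
    case False
    then have pos: "f x > 0" using f x unfolding is_norm_on_c00_def by (metis less_eq_real_def)
    have "v \<le> max (f x) (Sup (adm_sums g x))" if "v \<in> adm_sums f x" for v
    proof -
      from that obtain n Es where v: "v = (\<Sum>j<n. f (restr (Es j) x))" "admissible n Es"
        by (rule adm_sumsE)
      show ?thesis
      proof (cases "\<exists>l<n. D \<subseteq> Es l")
        case True
        then obtain l where l: "l < n" "D \<subseteq> Es l" by blast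
        have single: "f (restr (Es j) x) = (if j = l then f x else 0)" if j: "j < n" for j
        proof (cases "j = l")
          case True
          have "i \<in> Es j" if "x i \<noteq> 0" for i using l(2) True that by (auto simp: D_def)
          then have "restr (Es j) x = x" unfolding restr_def by (intro ext) metis
          then show ?thesis using True by simp
        next
          case False
          have "Es j \<inter> D = {}"
          proof (rule ccontr)
            assume "Es j \<inter> D \<noteq> {}"
            then obtain p where "p \<in> Es j" "p \<in> Es l" using l by auto
            then show False
              using admissible_lt[OF v(2), of l j p p] admissible_lt[OF v(2), of j l p p] j l False
              by (cases l j rule: linorder_cases) auto
          qed
          then have "x i = 0" if "i \<in> Es j" for i using that unfolding D_def by blast
          then have "restr (Es j) x = (\<lambda>_. 0)" unfolding restr_def by (intro ext) metis
          then have "f (restr (Es j) x) = 0" using f0 by metis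
          then show ?thesis using False by metis
        qed
        have "v = (\<Sum>j<n. if j = l then f x else 0)"
          unfolding v(1) by (rule sum.cong) (use single in auto)
        then have "v = f x" using l(1) by simp
        then show ?thesis by simp
      next
        case nosub: False
        have "f (restr (Es j) x) \<le> g (restr (Es j) x)" if j: "j < n" for j
        proof (rule less.hyps)
          have "{i. restr (Es j) x i \<noteq> 0} \<subset> D" using nosub j by (auto simp: restr_def D_def)
          then show "card {i. restr (Es j) x i \<noteq> 0} < card {i. x i \<noteq> 0}"
            using fin by (simp add: D_def psubset_card_mono)
        qed (use x in simp)
        then have "v \<le> (\<Sum>j<n. g (restr (Es j) x))" unfolding v(1) by (intro sum_mono) auto
        also have "\<dots> \<le> Sup (adm_sums g x)"
          by (rule cSup_upper[OF _ norm_adm_sums_bdd[OF g(1) x]])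
            (intro CollectI exI[of _ n] exI[of _ Es] conjI refl v(2))
        finally show ?thesis by simp
      qed
    qed
    then have "Sup (adm_sums f x) \<le> max (f x) (Sup (adm_sums g x))"
      by (intro cSup_least adm_sums_nonempty)
    moreover have "f x = max (sup_norm x) (1/2 * Sup (adm_sums f x))"
      using f(2) x unfolding tsirelson_eq_def by blast
    moreover have "g x = max (sup_norm x) (1/2 * Sup (adm_sums g x))"
      using g(2) x unfolding tsirelson_eq_def by blast
    ultimately show ?thesis using pos by linarith
  qed
qed

lemma tsir_is_norm: "is_norm_on_c00 tsir"
  unfolding is_norm_on_c00_def using tsir_eq_0 tsir_scale tsir_add by auto

lemma T_norm_eq_tsir: "T_norm = tsir"
  unfolding T_norm_def
proof (rule the_equality)
  show "is_norm_on_c00 tsir \<and> tsirelson_eq tsir \<and> (\<forall>x. x \<notin> c00 \<longrightarrow> tsir x = 0)"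
    using tsir_is_norm tsir_tsirelson_eq by (auto simp: tsir_def)
  fix f assume f: "is_norm_on_c00 f \<and> tsirelson_eq f \<and> (\<forall>x. x \<notin> c00 \<longrightarrow> f x = 0)"
  then have f1: "is_norm_on_c00 f" and f2: "tsirelson_eq f" and f3: "\<And>x. x \<notin> c00 \<Longrightarrow> f x = 0"
    by simp_all
  show "f = tsir"
  proof
    fix x show "f x = tsir x"
    proof (cases "x \<in> c00")
      case True
      then show ?thesis
        by (intro antisym tsirelson_unique_le f1 f2 tsir_is_norm tsir_tsirelson_eq)
    next
      case False then show ?thesis using f3 by (simp add: tsir_def)
    qed
  qed
qed

subsection \<open>Maxima of norming functionals\<close>

text \<open>The half-open interval from the cut point \<open>s\<close> to the next cut point,
  unbounded if there is none.\<close>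

definition cell :: "nat set \<Rightarrow> nat \<Rightarrow> nat set" where
  "cell S s = {p. s \<le> p \<and> (\<forall>s'\<in>S. s' \<le> p \<longrightarrow> s' \<le> s)}"

lemma cell_exists:
  assumes "finite S" "s \<in> S" "s \<le> p"
  obtains s0 where "s0 \<in> S" "s \<le> s0" "p \<in> cell S s0" "\<And>s'. s' \<in> S \<Longrightarrow> p \<in> cell S s' \<Longrightarrow> s' = s0"
proof -
  let ?A = "{s \<in> S. s \<le> p}"
  have A: "finite ?A" "s \<in> ?A" using assms by auto
  then have M: "Max ?A \<in> ?A" using Max_in by blast
  have "s' \<le> Max ?A" if "s' \<in> S" "s' \<le> p" for s' using A that by simp
  then have "p \<in> cell S (Max ?A)" using M by (auto simp: cell_def)
  moreover have "s' = Max ?A" if "s' \<in> S" "p \<in> cell S s'" for s'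
    using that M A(1) by (intro antisym) (auto simp: cell_def)
  moreover have "s \<le> Max ?A" using A by (rule Max_ge)
  ultimately show ?thesis using that[of "Max ?A"] M by blast
qed

lemma tsir_cells:
  assumes x: "x \<in> c00" and fin: "finite S" and S: "\<And>s. s \<in> S \<Longrightarrow> card S \<le> Suc s"
  shows "(\<Sum>s\<in>S. tsir (restr (cell S s) x)) \<le> 2 * tsir x"
proof -
  obtain h where h: "bij_betw h {..<card S} S" "strict_mono_on {..<card S} h"
    using fin by (rule ex_bij_betw_strict_mono_card)
  have inS: "h l \<in> S" if "l < card S" for l using h(1) that by (auto simp: bij_betw_def)
  have "(\<Sum>s\<in>S. tsir (restr (cell S s) x)) = (\<Sum>l<card S. tsir (restr (cell S (h l)) x))"
    using sum.reindex_bij_betw[OF h(1), of "\<lambda>s. tsir (restr (cell S s) x)"] by simp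
  also have "\<dots> \<le> 2 * tsir x"
  proof (rule tsir_family[OF x])
    fix l j assume "l < card S" "j \<in> cell S (h l)"
    then show "card S \<le> Suc j" using S[OF inS] by (fastforce simp: cell_def)
  next
    fix l l' i j assume *: "l < l'" "l' < card S" "i \<in> cell S (h l)" "j \<in> cell S (h l')"
    then have "h l < h l'" using h(2) by (auto simp: strict_mono_on_def)
    moreover have "h l' \<in> S" using * inS by blast
    ultimately show "i < j" using * unfolding cell_def
      by (smt (verit) leD le_less_trans linorder_le_less_linear mem_Collect_eq order_less_le_trans)
  qed
  finally show ?thesis .
qed

lemma pairing_cells:
  assumes x: "x \<in> c00" and fin: "finite S" and S: "\<And>p. h p \<noteq> 0 \<Longrightarrow> \<exists>s\<in>S. s \<le> p"
  shows "pairing h (mag x) = (\<Sum>s\<in>S. pairing h (mag (restr (cell S s) x)))"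
proof -
  have "(\<Sum>s\<in>S. pairing h (mag (restr (cell S s) x)))
      = pairing h (\<lambda>j. \<Sum>s\<in>S. mag (restr (cell S s) x) j)"
    using fin x by (simp add: pairing_sum_right)
  also have "\<dots> = (\<Sum>j\<in>{j. x j \<noteq> 0}. h j * (\<Sum>s\<in>S. mag (restr (cell S s) x) j))"
    by (rule pairing_eq_sum) (use x in \<open>auto simp: c00_def mag_apply restr_apply intro!: sum.neutral\<close>)
  also have "\<dots> = (\<Sum>j\<in>{j. x j \<noteq> 0}. h j * mag x j)"
  proof (rule sum.cong[OF refl])
    fix j
    show "h j * (\<Sum>s\<in>S. mag (restr (cell S s) x) j) = h j * mag x j"
    proof (cases "h j = 0")
      case False
      then obtain s where s: "s \<in> S" "s \<le> j" using S by blast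
      obtain s0 where s0: "s0 \<in> S" "j \<in> cell S s0" "\<And>s'. s' \<in> S \<Longrightarrow> j \<in> cell S s' \<Longrightarrow> s' = s0"
        using cell_exists[OF fin s] by metis
      have "j \<in> cell S s \<longleftrightarrow> s = s0" if "s \<in> S" for s using s0(2,3) that by blast
      then have "mag (restr (cell S s) x) j = (if s = s0 then mag x j else 0)" if "s \<in> S" for s
        using that by (simp add: mag_apply restr_apply)
      then have "(\<Sum>s\<in>S. mag (restr (cell S s) x) j) = (\<Sum>s\<in>S. if s = s0 then mag x j else 0)"
        by (rule sum.cong[OF refl])
      then show ?thesis using s0(1) fin by simp
    qed simp
  qed
  also have "\<dots> = pairing h (mag x)"
    by (rule pairing_eq_sum[symmetric]) (use x in \<open>auto simp: c00_def mag_apply\<close>)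
  finally show ?thesis by simp
qed

text \<open>The positive part of the ball of radius 4 in \<open>T*\<close>. The radius reproduces
  itself in the induction below: a node halves it, and cutting into cells by
  \<open>tsir_cells\<close> doubles it again.\<close>

definition dual_ball4 :: "(nat \<Rightarrow> real) set" where
  "dual_ball4 = {h. (\<forall>p. 0 \<le> h p) \<and> (\<forall>x\<in>c00. pairing h (mag x) \<le> 4 * tsir x)}"

text \<open>With \<open>k = Suc s\<close> the support has length at most \<open>k * k\<close> and is
  covered by \<open>k\<close> intervals of length \<open>k\<close> starting at \<open>s\<close>. The
  singletons within one interval form an admissible family, and so do the \<open>k\<close>
  intervals; each of the two levels costs a factor 2.\<close>

lemma l1_interval_le_tsir:
  assumes x: "x \<in> c00" and L: "L \<le> Suc s" and supp: "\<And>p. x p \<noteq> 0 \<Longrightarrow> s \<le> p \<and> p < L * Suc s"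
  shows "pairing (\<lambda>_. 1) (mag x) \<le> 4 * tsir x"
proof -
  define k where "k = Suc s"
  define E where "E i = {s + i * k..<s + i * k + k}" for i
  have Lk: "L * k \<le> k * k" unfolding k_def using L by (rule mult_le_mono1)
  have "pairing (\<lambda>_. 1) (mag x) = (\<Sum>p\<in>{s..<s + k * k}. 1 * mag x p)"
  proof (rule pairing_eq_sum)
    fix p assume "p \<notin> {s..<s + k * k}"
    then have "x p = 0" using supp[of p] Lk unfolding k_def[symmetric] by fastforce
    then show "mag x p = 0" by (simp add: mag_apply)
  qed simp
  also have "\<dots> = (\<Sum>p\<in>{0 + s..<k * k + s}. mag x p)" by (simp add: add.commute)
  also have "\<dots> = (\<Sum>q<k * k. mag x (q + s))"
    unfolding sum.shift_bounds_nat_ivl by (simp add: atLeast0LessThan)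
  also have "\<dots> = (\<Sum>i<k. \<Sum>q\<in>{i * k..<i * k + k}. mag x (q + s))"
    by (rule sum.nat_group[symmetric])
  also have "\<dots> = (\<Sum>i<k. \<Sum>l<k. mag x (l + i * k + s))"
  proof (rule sum.cong[OF refl])
    fix i
    have "{i * k..<i * k + k} = {0 + i * k..<k + i * k}" by (simp add: add.commute)
    then show "(\<Sum>q\<in>{i * k..<i * k + k}. mag x (q + s)) = (\<Sum>l<k. mag x (l + i * k + s))"
      using sum.shift_bounds_nat_ivl[of "\<lambda>q. mag x (q + s)" 0 "i * k" k]
      by (simp add: atLeast0LessThan)
  qed
  also have "\<dots> \<le> (\<Sum>i<k. 2 * tsir (restr (E i) x))"
  proof (rule sum_mono)
    fix i assume "i \<in> {..<k}"
    have "(\<Sum>l<k. mag x (l + i * k + s)) \<le> (\<Sum>l<k. tsir (restr {l + i * k + s} (restr (E i) x)))"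
    proof (rule sum_mono)
      fix l assume l: "l \<in> {..<k}"
      have "mag x (l + i * k + s) = \<bar>restr {l + i * k + s} (restr (E i) x) (l + i * k + s)\<bar>"
        using l by (simp add: E_def restr_apply mag_apply)
      also have "\<dots> \<le> tsir (restr {l + i * k + s} (restr (E i) x))"
        using x by (intro tsir_coord) simp
      finally show "mag x (l + i * k + s) \<le> tsir (restr {l + i * k + s} (restr (E i) x))" .
    qed
    also have "\<dots> \<le> 2 * tsir (restr (E i) x)"
      by (rule tsir_family) (use x in \<open>auto simp: k_def\<close>)
    finally show "(\<Sum>l<k. mag x (l + i * k + s)) \<le> 2 * tsir (restr (E i) x)" .
  qed
  also have "\<dots> = 2 * (\<Sum>i<k. tsir (restr (E i) x))" by (simp add: sum_distrib_left)
  also have "(\<Sum>i<k. tsir (restr (E i) x)) \<le> 2 * tsir x"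
  proof (rule tsir_family[OF x])
    fix l l' i j assume *: "l < l'" "i \<in> E l" "j \<in> E l'"
    have "Suc l * k \<le> l' * k" using *(1) by (intro mult_le_mono1) simp
    then show "i < j" using * by (auto simp: E_def)
  qed (auto simp: E_def k_def)
  finally show ?thesis by simp
qed

text \<open>The functionals whose maximum is taken need not have disjoint ranges, so their maximum is not itself a
  norming functional. The factor \<open>2 * n + 2\<close> leaves enough room to cut at the starting points of all
  children simultaneously; \<open>\<tau>\<close> bounds the number of children of each functional.\<close>

definition maxima_bounded :: "nat \<Rightarrow> (nat \<Rightarrow> real) set \<Rightarrow> bool" where
  "maxima_bounded n M \<longleftrightarrow> (\<forall>\<tau> k g h. 1 \<le> \<tau> \<longrightarrow>
     (\<forall>j<n. k j \<le> \<tau> \<and> (\<forall>l<k j. g j l \<in> M) \<and> successive (k j) (g j)) \<longrightarrow>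
     (\<forall>p. 0 \<le> h p) \<longrightarrow>
     (\<forall>p. h p \<noteq> 0 \<longrightarrow> (2 * n + 2) * \<tau> \<le> p \<and> (\<exists>j<n. h p \<le> 1/2 * (\<Sum>l<k j. g j l p))) \<longrightarrow>
     h \<in> dual_ball4)"

text \<open>Without functionals there are no children and \<open>h\<close> vanishes. Starting the
  induction here lets the inductive step also handle level 0, whose members have no
  children.\<close>

lemma maxima_bounded_empty: "maxima_bounded n {}"
proof -
  have "h = (\<lambda>_. 0)"
    if h: "\<forall>p. 0 \<le> h p" "\<forall>j<n. \<forall>l<k j. g j l \<in> {}"
      "\<forall>p. h p \<noteq> 0 \<longrightarrow> (\<exists>j<n. h p \<le> 1/2 * (\<Sum>l<k j. g j l p))"
    for h :: "nat \<Rightarrow> real" and k :: "nat \<Rightarrow> nat" and g :: "nat \<Rightarrow> nat \<Rightarrow> nat \<Rightarrow> real"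
  proof
    fix p
    have "k j = 0" if "j < n" for j using h(2) that by auto
    then show "h p = 0" using h(1,3) by (metis antisym lessThan_0 mult_zero_right sum.empty)
  qed
  moreover have "(\<lambda>_. 0) \<in> dual_ball4" by (simp add: dual_ball4_def)
  ultimately show ?thesis unfolding maxima_bounded_def by (smt (verit, best))
qed

text \<open>Cut at the starting point \<open>t\<close> of every child and at the corresponding \<open>L * Suc t\<close>. Between
  \<open>t\<close> and \<open>L * Suc t\<close> the Tsirelson norm is equivalent to the \<open>\<ell>\<^sub>1\<close> norm. Beyond \<open>L * Suc t\<close> every child that is
  active started at or before \<open>t\<close>, so it can be replaced by its at most \<open>Suc t\<close> own children. No constant is lost,
  because the leaves of the resulting tree are all of the first kind.\<close>

lemma maxima_bounded_step:
  assumes M: "maxima_bounded n M"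
    and range: "\<And>f p. f \<in> M' \<Longrightarrow> 0 \<le> f p \<and> f p \<le> 1"
    and cases: "\<And>f. f \<in> M' \<Longrightarrow> f = (\<lambda>_. 0) \<or> (\<exists>t. f = unitv t) \<or>
      (\<exists>k g. f = (\<lambda>p. 1/2 * (\<Sum>l<k. g l p)) \<and> (\<forall>l<k. g l \<in> M) \<and>
         (\<forall>l<k. \<forall>p. g l p \<noteq> 0 \<longrightarrow> k \<le> Suc p) \<and> successive k g)"
  shows "maxima_bounded n M'"
  unfolding maxima_bounded_def
proof (intro allI impI)
  fix \<tau> k g h
  define L where "L = 2 * n + 2"
  assume \<tau>: "1 \<le> \<tau>" and g: "\<forall>j<n. k j \<le> \<tau> \<and> (\<forall>l<k j. g j l \<in> M') \<and> successive (k j) (g j)"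
    and h0: "\<forall>p. 0 \<le> h p"
    and h': "\<forall>p. h p \<noteq> 0 \<longrightarrow> (2 * n + 2) * \<tau> \<le> p \<and> (\<exists>j<n. h p \<le> 1/2 * (\<Sum>l<k j. g j l p))"
  have h: "L * \<tau> \<le> p" "\<exists>j<n. h p \<le> 1/2 * (\<Sum>l<k j. g j l p)" if "h p \<noteq> 0" for p
    using h' that unfolding L_def by blast+
  define start where "start f = (LEAST s. f s \<noteq> 0)" for f :: "nat \<Rightarrow> real"
  have start: "f (start f) \<noteq> 0" "start f \<le> p" if "f p \<noteq> 0" for f p
    using that LeastI[of "\<lambda>s. f s \<noteq> 0" p] Least_le[of "\<lambda>s. f s \<noteq> 0" p] by (auto simp: start_def)
  define I where "I = Sigma {..<n} (\<lambda>j. {..<k j})"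
  \<comment> \<open>Children that start before \<open>L * \<tau>\<close> need no cut of their own:
    \<open>h\<close> vanishes there, and the cut point \<open>L * \<tau>\<close> in \<open>S\<close>
    stands for all of them.\<close>
  define S0 where "S0 = (\<lambda>(j, l). start (g j l)) ` I \<inter> {L * \<tau>..}"
  define S where "S = insert (L * \<tau>) S0"
  define S' where "S' = S \<union> (\<lambda>s. L * Suc s) ` S"
  have finI: "finite I" by (simp add: I_def)
  have finS: "finite S" using finI by (simp add: S_def S0_def)
  have finS': "finite S'" using finS by (simp add: S'_def)
  have "card I = (\<Sum>j<n. k j)" unfolding I_def by (subst card_SigmaI) auto
  also have "\<dots> \<le> n * \<tau>" using sum_bounded_above[of "{..<n}" k \<tau>] g by simp
  finally have cI: "card I \<le> n * \<tau>" .
  have "card S0 \<le> card ((\<lambda>(j, l). start (g j l)) ` I)"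
    unfolding S0_def by (rule card_mono[OF finite_imageI[OF finI]]) (rule Int_lower1)
  also have "\<dots> \<le> card I" by (rule card_image_le[OF finI])
  finally have "Suc (card S0) \<le> Suc (card I)" by (rule Suc_leI[OF le_imp_less_Suc])
  moreover have "card S \<le> Suc (card S0)" unfolding S_def by (rule card_insert_le_m1) auto
  ultimately have cS: "card S \<le> Suc (card I)" by (rule order_trans[rotated])
  \<comment> \<open>There are at most \<open>n * \<tau>\<close> children, one additional point
    \<open>L * \<tau>\<close>, and a second cut for each of these; \<open>1 \<le> \<tau>\<close>
    absorbs the remaining 2. Hence the number of cells does not exceed the smallest cut point, and
    the cells are admissible.\<close>
  have "card S' \<le> card S + card ((\<lambda>s. L * Suc s) ` S)" unfolding S'_def by (rule card_Un_le)
  also have "\<dots> \<le> Suc (card I) + Suc (card I)"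
    by (rule add_mono[OF cS order_trans[OF card_image_le[OF finS] cS]])
  also have "\<dots> = 2 * (card I + 1)" by simp
  also have "\<dots> \<le> 2 * (n * \<tau> + 1)" by (rule mult_le_mono2[OF add_right_mono[OF cI]])
  also have "\<dots> \<le> L * \<tau>" using \<tau> by (simp add: L_def algebra_simps)
  finally have cardS': "card S' \<le> L * \<tau>" .
  have geS: "L * \<tau> \<le> s" if "s \<in> S" for s using that by (auto simp: S_def S0_def)
  have "s \<le> L * Suc s" for s by (simp add: L_def)
  then have geS': "L * \<tau> \<le> s" if "s \<in> S'" for s using that geS unfolding S'_def by (blast intro: order_trans)
  show "h \<in> dual_ball4" unfolding dual_ball4_def
  proof (intro CollectI conjI ballI h0)
    fix x :: "nat \<Rightarrow> real" assume x: "x \<in> c00"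
    have piece: "pairing h (mag (restr (cell S' s) x)) \<le> 2 * tsir (restr (cell S' s) x)" if s: "s \<in> S'" for s
    proof -
      define y where "y = restr (cell S' s) x"
      have y: "y \<in> c00" using x by (simp add: y_def)
      have "L * \<tau> \<in> S" by (simp add: S_def)
      \<comment> \<open>\<open>t\<close> is the last point of \<open>S\<close> at or before
        \<open>s\<close>. The piece lies in the cell of \<open>t\<close>, where every active child
        has started by \<open>t\<close>.\<close>
      then obtain t where t: "t \<in> S" "s \<in> cell S t" using cell_exists[OF finS _ geS'[OF s]] by metis
      have tL: "L * Suc t \<in> S'" using t(1) unfolding S'_def by blast
      have Lt: "L \<le> Suc t" using geS[OF t(1)] \<tau> by (metis le_SucI le_trans mult.commute mult_le_mono1 nat_mult_1)
      have cS: "p \<in> cell S t" if "p \<in> cell S' s" for p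
        using that t unfolding cell_def S'_def by fastforce
      have start_le: "start (g j l) \<le> t" if "j < n" "l < k j" "p \<in> cell S t" "g j l p \<noteq> 0" for j l p
      proof (rule ccontr)
        assume *: "\<not> start (g j l) \<le> t"
        then have "L * \<tau> \<le> start (g j l)" using geS[OF t(1)] by simp
        then have "start (g j l) \<in> S" using that by (force simp: S_def S0_def I_def)
        moreover have "start (g j l) \<le> p" using start that by blast
        ultimately show False using that(3) * by (auto simp: cell_def)
      qed
      \<comment> \<open>For each \<open>j\<close> at most one child is active in the cell: of two
        active ones, the later starts after a point of the earlier one that is at least
        \<open>t\<close>, although both start by \<open>t\<close>. The nonzero value at some
        \<open>p \<le> t\<close> is recorded because it bounds the number of grandchildren.\<close>
      have uniq: "\<exists>f. (f = (\<lambda>_. 0) \<or> f \<in> M' \<and> (\<exists>p\<le>t. f p \<noteq> 0)) \<and>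
          (\<forall>p\<in>cell S t. (\<Sum>l<k j. g j l p) = f p)" if j: "j < n" for j
      proof (cases "\<exists>l<k j. \<exists>p\<in>cell S t. g j l p \<noteq> 0")
        case True
        then obtain l q where l: "l < k j" "q \<in> cell S t" "g j l q \<noteq> 0" by blast
        have other: "g j l' p = 0" if l': "l' < k j" "l' \<noteq> l" "p \<in> cell S t" for l' p
        proof (rule ccontr)
          assume nz: "g j l' p \<noteq> 0"
          have s1: "start (g j l') \<le> t" "start (g j l) \<le> t"
            using start_le j l' l nz by blast+
          have s2: "g j l' (start (g j l')) \<noteq> 0" "g j l (start (g j l)) \<noteq> 0"
            using start l nz by blast+
          have tp: "t \<le> p" "t \<le> q" using l l' by (auto simp: cell_def)
          have "successive (k j) (g j)" using g j by blast
          then have "l < l' \<Longrightarrow> q < start (g j l')" "l' < l \<Longrightarrow> p < start (g j l)"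
            using l l' nz s2 unfolding successive_def by blast+
          then show False using l'(2) s1 tp by (metis leD le_trans nat_neq_iff)
        qed
        have "(\<Sum>l<k j. g j l p) = g j l p" if "p \<in> cell S t" for p
        proof -
          have "(\<Sum>l'<k j. g j l' p) = (\<Sum>l'<k j. if l' = l then g j l p else 0)"
            using other that by (intro sum.cong) auto
          then show ?thesis using l(1) by simp
        qed
        moreover have "g j l \<in> M'" using g j l by blast
        moreover have "\<exists>p\<le>t. g j l p \<noteq> 0" using start_le[OF j l(1,2,3)] start(1)[of "g j l" q] l(3) by blast
        ultimately show ?thesis by blast
      next
        case False then show ?thesis by (intro exI[of _ "\<lambda>_. 0"]) simp
      qed
      have y0: "y p = 0" if "p \<notin> cell S' s" for p using that by (simp add: y_def restr_apply)
      show "pairing h (mag (restr (cell S' s) x)) \<le> 2 * tsir (restr (cell S' s) x)"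
      \<comment> \<open>In the early region \<open>h\<close> is at most \<open>1/2\<close>, since a
        single child has values at most 1, and the \<open>\<ell>\<^sub>1\<close> comparison has
        constant 4.\<close>
      proof (cases "s < L * Suc t")
        case True
        have "h p \<le> 1/2" if p: "y p \<noteq> 0" for p
        proof (cases "h p = 0")
          case False
          then obtain j where j: "j < n" "h p \<le> 1/2 * (\<Sum>l<k j. g j l p)" using h by blast
          have "p \<in> cell S t" using p y0 cS by blast
          then obtain f where "f = (\<lambda>_. 0) \<or> f \<in> M'" "(\<Sum>l<k j. g j l p) = f p" using uniq[OF j(1)] by blast
          then show ?thesis using j(2) range[of f p] by auto
        qed simp
        then have "pairing h (mag y) \<le> pairing (\<lambda>_. 1/2 * 1) (mag y)"
          by (intro pairing_mono) (auto simp: mag_apply)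
        also have "\<dots> = 1/2 * pairing (\<lambda>_. 1) (mag y)" by (rule pairing_scale_left)
        also have "pairing (\<lambda>_. 1) (mag y) \<le> 4 * tsir y"
        proof (rule l1_interval_le_tsir[OF y Lt])
          fix p assume "y p \<noteq> 0"
          then have p: "p \<in> cell S' s" using y0 by blast
          then have "t \<le> p" using cS by (auto simp: cell_def)
          moreover have "p < L * Suc t" using p tL True by (force simp: cell_def)
          ultimately show "t \<le> p \<and> p < L * Suc t" ..
        qed
        finally show ?thesis by (simp add: y_def)
      next
        case False
        \<comment> \<open>In the late region a unit vector that has started by \<open>t\<close> is
          already over. A node that is nonzero at some \<open>q \<le> t\<close> has at most
          \<open>Suc q\<close> children.\<close>
        have "\<exists>k' g'. k' \<le> Suc t \<and> (\<forall>l<k'. g' l \<in> M) \<and> successive k' g' \<and>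
            (\<forall>p\<in>cell S t. L * Suc t \<le> p \<longrightarrow> (\<Sum>l<k j. g j l p) = 1/2 * (\<Sum>l<k'. g' l p))" if j: "j < n" for j
        proof -
          obtain f where f: "f = (\<lambda>_. 0) \<or> f \<in> M' \<and> (\<exists>p\<le>t. f p \<noteq> 0)"
            "\<And>p. p \<in> cell S t \<Longrightarrow> (\<Sum>l<k j. g j l p) = f p" using uniq[OF j] by blast
          consider (zero) "\<And>p. L * Suc t \<le> p \<Longrightarrow> f p = 0"
            | (node) k' g' q where "f = (\<lambda>p. 1/2 * (\<Sum>l<k'. g' l p))" "\<forall>l<k'. g' l \<in> M"
                "\<forall>l<k'. \<forall>p. g' l p \<noteq> 0 \<longrightarrow> k' \<le> Suc p" "successive k' g'" "q \<le> t" "f q \<noteq> 0"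
          proof (cases "f = (\<lambda>_. 0)")
            case True then show ?thesis using zero by simp
          next
            case False
            with f(1) obtain q where q: "f \<in> M'" "q \<le> t" "f q \<noteq> 0" by blast
            show ?thesis
            proof (cases "\<exists>u. f = unitv u")
              case True
              then have "f = unitv q" using q(3) by (auto simp: unitv_apply split: if_splits)
              moreover have "t < L * Suc t" by (simp add: L_def)
              ultimately show ?thesis using q zero by (simp add: unitv_apply)
            next
              case notu: False
              then show ?thesis using cases[OF q(1)] node q False by blast
            qed
          qed
          then show ?thesis
          proof cases
            case zero
            then show ?thesis using f(2) by (intro exI[of _ 0] exI[of _ undefined]) (simp add: successive_def)
          next
            case node
            from node(1,6) obtain l where "l < k'" "g' l q \<noteq> 0" by (auto elim: sum.not_neutral_contains_not_neutral)
            then have "k' \<le> Suc t" using node(3,5) by (meson Suc_le_mono le_trans)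
            then show ?thesis using node f(2) by (intro exI[of _ k'] exI[of _ g']) auto
          qed
        qed
        then obtain k' g' where g': "\<And>j. j < n \<Longrightarrow> k' j \<le> Suc t \<and> (\<forall>l<k' j. g' j l \<in> M) \<and> successive (k' j) (g' j) \<and>
            (\<forall>p\<in>cell S t. L * Suc t \<le> p \<longrightarrow> (\<Sum>l<k j. g j l p) = 1/2 * (\<Sum>l<k' j. g' j l p))" by metis
        \<comment> \<open>Passing to grandchildren produced another \<open>1/2\<close>, so twice
          \<open>h\<close> satisfies the hypothesis for \<open>M\<close> with \<open>Suc t\<close>
          in place of \<open>\<tau>\<close>; \<open>L * Suc t\<close> is the starting point demanded
          there. The bound 4 for \<open>h1\<close> is the bound 2 for \<open>h\<close>.\<close>
        define h1 where "h1 = (\<lambda>p. 2 * restr (cell S' s) h p)"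
        have "h1 \<in> dual_ball4"
        proof (rule M[unfolded maxima_bounded_def, rule_format, of "Suc t" k' g'])
          fix p assume "h1 p \<noteq> 0"
          then have p: "p \<in> cell S' s" "h p \<noteq> 0" by (auto simp: h1_def restr_apply split: if_splits)
          then have "s \<le> p" by (simp add: cell_def)
          then have Lp: "L * Suc t \<le> p" using False by simp
          obtain j where j: "j < n" "h p \<le> 1/2 * (\<Sum>l<k j. g j l p)" using h p by blast
          have "(\<Sum>l<k j. g j l p) = 1/2 * (\<Sum>l<k' j. g' j l p)"
            using g'[OF j(1)] cS[OF p(1)] Lp by blast
          moreover have "h1 p = 2 * h p" using p(1) by (simp add: h1_def restr_apply)
          ultimately have "h1 p \<le> 1/2 * (\<Sum>l<k' j. g' j l p)" using j(2) by linarith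
          then show "(2 * n + 2) * Suc t \<le> p \<and> (\<exists>j<n. h1 p \<le> 1/2 * (\<Sum>l<k' j. g' j l p))"
            using Lp j(1) unfolding L_def by blast
        qed (use g' h0 in \<open>auto simp: h1_def restr_apply\<close>)
        then have "pairing h1 (mag y) \<le> 4 * tsir y" using y by (simp add: dual_ball4_def)
        moreover have "pairing h1 (mag y) = 2 * pairing h (mag y)"
        proof -
          have "restr (cell S' s) (mag y) = mag y" by (auto simp: restr_def mag_def y_def)
          then show ?thesis unfolding h1_def pairing_scale_left
            using y by (simp add: pairing_restr_swap)
        qed
        ultimately show ?thesis by (simp add: y_def)
      qed
    qed
    have "pairing h (mag x) = (\<Sum>s\<in>S'. pairing h (mag (restr (cell S' s) x)))"
      by (rule pairing_cells[OF x finS']) (use h(1) in \<open>auto simp: S'_def S_def\<close>)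
    also have "\<dots> \<le> (\<Sum>s\<in>S'. 2 * tsir (restr (cell S' s) x))"
      using piece by (rule sum_mono)
    also have "\<dots> = 2 * (\<Sum>s\<in>S'. tsir (restr (cell S' s) x))" by (simp add: sum_distrib_left)
    also have "(\<Sum>s\<in>S'. tsir (restr (cell S' s) x)) \<le> 2 * tsir x"
      by (rule tsir_cells[OF x finS']) (use cardS' geS' in \<open>auto intro: le_SucI order_trans\<close>)
    finally show "pairing h (mag x) \<le> 4 * tsir x" by simp
  qed
qed

lemma maxima_bounded_norming_level: "maxima_bounded n (norming_level m)"
proof (induction m)
  case 0
  show ?case by (rule maxima_bounded_step[OF maxima_bounded_empty]) (use norming_level_range[of _ 0] in auto)
next
  case (Suc m)
  show ?case
  proof (rule maxima_bounded_step[OF Suc.IH])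
    fix f assume f: "f \<in> norming_level (Suc m)"
    show "0 \<le> f p \<and> f p \<le> 1" for p using norming_level_range[OF f] .
    show "f = (\<lambda>_. 0) \<or> (\<exists>t. f = unitv t) \<or>
      (\<exists>k g. f = (\<lambda>p. 1/2 * (\<Sum>l<k. g l p)) \<and> (\<forall>l<k. g l \<in> norming_level m) \<and>
         (\<forall>l<k. \<forall>p. g l p \<noteq> 0 \<longrightarrow> k \<le> Suc p) \<and> successive k g)"
      using f
    proof (cases rule: norming_level_cases)
      case (3 m' k h)
      then show ?thesis by (intro disjI2 exI[of _ k] exI[of _ h]) simp
    qed auto
  qed
qed

text \<open>Each functional is regarded as the only child of a node, with \<open>\<tau> = 1\<close>.
  The node carries \<open>1/2\<close>, so the bound 4 applies to half of \<open>h\<close>.\<close>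

lemma norming_max_le:
  assumes f: "\<And>i. i < n \<Longrightarrow> f i \<in> norming" and x: "x \<in> c00"
    and h0: "\<And>p. 0 \<le> h p"
    and h: "\<And>p. h p \<noteq> 0 \<Longrightarrow> 2 * n + 2 \<le> p \<and> (\<exists>i<n. h p \<le> f i p)"
  shows "pairing h (mag x) \<le> 8 * tsir x"
proof -
  obtain m where m: "\<And>i. i < n \<Longrightarrow> f i \<in> norming_level m" using norming_common[of n f] f by blast
  have "(\<lambda>p. 1/2 * h p) \<in> dual_ball4"
  proof (rule maxima_bounded_norming_level[unfolded maxima_bounded_def, rule_format, of 1 n "\<lambda>_. 1" "\<lambda>i _. f i" m])
    fix p assume "1/2 * h p \<noteq> 0"
    then have "h p \<noteq> 0" by simp
    from h[OF this] show "(2 * n + 2) * 1 \<le> p \<and> (\<exists>i<n. 1/2 * h p \<le> 1/2 * (\<Sum>l<(1::nat). f i p))" by auto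
  qed (use m h0 in \<open>auto simp: successive_def\<close>)
  then have "pairing (\<lambda>p. 1/2 * h p) (mag x) \<le> 4 * tsir x" using x unfolding dual_ball4_def by blast
  then show ?thesis unfolding pairing_scale_left by simp
qed

subsection \<open>The dual norm\<close>

text \<open>The lattice maximum in predual form. The sum of almost norming functionals cut down to
  disjoint sets is pointwise below their maximum. In contrast to \<open>tsir_family\<close> the sets
  may interlace arbitrarily; the price is the later start and the larger constant.\<close>

lemma tsir_disjoint:
  assumes x: "x \<in> c00"
    and ge: "\<And>i p. i < n \<Longrightarrow> p \<in> A i \<Longrightarrow> 2 * n + 2 \<le> p"
    and disj: "\<And>i i' p. i < n \<Longrightarrow> i' < n \<Longrightarrow> p \<in> A i \<Longrightarrow> p \<in> A i' \<Longrightarrow> i = i'"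
  shows "(\<Sum>i<n. tsir (restr (A i) x)) \<le> 8 * tsir x"
proof (rule field_le_epsilon)
  fix e :: real assume e: "e > 0"
  have "\<exists>g. g \<in> norming \<and> tsir (restr (A i) x) < pairing g (mag (restr (A i) x)) + e / Suc n" for i
    using tsir_approx[of "restr (A i) x" "e / Suc n"] x e
    by (metis c00_restr divide_pos_pos of_nat_0_less_iff zero_less_Suc)
  then obtain g where g: "\<And>i. g i \<in> norming"
      "\<And>i. tsir (restr (A i) x) < pairing (g i) (mag (restr (A i) x)) + e / Suc n" by metis
  let ?h = "\<lambda>j. \<Sum>i<n. restr (A i) (g i) j"
  have "pairing ?h (mag x) \<le> 8 * tsir x"
  proof (rule norming_max_le[of n g, OF g(1) x])
    show "0 \<le> ?h p" for p using norming_range[OF g(1)] by (intro sum_nonneg) (simp add: restr_apply)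
    fix p assume "?h p \<noteq> 0"
    then obtain i where i: "i < n" "restr (A i) (g i) p \<noteq> 0"
      by (meson lessThan_iff sum.not_neutral_contains_not_neutral)
    then have pA: "p \<in> A i" by (auto simp: restr_apply split: if_splits)
    have "p \<in> A i' \<longleftrightarrow> i' = i" if "i' < n" for i' using disj[OF i(1) that pA] pA by blast
    then have "?h p = (\<Sum>i'<n. if i' = i then g i p else 0)"
      by (intro sum.cong[OF refl]) (simp add: restr_apply)
    then have "?h p \<le> g i p" using i(1) by simp
    then show "2 * n + 2 \<le> p \<and> (\<exists>i<n. ?h p \<le> g i p)" using ge[OF i(1) pA] i(1) by blast
  qed
  moreover have "(\<Sum>i<n. tsir (restr (A i) x)) \<le> (\<Sum>i<n. pairing (restr (A i) (g i)) (mag x) + e / Suc n)"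
    using g(2) x by (intro sum_mono) (simp add: pairing_restr_swap restr_mag less_imp_le)
  moreover have "\<dots> = pairing ?h (mag x) + n * (e / Suc n)"
    unfolding pairing_sum_left by (simp add: sum.distrib)
  moreover have "n * (e / Suc n) \<le> e" using e by (simp add: field_simps)
  ultimately show "(\<Sum>i<n. tsir (restr (A i) x)) \<le> 8 * tsir x + e" by linarith
qed

lemma Tstar_bdd: "f \<in> Tstar \<Longrightarrow> bdd_above {\<bar>pairing f x\<bar> | x. x \<in> c00 \<and> tsir x \<le> 1}"
  by (simp add: Tstar_def T_norm_eq_tsir)

lemma Tstar_pairing:
  assumes f: "f \<in> Tstar" and x: "x \<in> c00"
  shows "\<bar>pairing f x\<bar> \<le> Tstar_norm f * tsir x"
proof (cases "tsir x = 0")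
  case True
  then show ?thesis using tsir_eq_0[OF x] by simp
next
  case False
  let ?y = "\<lambda>j. (1 / tsir x) * x j"
  have "?y \<in> c00" using x by (rule c00_scale)
  moreover have "tsir ?y = 1" using False by (subst tsir_scale[OF x]) simp
  ultimately have "\<bar>pairing f ?y\<bar> \<in> {\<bar>pairing f x\<bar> | x. x \<in> c00 \<and> tsir x \<le> 1}" by auto
  then have "\<bar>pairing f ?y\<bar> \<le> Tstar_norm f"
    unfolding Tstar_norm_def T_norm_eq_tsir using Tstar_bdd[OF f] by (rule cSup_upper)
  moreover have "tsir x > 0" using False tsir_nonneg[of x] by linarith
  ultimately show ?thesis unfolding pairing_scale_right by (simp add: abs_mult field_simps)
qed

text \<open>Multiplying the coordinates of \<open>x\<close> by the signs of \<open>f\<close> does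
  not increase the norm of \<open>x\<close>, because \<open>tsir\<close> depends on absolute values
  only.\<close>

lemma Tstar_mag:
  assumes f: "f \<in> Tstar" and x: "x \<in> c00"
  shows "pairing (mag f) (mag x) \<le> Tstar_norm f * tsir x"
proof -
  let ?y = "\<lambda>j. sgn (f j) * \<bar>x j\<bar>"
  have y: "?y \<in> c00" using x by (rule c00_mono) simp
  have fin: "finite {j. x j \<noteq> 0}" using x by (simp add: c00_def)
  have "pairing (mag f) (mag x) = pairing f ?y"
    by (subst (1 2) pairing_eq_sum[OF fin]) (auto simp: mag_apply abs_sgn mult.assoc intro!: sum.cong)
  also have "\<dots> \<le> Tstar_norm f * tsir ?y" using Tstar_pairing[OF f y] by simp
  also have "\<dots> \<le> Tstar_norm f * tsir x"
  proof (rule mult_left_mono)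
    show "tsir ?y \<le> tsir x" by (rule tsir_mono[OF x]) (auto simp: abs_mult sgn_real_def)
    show "0 \<le> Tstar_norm f" using Tstar_pairing[OF f, of "unitv 0"] by (simp add: tsir_unitv)
  qed
  finally show ?thesis .
qed

text \<open>Converse of \<open>Tstar_mag\<close>. Together they reduce estimates in the dual to
  pointwise comparisons of nonnegative functionals.\<close>

lemma Tstar_leI:
  assumes "\<And>x. x \<in> c00 \<Longrightarrow> pairing (mag f) (mag x) \<le> C * tsir x"
  shows "f \<in> Tstar" "Tstar_norm f \<le> C"
proof -
  have "0 \<le> pairing (mag f) (mag (unitv 0))" by (intro pairing_nonneg) auto
  then have C: "0 \<le> C" using assms[of "unitv 0"] by (simp add: tsir_unitv)
  have b: "v \<le> C" if v: "v \<in> {\<bar>pairing f x\<bar> | x. x \<in> c00 \<and> tsir x \<le> 1}" for v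
  proof -
    obtain x where x: "x \<in> c00" "tsir x \<le> 1" "v = \<bar>pairing f x\<bar>" using v by blast
    have fin: "finite {j. x j \<noteq> 0}" using x by (simp add: c00_def)
    have "v \<le> pairing (mag f) (mag x)" unfolding x(3)
      by (subst (1 2) pairing_eq_sum[OF fin])
        (auto simp: mag_apply abs_mult[symmetric] simp del: abs_mult intro!: order_trans[OF sum_abs])
    also have "\<dots> \<le> C * tsir x" by (rule assms[OF x(1)])
    also have "\<dots> \<le> C" using C x(2) by (simp add: mult_left_le)
    finally show ?thesis .
  qed
  have "\<bar>pairing f (\<lambda>_. 0)\<bar> \<in> {\<bar>pairing f x\<bar> | x. x \<in> c00 \<and> tsir x \<le> 1}"
    by (intro CollectI exI[of _ "\<lambda>_. 0"]) simp
  then have ne: "{\<bar>pairing f x\<bar> | x. x \<in> c00 \<and> tsir x \<le> 1} \<noteq> {}" by blast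
  show "f \<in> Tstar" unfolding Tstar_def T_norm_eq_tsir using b by (intro CollectI bdd_aboveI)
  show "Tstar_norm f \<le> C" unfolding Tstar_norm_def T_norm_eq_tsir using ne b by (rule cSup_least)
qed

lemma Tstar_norm_coord: "f \<in> Tstar \<Longrightarrow> \<bar>f j\<bar> \<le> Tstar_norm f"
proof -
  assume f: "f \<in> Tstar"
  have "pairing f (unitv j) = (\<Sum>i\<in>{j}. f i * unitv j i)"
    by (rule pairing_eq_sum) (auto simp: unitv_apply)
  then show ?thesis using Tstar_pairing[OF f, of "unitv j"] by (simp add: tsir_unitv unitv_apply)
qed

lemma Tstar_norm_nonneg: "f \<in> Tstar \<Longrightarrow> 0 \<le> Tstar_norm f"
  using Tstar_norm_coord[of f 0] by simp

lemma Tstar_mono: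
  assumes g: "g \<in> Tstar" and le: "\<And>j. \<bar>f j\<bar> \<le> \<bar>g j\<bar>"
  shows "f \<in> Tstar" "Tstar_norm f \<le> Tstar_norm g"
proof -
  have "pairing (mag f) (mag x) \<le> Tstar_norm g * tsir x" if "x \<in> c00" for x
  proof -
    have "pairing (mag f) (mag x) \<le> pairing (mag g) (mag x)"
      using le by (intro pairing_mono) (auto simp: mag_apply)
    then show ?thesis using Tstar_mag[OF g that] by simp
  qed
  from Tstar_leI[OF this] show "f \<in> Tstar" "Tstar_norm f \<le> Tstar_norm g" by blast+
qed

lemma Tstar_add:
  assumes f: "f \<in> Tstar" and g: "g \<in> Tstar"
  shows "(\<lambda>j. f j + g j) \<in> Tstar" "Tstar_norm (\<lambda>j. f j + g j) \<le> Tstar_norm f + Tstar_norm g"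
proof -
  have "pairing (mag (\<lambda>j. f j + g j)) (mag x) \<le> (Tstar_norm f + Tstar_norm g) * tsir x" if "x \<in> c00" for x
  proof -
    have "pairing (mag (\<lambda>j. f j + g j)) (mag x) \<le> pairing (\<lambda>j. mag f j + mag g j) (mag x)"
      by (intro pairing_mono) (auto simp: mag_apply)
    then show ?thesis using Tstar_mag[OF f that] Tstar_mag[OF g that]
      by (simp add: pairing_add_left distrib_right)
  qed
  from Tstar_leI[OF this] show "(\<lambda>j. f j + g j) \<in> Tstar" 
    "Tstar_norm (\<lambda>j. f j + g j) \<le> Tstar_norm f + Tstar_norm g" by blast+
qed

lemma Tstar_zero [simp]: "(\<lambda>_. 0) \<in> Tstar" "Tstar_norm (\<lambda>_. 0) = 0"
proof -
  have *: "pairing (mag (\<lambda>_. 0)) (mag x) \<le> 0 * tsir x" for x by (simp add: mag_def)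
  show "(\<lambda>_. 0) \<in> Tstar" by (rule Tstar_leI[OF *])
  moreover have "Tstar_norm (\<lambda>_. 0) \<le> 0" by (rule Tstar_leI[OF *])
  ultimately show "Tstar_norm (\<lambda>_. 0) = 0" using Tstar_norm_nonneg[of "\<lambda>_. 0"] by simp
qed

lemma Tstar_sum:
  assumes "finite A" "\<And>i. i \<in> A \<Longrightarrow> f i \<in> Tstar"
  shows "(\<lambda>j. \<Sum>i\<in>A. f i j) \<in> Tstar \<and> Tstar_norm (\<lambda>j. \<Sum>i\<in>A. f i j) \<le> (\<Sum>i\<in>A. Tstar_norm (f i))"
  using assms
proof (induction A rule: finite_induct)
  case (insert a A)
  then have IH: "(\<lambda>j. \<Sum>i\<in>A. f i j) \<in> Tstar" "Tstar_norm (\<lambda>j. \<Sum>i\<in>A. f i j) \<le> (\<Sum>i\<in>A. Tstar_norm (f i))"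
    and a: "f a \<in> Tstar" by auto
  show ?case using Tstar_add[OF a IH(1)] IH(2) insert.hyps by simp
qed simp

lemma Tstar_scale:
  assumes f: "f \<in> Tstar"
  shows "(\<lambda>j. c * f j) \<in> Tstar" "Tstar_norm (\<lambda>j. c * f j) = \<bar>c\<bar> * Tstar_norm f"
proof -
  have *: "(\<lambda>j. c * f j) \<in> Tstar \<and> Tstar_norm (\<lambda>j. c * f j) \<le> \<bar>c\<bar> * Tstar_norm f" if f: "f \<in> Tstar" for c f
  proof -
    have "pairing (mag (\<lambda>j. c * f j)) (mag x) \<le> \<bar>c\<bar> * Tstar_norm f * tsir x" if "x \<in> c00" for x
    proof -
      have "mag (\<lambda>j. c * f j) = (\<lambda>j. \<bar>c\<bar> * mag f j)" by (simp add: mag_def abs_mult)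
      then show ?thesis using Tstar_mag[OF f that]
        by (simp add: pairing_scale_left mult.assoc mult_left_mono)
    qed
    from Tstar_leI[OF this] show ?thesis by blast
  qed
  show m: "(\<lambda>j. c * f j) \<in> Tstar" using *[OF f] by blast
  show "Tstar_norm (\<lambda>j. c * f j) = \<bar>c\<bar> * Tstar_norm f"
  proof (cases "c = 0")
    case False
    have "Tstar_norm (\<lambda>j. (1/c) * (c * f j)) \<le> \<bar>1/c\<bar> * Tstar_norm (\<lambda>j. c * f j)"
      using *[OF m, of "1/c"] by blast
    then have "\<bar>c\<bar> * Tstar_norm f \<le> Tstar_norm (\<lambda>j. c * f j)" using False by (simp add: field_simps)
    then show ?thesis using *[OF f, of c] by (intro antisym) auto
  qed simp
qed

lemma Tstar_c00:
  assumes f: "f \<in> c00" shows "f \<in> Tstar"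
proof -
  have fin: "finite {j. f j \<noteq> 0}" using f by (simp add: c00_def)
  show ?thesis
  proof (rule Tstar_leI(1)[of _ "\<Sum>j\<in>{j. f j \<noteq> 0}. \<bar>f j\<bar>"])
    fix x :: "nat \<Rightarrow> real" assume x: "x \<in> c00"
    have fx: "finite {j. x j \<noteq> 0}" using x by (simp add: c00_def)
    have "pairing (mag f) (mag x) = (\<Sum>j\<in>{j. x j \<noteq> 0}. mag f j * mag x j)"
      by (rule pairing_eq_sum[OF fx]) (auto simp: mag_apply)
    also have "\<dots> = (\<Sum>j\<in>{j. x j \<noteq> 0} \<inter> {j. f j \<noteq> 0}. mag f j * mag x j)"
      by (rule sum.mono_neutral_right[OF fx]) (auto simp: mag_apply)
    also have "\<dots> \<le> (\<Sum>j\<in>{j. f j \<noteq> 0}. mag f j * mag x j)"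
      by (rule sum_mono2[OF fin]) auto
    also have "\<dots> \<le> (\<Sum>j\<in>{j. f j \<noteq> 0}. \<bar>f j\<bar> * tsir x)"
      using tsir_coord[OF x] by (intro sum_mono) (simp add: mag_apply mult_left_mono)
    finally show "pairing (mag f) (mag x) \<le> (\<Sum>j\<in>{j. f j \<noteq> 0}. \<bar>f j\<bar>) * tsir x"
      by (simp add: sum_distrib_right)
  qed
qed

lemma Tstar_norm_unitv: "Tstar_norm (unitv t) = 1"
proof -
  have "mag (unitv t) = unitv t" by (auto simp: mag_def unitv_def)
  then have "Tstar_norm (unitv t) \<le> 1"
    using tsir_coord by (intro Tstar_leI(2)) (simp add: pairing_unitv mag_apply)
  then show ?thesis using Tstar_norm_coord[OF Tstar_c00, of "unitv t" t] by (simp add: unitv_apply)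
qed

text \<open>Dual of \<open>tsir_family\<close>: admissible blocks in \<open>T*\<close> have an upper
  \<open>c0\<close> estimate with constant 2.\<close>

lemma Tstar_block:
  assumes f: "\<And>l. l < k \<Longrightarrow> f l \<in> Tstar" "\<And>l. l < k \<Longrightarrow> Tstar_norm (f l) \<le> c" and c: "0 \<le> c"
    and k: "\<And>l j. l < k \<Longrightarrow> f l j \<noteq> 0 \<Longrightarrow> k \<le> Suc j" and s: "successive k f"
  shows "Tstar_norm (\<lambda>j. \<Sum>l<k. f l j) \<le> 2 * c"
proof (rule Tstar_leI(2))
  fix x :: "nat \<Rightarrow> real" assume x: "x \<in> c00"
  define E where "E l = {j. f l j \<noteq> 0}" for l
  have "pairing (mag (\<lambda>j. \<Sum>l<k. f l j)) (mag x) \<le> pairing (\<lambda>j. \<Sum>l<k. mag (f l) j) (mag x)"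
    by (intro pairing_mono) (auto simp: mag_apply)
  also have "\<dots> = (\<Sum>l<k. pairing (mag (f l)) (mag x))" by (rule pairing_sum_left)
  also have "\<dots> \<le> (\<Sum>l<k. c * tsir (restr (E l) x))"
  proof (rule sum_mono)
    fix l assume "l \<in> {..<k}"
    then have l: "l < k" by simp
    have "restr (E l) (mag (f l)) = mag (f l)" by (auto simp: restr_def mag_def E_def)
    then have "pairing (mag (f l)) (mag x) = pairing (mag (f l)) (mag (restr (E l) x))"
      using pairing_restr_swap[of "mag x" "E l" "mag (f l)"] x by (simp add: restr_mag)
    also have "\<dots> \<le> Tstar_norm (f l) * tsir (restr (E l) x)"
      using f(1)[OF l] x by (intro Tstar_mag) auto
    also have "\<dots> \<le> c * tsir (restr (E l) x)" using f(2)[OF l] by (intro mult_right_mono) auto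
    finally show "pairing (mag (f l)) (mag x) \<le> c * tsir (restr (E l) x)" .
  qed
  also have "\<dots> = c * (\<Sum>l<k. tsir (restr (E l) x))" by (simp add: sum_distrib_left)
  also have "\<dots> \<le> c * (2 * tsir x)"
  proof (rule mult_left_mono[OF tsir_family[OF x] c])
    show "k \<le> Suc j" if "l < k" "j \<in> E l" for l j using k that by (simp add: E_def)
    show "i < j" if "l < l'" "l' < k" "i \<in> E l" "j \<in> E l'" for l l' i j
      using s that unfolding successive_def E_def by blast
  qed
  finally show "pairing (mag (\<lambda>j. \<Sum>l<k. f l j)) (mag x) \<le> 2 * c * tsir x" by simp
qed

text \<open>Dual of \<open>tsir_disjoint\<close>: assigning to each coordinate one index
  \<open>\<iota> p\<close> that dominates there splits the support of \<open>w\<close> into disjoint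
  sets.\<close>

lemma Tstar_max:
  assumes v: "\<And>i. i < n \<Longrightarrow> v i \<in> Tstar" "\<And>i. i < n \<Longrightarrow> Tstar_norm (v i) \<le> c" and c: "0 \<le> c"
    and w: "\<And>p. w p \<noteq> 0 \<Longrightarrow> 2 * n + 2 \<le> p \<and> (\<exists>i<n. \<bar>w p\<bar> \<le> \<bar>v i p\<bar>)"
  shows "w \<in> Tstar" "Tstar_norm w \<le> 8 * c"
proof -
  have "pairing (mag w) (mag x) \<le> 8 * c * tsir x" if x: "x \<in> c00" for x
  proof -
    obtain \<iota> where \<iota>: "\<And>p. w p \<noteq> 0 \<Longrightarrow> \<iota> p < n \<and> \<bar>w p\<bar> \<le> \<bar>v (\<iota> p) p\<bar>" using w by metis
    define A where "A i = {p. w p \<noteq> 0 \<and> \<iota> p = i}" for i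
    have "mag w p \<le> (\<Sum>i<n. restr (A i) (mag (v i)) p)" for p
    proof (cases "w p = 0")
      case True then show ?thesis by (simp add: mag_apply restr_apply sum_nonneg)
    next
      case False
      have "mag w p \<le> restr (A (\<iota> p)) (mag (v (\<iota> p))) p"
        using \<iota>[OF False] False by (simp add: A_def restr_apply mag_apply)
      also have "\<dots> \<le> (\<Sum>i<n. restr (A i) (mag (v i)) p)"
        using \<iota>[OF False] by (intro member_le_sum) (auto simp: restr_apply)
      finally show ?thesis .
    qed
    then have "pairing (mag w) (mag x) \<le> pairing (\<lambda>p. \<Sum>i<n. restr (A i) (mag (v i)) p) (mag x)"
      by (intro pairing_mono) auto
    also have "\<dots> = (\<Sum>i<n. pairing (mag (v i)) (mag (restr (A i) x)))"
      unfolding pairing_sum_left using x by (simp add: pairing_restr_swap flip: restr_mag)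
    also have "\<dots> \<le> (\<Sum>i<n. c * tsir (restr (A i) x))"
    proof (rule sum_mono)
      fix i assume i: "i \<in> {..<n}"
      have "pairing (mag (v i)) (mag (restr (A i) x)) \<le> Tstar_norm (v i) * tsir (restr (A i) x)"
        using v i x by (intro Tstar_mag) auto
      also have "\<dots> \<le> c * tsir (restr (A i) x)" using v i by (intro mult_right_mono) auto
      finally show "pairing (mag (v i)) (mag (restr (A i) x)) \<le> c * tsir (restr (A i) x)" .
    qed
    also have "\<dots> = c * (\<Sum>i<n. tsir (restr (A i) x))" by (simp add: sum_distrib_left)
    also have "\<dots> \<le> c * (8 * tsir x)"
      by (rule mult_left_mono[OF tsir_disjoint[OF x] c]) (use w in \<open>auto simp: A_def\<close>)
    finally show ?thesis by simp
  qed
  from Tstar_leI[OF this] show "w \<in> Tstar" "Tstar_norm w \<le> 8 * c" by blast+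
qed

subsection \<open>Decay of tails in the dual\<close>

lemma mag_of_nonneg: "(\<And>j. 0 \<le> x j) \<Longrightarrow> mag x = x"
  by (auto simp: mag_def)

text \<open>A block met by at most one child contributes at most \<open>1/2\<close>, any other block
  at most 1. Each block met by two children is charged to the first child that meets it, and no
  child is charged twice, so there are at most \<open>k\<close> such blocks.\<close>

lemma node_pairing_blocks:
  assumes h: "\<And>l. l < k \<Longrightarrow> h l \<in> norming" and hs: "successive k h"
    and x: "\<And>i. i < r \<Longrightarrow> x i \<in> c00" "\<And>i. i < r \<Longrightarrow> tsir (x i) \<le> 1" "\<And>i j. 0 \<le> x i j"
    and xs: "successive r x"
    and node: "(\<lambda>j. 1/2 * (\<Sum>l<k. h l j)) \<in> norming"
  shows "(\<Sum>i<r. pairing (\<lambda>j. 1/2 * (\<Sum>l<k. h l j)) (x i)) \<le> r / 2 + k / 2"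
proof -
  let ?g = "\<lambda>j. 1/2 * (\<Sum>l<k. h l j)"
  define hits where "hits l i \<longleftrightarrow> (\<exists>j. h l j \<noteq> 0 \<and> x i j \<noteq> 0)" for l i
  define Two where "Two = {i. i < r \<and> (\<exists>l l'. l < l' \<and> l' < k \<and> hits l i \<and> hits l' i)}"
  define a where "a i = (LEAST l. hits l i)" for i
  have a: "hits (a i) i" "\<exists>l'. a i < l' \<and> l' < k \<and> hits l' i" if i: "i \<in> Two" for i
  proof -
    from i obtain l l' where l: "l < l'" "l' < k" "hits l i" "hits l' i" by (auto simp: Two_def)
    show "hits (a i) i" unfolding a_def using l(3) by (rule LeastI)
    have "a i \<le> l" unfolding a_def using l(3) by (rule Least_le)
    then show "\<exists>l'. a i < l' \<and> l' < k \<and> hits l' i" using l by (meson le_less_trans)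
  qed
  \<comment> \<open>If the same child met first an earlier and a later split block, a subsequent
    child would meet the earlier block, contradicting the order of the blocks or that of the
    children.\<close>
  have neq: "a i \<noteq> a i'" if ii: "i \<in> Two" "i' \<in> Two" "i < i'" for i i'
  proof
    assume eq: "a i = a i'"
    obtain l' where l': "a i < l'" "l' < k" "hits l' i" using a(2)[OF ii(1)] by blast
    obtain j where j: "h l' j \<noteq> 0" "x i j \<noteq> 0" using l'(3) by (auto simp: hits_def)
    obtain j' where j': "h (a i) j' \<noteq> 0" "x i' j' \<noteq> 0" using a(1)[OF ii(2)] eq by (auto simp: hits_def)
    have "j < j'" using xs ii j j' unfolding successive_def Two_def by blast
    moreover have "j' < j" using hs l' j j' unfolding successive_def by blast
    ultimately show False by simp
  qed
  have "inj_on a Two"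
  proof (rule inj_onI)
    fix i i' assume "i \<in> Two" "i' \<in> Two" "a i = a i'"
    then show "i = i'" using neq[of i i'] neq[of i' i] by (cases i i' rule: linorder_cases) auto
  qed
  moreover have "a ` Two \<subseteq> {..<k}" using a(2) by fastforce
  ultimately have card: "card Two \<le> k" using card_inj_on_le[of a Two "{..<k}"] by simp
  have le1: "pairing (h l) (x i) \<le> 1" if "l < k" "i < r" for l i
    using tsir_upper[OF x(1)[OF that(2)] h[OF that(1)]] x(2)[OF that(2)] x(3)
    by (simp add: mag_of_nonneg)
  have each: "pairing ?g (x i) \<le> 1/2 + (if i \<in> Two then 1/2 else 0)" if i: "i < r" for i
  proof (cases "i \<in> Two")
    case True
    then show ?thesis using tsir_upper[OF x(1)[OF i] node] x(2)[OF i] x(3) by (simp add: mag_of_nonneg)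
  next
    case False
    have z: "pairing (h l) (x i) = 0" if "\<not> hits l i" for l
      unfolding pairing_def using that by (intro sum.neutral) (auto simp: hits_def)
    have "(\<Sum>l<k. pairing (h l) (x i)) \<le> 1"
    proof (cases "\<exists>l<k. hits l i")
      case True
      then obtain l where l: "l < k" "hits l i" by blast
      have "\<not> hits l' i" if "l' < k" "l' \<noteq> l" for l'
        using False l i that unfolding Two_def by (metis (mono_tags, lifting) mem_Collect_eq nat_neq_iff)
      then have "(\<Sum>l'<k. pairing (h l') (x i)) = (\<Sum>l'<k. if l' = l then pairing (h l) (x i) else 0)"
        using z by (intro sum.cong) auto
      then show ?thesis using l(1) le1[OF l(1) i] by simp
    next
      case False
      then show ?thesis using z by simp
    qed
    then show ?thesis using False unfolding pairing_scale_left pairing_sum_left by simp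
  qed
  have "(\<Sum>i<r. pairing ?g (x i)) \<le> (\<Sum>i<r. 1/2 + (if i \<in> Two then 1/2 else 0))"
    using each by (intro sum_mono) simp
  also have "\<dots> = r / 2 + (\<Sum>i<r. if i \<in> Two then 1/2 else 0)" by (simp add: sum.distrib)
  also have "(\<Sum>i<r. if i \<in> Two then 1/2 else 0) = (\<Sum>i\<in>{..<r} \<inter> Two. 1/2 :: real)"
    by (rule sum.inter_restrict[symmetric, OF finite_lessThan])
  also have "{..<r} \<inter> Two = Two" by (auto simp: Two_def)
  also have "(\<Sum>i\<in>Two. 1/2 :: real) \<le> k / 2" using card by simp
  finally show ?thesis by simp
qed

text \<open>James' distortion argument: at most \<open>p\<close> of the blocks are split by an admissible family that
  starts before \<open>p\<close>, so an average of many blocks contributes only about one half.\<close>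

lemma tsir_james:
  assumes x0: "x0 \<in> c00" "tsir x0 \<le> 1" "\<And>j. 0 \<le> x0 j" "\<And>j. p \<le> j \<Longrightarrow> x0 j = 0"
    and x: "\<And>i. i < r \<Longrightarrow> x i \<in> c00" "\<And>i. i < r \<Longrightarrow> tsir (x i) \<le> 1" "\<And>i j. 0 \<le> x i j"
    and xs: "successive r x" and xp: "\<And>i j. i < r \<Longrightarrow> x i j \<noteq> 0 \<Longrightarrow> p \<le> j"
    and r: "4 * p \<le> r" "0 < r"
  shows "tsir (\<lambda>j. x0 j + 1 / r * (\<Sum>i<r. x i j)) \<le> 7/4"
proof -
  let ?s = "\<lambda>j. \<Sum>i<r. x i j"
  let ?y = "\<lambda>j. 1 / real r * ?s j"
  have s: "?s \<in> c00" using x(1) by (intro c00_sum) auto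
  have y: "?y \<in> c00" using s by (rule c00_scale)
  have y0: "0 \<le> ?y j" for j using x(3) by (simp add: sum_nonneg)
  have "tsir ?s \<le> (\<Sum>i<r. tsir (x i))" using x(1) by (intro tsir_sum) auto
  also have "\<dots> \<le> (\<Sum>i<r. 1)" using x(2) by (intro sum_mono) auto
  finally have "tsir ?y \<le> 1" using r(2) s by (simp only: tsir_scale) (simp add: field_simps)
  then have yle: "pairing g ?y \<le> 1" if "g \<in> norming" for g
    using tsir_upper[OF y that] mag_of_nonneg[of ?y] y0 by simp
  have x0le: "pairing g x0 \<le> 1" if "g \<in> norming" for g
    using tsir_upper[OF x0(1) that] mag_of_nonneg[of x0] x0 by simp
  show ?thesis
  proof (rule tsir_leI)
    show "(\<lambda>j. x0 j + ?y j) \<in> c00" by (rule c00_add[OF x0(1) y])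
    fix g assume g: "g \<in> norming"
    have "mag (\<lambda>j. x0 j + ?y j) = (\<lambda>j. x0 j + ?y j)" using x0(3) y0 by (intro mag_of_nonneg add_nonneg_nonneg)
    then have split: "pairing g (mag (\<lambda>j. x0 j + ?y j)) = pairing g x0 + pairing g ?y"
      using pairing_add_right[OF x0(1) y] by simp
    show "pairing g (mag (\<lambda>j. x0 j + ?y j)) \<le> 7/4"
    \<comment> \<open>A functional that misses \<open>x0\<close> gains at most 1 from the average.
      One that meets \<open>x0\<close> is nonzero before \<open>p\<close>, so its root has at most
      \<open>p\<close> children and the average contributes at most \<open>3/4\<close> on top of the
      1 from \<open>x0\<close>.\<close>
    proof (cases "\<exists>j. g j \<noteq> 0 \<and> x0 j \<noteq> 0")
      case False
      then have "pairing g x0 = 0" unfolding pairing_def by (intro sum.neutral) auto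
      then show ?thesis using split yle[OF g] by simp
    next
      case True
      then obtain j where j: "g j \<noteq> 0" "x0 j \<noteq> 0" by blast
      have jp: "j < p" using x0(4)[of j] j(2) by (rule_tac ccontr) simp
      obtain m where "g \<in> norming_level m" using g by (auto simp: norming_def)
      then have "pairing g ?y \<le> 3/4"
      proof (cases rule: norming_level_cases)
        case 1 then show ?thesis by simp
      next
        case (2 t)
        then have "t < p" using j(1) jp by (simp add: unitv_apply split: if_splits)
        then have "x i t = 0" if "i < r" for i using xp[OF that, of t] by (rule_tac ccontr) simp
        then have "?y t = 0" by simp
        moreover have "pairing g ?y = ?y t" unfolding 2 by (rule pairing_unitv[OF y])
        ultimately show ?thesis by linarith
      next
        case (3 m' k h)
        then obtain l where l: "l < k" "h l j \<noteq> 0" using j(1)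
          by (auto elim: sum.not_neutral_contains_not_neutral)
        then have "k \<le> p" using 3(4) jp by (meson Suc_leI le_trans)
        then have "4 * k \<le> r" using r(1) by simp
        then have kr: "real k \<le> real r / 4" by simp
        have h: "h l \<in> norming" if "l < k" for l using 3(3) that by (auto simp: norming_def)
        have "pairing g ?y = 1 / real r * (\<Sum>i<r. pairing g (x i))"
          unfolding pairing_scale_right using pairing_sum_right[of "{..<r}" x g] x(1) by simp
        also have "\<dots> \<le> 1 / real r * (r / 2 + k / 2)"
          using node_pairing_blocks[OF h 3(5) x xs] g unfolding 3(2) by (intro mult_left_mono) auto
        also have "\<dots> \<le> 1 / real r * (3/4 * r)" using kr by (intro mult_left_mono) auto
        also have "\<dots> = 3/4" using r(2) by simp
        finally show ?thesis .
      qed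
      then show ?thesis using split x0le[OF g] by simp
    qed
  qed
qed

text \<open>Suppose the tail norms decrease to some positive \<open>l\<close>. Vectors of norm at
  most 1 arbitrarily far out then have pairing more than \<open>19/20 * l\<close> with
  \<open>mag f\<close>. Adding one of them to an average of many later ones gives pairing at least
  \<open>19/10 * l\<close> but norm at most \<open>7/4\<close>, so the tail from \<open>N\<close> on
  would have norm above \<open>21/20 * l\<close>: the fractions are chosen so that
  \<open>21/20 * (7/4)\<close> stays below \<open>19/10\<close>.\<close>

lemma Tstar_tail:
  assumes f: "f \<in> Tstar"
  shows "(\<lambda>n. Tstar_norm (restr {n..} f)) \<longlonglongrightarrow> 0"
proof -
  define lam where "lam n = Tstar_norm (restr {n..} f)" for n
  have fT: "restr A f \<in> Tstar" for A by (rule Tstar_mono(1)[OF f]) (simp add: restr_apply)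
  have dec: "decseq lam" unfolding decseq_def lam_def
    by (intro allI impI Tstar_mono(2) fT) (simp add: restr_apply)
  have nn: "0 \<le> lam n" for n unfolding lam_def by (rule Tstar_norm_nonneg[OF fT])
  obtain l where l: "lam \<longlonglongrightarrow> l" "\<And>n. l \<le> lam n"
    using decseq_convergent[OF dec, of 0] nn by auto
  have l0: "0 \<le> l" using nn by (intro LIMSEQ_le_const[OF l(1)]) auto
  have "l = 0"
  proof (rule ccontr)
    assume "l \<noteq> 0"
    then have lpos: "l > 0" using l0 by simp
    then have "eventually (\<lambda>n. lam n < 21/20 * l) sequentially"
      using l(1) by (intro order_tendstoD) auto
    then obtain N where N: "lam N < 21/20 * l" by (auto simp: eventually_sequentially)
    \<comment> \<open>Otherwise, testing on normalized positive vectors beyond \<open>n\<close>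
      would push \<open>lam n\<close> down to \<open>19/20 * l\<close>, below the limit of a
      decreasing sequence.\<close>
    have ex: "\<exists>x. x \<in> c00 \<and> tsir x \<le> 1 \<and> (\<forall>j. 0 \<le> x j) \<and> (\<forall>j<n. x j = 0) \<and> 19/20 * l < pairing (mag f) x" for n
    proof (rule ccontr)
      assume no: "\<not> ?thesis"
      have "lam n \<le> 19/20 * l" unfolding lam_def
      proof (rule Tstar_leI(2))
        fix x :: "nat \<Rightarrow> real" assume x: "x \<in> c00"
        show "pairing (mag (restr {n..} f)) (mag x) \<le> 19/20 * l * tsir x"
        proof (cases "tsir x = 0")
          case True then show ?thesis using tsir_eq_0[OF x] by (simp add: mag_def)
        next
          case False
          then have tp: "tsir x > 0" using tsir_nonneg[of x] by linarith
          let ?y = "restr {n..} (mag x)"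
          let ?z = "\<lambda>j. 1 / tsir x * ?y j"
          have y: "?y \<in> c00" using x by simp
          have z: "?z \<in> c00" using y by (rule c00_scale)
          have "tsir ?y \<le> tsir x" by (rule tsir_mono[OF x]) (simp add: restr_apply mag_apply)
          then have "tsir ?z \<le> 1" using tp by (subst tsir_scale[OF y]) (simp add: field_simps)
          moreover have "\<forall>j. 0 \<le> ?z j" using tp by (simp add: restr_apply)
          moreover have "\<forall>j<n. ?z j = 0" by (simp add: restr_apply)
          ultimately have "pairing (mag f) ?z \<le> 19/20 * l" using no z by (meson not_le)
          then have "pairing (mag f) ?y \<le> 19/20 * l * tsir x"
            unfolding pairing_scale_right using tp by (simp add: field_simps)
          then show ?thesis using x by (simp add: pairing_restr_swap flip: restr_mag)
        qed
      qed
      then show False using l(2)[of n] lpos by simp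
    qed
    then obtain X where X: "\<And>n. X n \<in> c00" "\<And>n. tsir (X n) \<le> 1" "\<And>n j. 0 \<le> X n j"
        "\<And>n j. j < n \<Longrightarrow> X n j = 0" "\<And>n. 19/20 * l < pairing (mag f) (X n)" by metis
    have "\<exists>p. \<forall>j\<ge>p. X n j = 0" for n using c00_bound[OF X(1)[of n]] by metis
    then obtain B where B: "\<And>n j. B n \<le> j \<Longrightarrow> X n j = 0" by metis
    define p where "p = max N (B N)"
    \<comment> \<open>Each vector is taken beyond the end of the preceding one, so that
      \<open>X (q i)\<close> lives between \<open>q i\<close> and \<open>q (Suc i)\<close>.\<close>
    define q where "q = rec_nat p (\<lambda>_ a. max a (B a))"
    have q: "q 0 = p" "q (Suc i) = max (q i) (B (q i))" for i by (simp_all add: q_def)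
    have qmono: "i \<le> i' \<Longrightarrow> q i \<le> q i'" for i i'
      by (rule lift_Suc_mono_le[of q]) (simp_all add: q)
    define r where "r = 4 * p + 1"
    define x where "x i = X (q i)" for i
    have supp: "q i \<le> j \<and> j < q (Suc i)" if "x i j \<noteq> 0" for i j
      using X(4)[of j "q i"] B[of "q i" j] that unfolding x_def q(2) by (meson max.strict_coboundedI2 not_le)
    have xs: "successive r x" unfolding successive_def
    proof (intro allI impI)
      fix i i' j j' assume *: "i < i'" "x i j \<noteq> 0" "x i' j' \<noteq> 0"
      have "q (Suc i) \<le> q i'" using *(1) by (intro qmono) simp
      then show "j < j'" using supp[OF *(2)] supp[OF *(3)] by linarith
    qed
    let ?z = "\<lambda>j. X N j + 1 / real r * (\<Sum>i<r. x i j)"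
    have tz: "tsir ?z \<le> 7/4"
    proof (rule tsir_james[OF X(1,2,3) _ _ _ _ xs])
      show "X N j = 0" if "p \<le> j" for j using B that by (simp add: p_def)
      show "p \<le> j" if "x i j \<noteq> 0" for i j using supp[OF that] qmono[of 0 i] q(1) by simp
    qed (use X in \<open>auto simp: x_def r_def\<close>)
    have sc: "(\<lambda>j. \<Sum>i<r. x i j) \<in> c00" using X(1) by (intro c00_sum) (auto simp: x_def)
    have zc: "?z \<in> c00" by (intro c00_add X(1) c00_scale sc)
    have "r * (19/20 * l) \<le> (\<Sum>i<r. pairing (mag f) (x i))"
      using sum_bounded_below[of "{..<r}" "19/20 * l" "\<lambda>i. pairing (mag f) (x i)"] X(5)
      by (simp add: x_def less_imp_le)
    then have "19/20 * l \<le> 1 / real r * (\<Sum>i<r. pairing (mag f) (x i))"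
      by (simp add: r_def field_simps)
    also have "\<dots> = pairing (mag f) (\<lambda>j. 1 / real r * (\<Sum>i<r. x i j))"
      unfolding pairing_scale_right using X(1) by (simp add: pairing_sum_right x_def)
    finally have "19/10 * l \<le> pairing (mag f) ?z"
      using X(5)[of N] unfolding pairing_add_right[OF X(1)[of N] c00_scale[OF sc]] by linarith
    also have "\<dots> = pairing (mag (restr {N..} f)) ?z"
    proof -
      have "?z j = 0" if j: "j < N" for j
      proof -
        have "x i j = 0" for i
        proof (rule ccontr)
          assume "x i j \<noteq> 0"
          then have "p \<le> j" using supp[of i j] qmono[of 0 i] q(1) by simp
          then show False using j by (simp add: p_def)
        qed
        then show ?thesis using X(4)[OF j] by simp
      qed
      then have "restr {N..} ?z = ?z" unfolding restr_def by (intro ext) (metis atLeast_iff not_le)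
      then show ?thesis using pairing_restr_swap[OF zc, of "{N..}" "mag f"] by (simp add: restr_mag)
    qed
    also have "\<dots> \<le> lam N * tsir ?z"
    proof -
      have "0 \<le> ?z j" for j using X(3) by (intro add_nonneg_nonneg mult_nonneg_nonneg sum_nonneg) (auto simp: x_def)
      then have "mag ?z = ?z" by (rule mag_of_nonneg)
      then show ?thesis using Tstar_mag[OF fT zc, of "{N..}"] by (simp add: lam_def)
    qed
    also have "\<dots> \<le> 21/20 * l * (7/4)"
      using N tz nn[of N] by (intro mult_mono) auto
    finally show False using lpos by simp
  qed
  then show ?thesis using l(1) unfolding lam_def by simp
qed

text \<open>A uniform bound would put the constant sequence 1 into \<open>Tstar\<close>, and its
  tails have norm at least 1.\<close>

lemma Tstar_norm_ones_unbounded: "\<exists>N. Tstar_norm (\<lambda>j. if j < N then 1 else 0) > c"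
proof (rule ccontr)
  assume "\<not> ?thesis"
  then have le: "Tstar_norm (\<lambda>j. if j < N then 1 else 0) \<le> c" for N by (simp add: not_less)
  have "(\<lambda>_. 1) \<in> Tstar"
  proof (rule Tstar_leI(1)[of _ c])
    fix x :: "nat \<Rightarrow> real" assume x: "x \<in> c00"
    obtain N where N: "\<And>j. N \<le> j \<Longrightarrow> x j = 0" using c00_bound[OF x] by blast
    let ?u = "\<lambda>j. if j < N then 1 else 0 :: real"
    have u: "?u \<in> Tstar" by (rule Tstar_c00) (simp add: c00_def)
    have "pairing (mag (\<lambda>_. 1)) (mag x) \<le> pairing (mag ?u) (mag x)"
      by (rule pairing_mono) (use N in \<open>auto simp: mag_apply not_less\<close>)
    also have "\<dots> \<le> Tstar_norm ?u * tsir x" by (rule Tstar_mag[OF u x])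
    also have "\<dots> \<le> c * tsir x" using le by (intro mult_right_mono) auto
    finally show "pairing (mag (\<lambda>_. 1)) (mag x) \<le> c * tsir x" .
  qed
  then have lim: "(\<lambda>n. Tstar_norm (restr {n..} (\<lambda>_. 1))) \<longlonglongrightarrow> 0"
    and T: "\<And>n. restr {n..} (\<lambda>_. 1) \<in> Tstar"
    by (auto intro: Tstar_tail Tstar_mono(1) simp: restr_apply)
  have "1 \<le> Tstar_norm (restr {n..} (\<lambda>_. 1))" for n
    using Tstar_norm_coord[OF T, of n n] by (simp add: restr_apply)
  then have "(1::real) \<le> 0" using lim by (intro LIMSEQ_le_const) auto
  then show False by simp
qed

subsection \<open>The space of sequences in the dual\<close>

abbreviation rownorms :: "vv \<Rightarrow> nat \<Rightarrow> real" where
  "rownorms x \<equiv> \<lambda>k. Tstar_norm (x k)"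

lemma Tstar_restr: "f \<in> Tstar \<Longrightarrow> restr A f \<in> Tstar"
  by (erule Tstar_mono(1)) (simp add: restr_apply)

lemma Tstar_dominated:
  assumes g: "g \<in> Tstar" and f: "\<And>j. 0 \<le> f j" "\<And>j. f j \<le> g j"
  shows "f \<in> Tstar" "Tstar_norm f \<le> Tstar_norm g"
proof -
  have "\<bar>f j\<bar> \<le> \<bar>g j\<bar>" for j using f(1)[of j] f(2)[of j] by simp
  from Tstar_mono[OF g this] show "f \<in> Tstar" "Tstar_norm f \<le> Tstar_norm g" by blast+
qed

text \<open>By \<open>Tstar_tail\<close> the truncations of a member of \<open>Tstar\<close>
  converge to it, so the convergence clause in \<open>TT\<close> becomes mere membership.
  Conversely, norm convergence forces the limit to agree with the row norms in each
  coordinate.\<close>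

lemma TT_iff: "x \<in> TT \<longleftrightarrow> (\<forall>k. x k \<in> Tstar) \<and> rownorms x \<in> Tstar"
proof
  assume x: "x \<in> TT"
  let ?v = "rownorms x"
  from x obtain s where xk: "\<forall>k. x k \<in> Tstar" and s: "s \<in> Tstar"
    and lim: "(\<lambda>n. Tstar_norm (\<lambda>j. s j - trunc n ?v j)) \<longlonglongrightarrow> 0"
    unfolding TT_def by blast
  have "s j = ?v j" for j
  proof -
    have d: "(\<lambda>j. s j - trunc n ?v j) \<in> Tstar" for n
    proof -
      have "{j. trunc n ?v j \<noteq> 0} \<subseteq> {..<n}" by (auto simp: trunc_def)
      then have "trunc n ?v \<in> c00" unfolding c00_def by (simp add: finite_subset)
      then have "(\<lambda>j. s j + (-1) * trunc n ?v j) \<in> Tstar"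
        by (intro Tstar_add(1)[OF s] Tstar_scale(1) Tstar_c00)
      then show ?thesis by simp
    qed
    have "\<bar>s j - ?v j\<bar> \<le> Tstar_norm (\<lambda>j. s j - trunc n ?v j)" if "n \<ge> Suc j" for n
      using Tstar_norm_coord[OF d, of j n] that by (simp add: trunc_def)
    then have "\<bar>s j - ?v j\<bar> \<le> 0" by (intro LIMSEQ_le_const[OF lim]) blast
    then show ?thesis by simp
  qed
  then have "s = ?v" by (rule ext)
  then show "(\<forall>k. x k \<in> Tstar) \<and> ?v \<in> Tstar" using xk s by simp
next
  assume x: "(\<forall>k. x k \<in> Tstar) \<and> rownorms x \<in> Tstar"
  have "(\<lambda>j. rownorms x j - trunc n (rownorms x) j) = restr {n..} (rownorms x)" for n
    by (auto simp: trunc_def restr_def)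
  then have "(\<lambda>n. Tstar_norm (\<lambda>j. rownorms x j - trunc n (rownorms x) j)) \<longlonglongrightarrow> 0"
    using Tstar_tail[of "rownorms x"] x by simp
  then show "x \<in> TT" unfolding TT_def
    by (intro CollectI conjI bexI[of _ "rownorms x"]) (use x in simp_all)
qed

lemma TT_row: "x \<in> TT \<Longrightarrow> x k \<in> Tstar"
  by (simp add: TT_iff)

lemma TT_rownorms: "x \<in> TT \<Longrightarrow> rownorms x \<in> Tstar"
  by (simp add: TT_iff)

lemma TT_leI:
  assumes rows: "\<And>k. x k \<in> Tstar" and g: "g \<in> Tstar" and le: "\<And>k. Tstar_norm (x k) \<le> g k"
  shows "x \<in> TT" "TT_norm x \<le> Tstar_norm g"
proof -
  have nn: "0 \<le> rownorms x k" for k by (rule Tstar_norm_nonneg[OF rows])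
  show "x \<in> TT" unfolding TT_iff using rows Tstar_dominated(1)[OF g nn le] by blast
  show "TT_norm x \<le> Tstar_norm g" unfolding TT_norm_def by (rule Tstar_dominated(2)[OF g nn le])
qed

lemma TT_dominated:
  assumes y: "y \<in> TT" and le: "\<And>k j. \<bar>x k j\<bar> \<le> \<bar>y k j\<bar>"
  shows "x \<in> TT" "TT_norm x \<le> TT_norm y"
  using TT_leI[OF Tstar_mono(1)[OF TT_row[OF y] le] TT_rownorms[OF y] Tstar_mono(2)[OF TT_row[OF y] le]]
  by (simp_all add: TT_norm_def)

lemma TT_add:
  assumes x: "x \<in> TT" and y: "y \<in> TT"
  shows "(\<lambda>k j. x k j + y k j) \<in> TT" "TT_norm (\<lambda>k j. x k j + y k j) \<le> TT_norm x + TT_norm y"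
proof -
  note s = Tstar_add[OF TT_rownorms[OF x] TT_rownorms[OF y]]
  note t = TT_leI[of "\<lambda>k j. x k j + y k j", OF Tstar_add(1)[OF TT_row[OF x] TT_row[OF y]] s(1)
      Tstar_add(2)[OF TT_row[OF x] TT_row[OF y]]]
  show "(\<lambda>k j. x k j + y k j) \<in> TT" by (rule t(1))
  show "TT_norm (\<lambda>k j. x k j + y k j) \<le> TT_norm x + TT_norm y"
    using t(2) s(2) unfolding TT_norm_def by simp
qed

lemma TT_scale:
  assumes x: "x \<in> TT"
  shows "(\<lambda>k j. c * x k j) \<in> TT" "TT_norm (\<lambda>k j. c * x k j) = \<bar>c\<bar> * TT_norm x"
proof -
  have eq: "rownorms (\<lambda>k j. c * x k j) = (\<lambda>k. \<bar>c\<bar> * rownorms x k)"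
    using Tstar_scale(2)[OF TT_row[OF x]] by (intro ext)
  show "(\<lambda>k j. c * x k j) \<in> TT"
    unfolding TT_iff eq using Tstar_scale(1) TT_row[OF x] TT_rownorms[OF x] by blast
  show "TT_norm (\<lambda>k j. c * x k j) = \<bar>c\<bar> * TT_norm x"
    unfolding TT_norm_def eq using Tstar_scale(2)[OF TT_rownorms[OF x]] by simp
qed

lemma TT_zero: "(\<lambda>k j. 0) \<in> TT" "TT_norm (\<lambda>k j. 0) = 0"
  by (simp_all add: TT_iff TT_norm_def)

lemma TT_sum:
  assumes "finite A" "\<And>i. i \<in> A \<Longrightarrow> x i \<in> TT"
  shows "(\<lambda>k j. \<Sum>i\<in>A. x i k j) \<in> TT \<and> TT_norm (\<lambda>k j. \<Sum>i\<in>A. x i k j) \<le> (\<Sum>i\<in>A. TT_norm (x i))"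
  using assms
proof (induction A rule: finite_induct)
  case (insert a A)
  then have IH: "(\<lambda>k j. \<Sum>i\<in>A. x i k j) \<in> TT" "TT_norm (\<lambda>k j. \<Sum>i\<in>A. x i k j) \<le> (\<Sum>i\<in>A. TT_norm (x i))"
    and a: "x a \<in> TT" by auto
  show ?case using TT_add[OF a IH(1)] IH(2) insert.hyps by simp
qed (simp add: TT_zero)

lemma TT_coord: "x \<in> TT \<Longrightarrow> \<bar>x k j\<bar> \<le> TT_norm x"
proof -
  assume x: "x \<in> TT"
  have "\<bar>x k j\<bar> \<le> rownorms x k" by (rule Tstar_norm_coord[OF TT_row[OF x]])
  also have "\<dots> \<le> TT_norm x" unfolding TT_norm_def using Tstar_norm_coord[OF TT_rownorms[OF x], of k] by simp
  finally show ?thesis .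
qed

definition corner :: "nat \<Rightarrow> vv \<Rightarrow> vv" where
  "corner R x = (\<lambda>k j. if k < R \<and> j < R then x k j else 0)"

definition off_corner :: "nat \<Rightarrow> vv \<Rightarrow> vv" where
  "off_corner R x = (\<lambda>k j. if k < R \<and> j < R then 0 else x k j)"

lemma corner_TT:
  assumes "x \<in> TT" shows "corner R x \<in> TT" "TT_norm (corner R x) \<le> TT_norm x"
  by (rule TT_dominated[OF assms]; simp add: corner_def)+

lemma off_corner_TT:
  assumes "x \<in> TT" shows "off_corner R x \<in> TT" 
  by (rule TT_dominated[OF assms]) (simp add: off_corner_def)

text \<open>Tails are cut twice: the rows beyond \<open>K\<close> contribute at most
  \<open>e / 2\<close>, and in each of the first \<open>K\<close> rows the columns beyond
  \<open>R\<close> contribute at most \<open>d\<close>, where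
  \<open>K * d \<le> e / 2\<close>.\<close>

lemma off_corner_small:
  assumes x: "x \<in> TT" and e: "e > 0"
  obtains R0 where "\<And>R. R0 \<le> R \<Longrightarrow> TT_norm (off_corner R x) \<le> e"
proof -
  let ?v = "rownorms x"
  have "eventually (\<lambda>n. Tstar_norm (restr {n..} ?v) < e / 2) sequentially"
    using Tstar_tail[OF TT_rownorms[OF x]] e by (intro order_tendstoD) auto
  then obtain K where K: "Tstar_norm (restr {K..} ?v) < e / 2" by (auto simp: eventually_sequentially)
  define d where "d = e / (2 * Suc K)"
  have d: "d > 0" using e by (simp add: d_def)
  have "\<exists>n. \<forall>m\<ge>n. Tstar_norm (restr {m..} (x k)) < d" for k
    using order_tendstoD(2)[OF Tstar_tail[OF TT_row[OF x, of k]] d] by (simp add: eventually_sequentially)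
  then obtain n where n: "\<And>k m. n k \<le> m \<Longrightarrow> Tstar_norm (restr {m..} (x k)) < d" by metis
  have "TT_norm (off_corner R x) \<le> e" if R: "K + (\<Sum>k<K. n k) \<le> R" for R
  proof -
    let ?g = "\<lambda>k. restr {K..} ?v k + (\<Sum>i<K. d * unitv i k)"
    have uT: "(\<lambda>k. d * unitv i k) \<in> Tstar" "Tstar_norm (\<lambda>k. d * unitv i k) = d" for i
      using Tstar_scale[OF Tstar_c00[OF c00_unitv], of d i] d by (simp_all add: Tstar_norm_unitv)
    have sT: "(\<lambda>k. \<Sum>i<K. d * unitv i k) \<in> Tstar" "Tstar_norm (\<lambda>k. \<Sum>i<K. d * unitv i k) \<le> K * d"
      using Tstar_sum[of "{..<K}" "\<lambda>i k. d * unitv i k"] uT by simp_all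
    note vT = Tstar_restr[OF TT_rownorms[OF x], of "{K..}"]
    have "TT_norm (off_corner R x) \<le> Tstar_norm ?g"
    proof (rule TT_leI(2))
      show "off_corner R x k \<in> Tstar" for k using off_corner_TT[OF x] by (rule TT_row)
      show "?g \<in> Tstar" by (rule Tstar_add(1)[OF vT sT(1)])
      show "Tstar_norm (off_corner R x k) \<le> ?g k" for k
      proof (cases "k < K")
        case True
        have "n k \<le> (\<Sum>k<K. n k)" using True by (intro member_le_sum) auto
        then have nk: "n k \<le> R" using R by simp
        have "off_corner R x k = restr {R..} (x k)"
          using True R by (auto simp: off_corner_def restr_def)
        then have "Tstar_norm (off_corner R x k) \<le> d" using n[OF nk] by simp
        also have "d = (\<Sum>i<K. if i = k then d else 0)" using True by simp
        also have "\<dots> = (\<Sum>i<K. d * unitv i k)" by (intro sum.cong) (auto simp: unitv_apply)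
        also have "\<dots> \<le> ?g k" using Tstar_norm_nonneg[OF TT_row[OF x]] by (simp add: restr_apply)
        finally show ?thesis .
      next
        case False
        have "Tstar_norm (off_corner R x k) \<le> ?v k"
          by (rule Tstar_mono(2)[OF TT_row[OF x]]) (simp add: off_corner_def)
        also have "\<dots> \<le> ?g k" using False d by (simp add: restr_apply sum_nonneg unitv_apply)
        finally show ?thesis .
      qed
    qed
    also have "\<dots> \<le> Tstar_norm (restr {K..} ?v) + K * d"
      using Tstar_add(2)[OF vT sT(1)] sT(2) by simp
    also have "K * d \<le> e / 2" using e by (simp add: d_def field_simps)
    finally show ?thesis using K by simp
  qed
  then show ?thesis using that by blast
qed

section \<open>Finite-codimensional subspaces and the rows they contain\<close>

definition corner_kernel :: "nat \<Rightarrow> vv set" where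
  "corner_kernel R = {x \<in> TT. \<forall>k<R. \<forall>j<R. x k j = 0}"

lemma row_TT:
  assumes a: "a \<in> Tstar"
  shows "(\<lambda>k j. if k = i then a j else 0) \<in> TT" "TT_norm (\<lambda>k j. if k = i then a j else 0) = Tstar_norm a"
proof -
  let ?x = "\<lambda>k j. if k = i then a j else 0"
  have row: "?x k = (if k = i then a else (\<lambda>_. 0))" for k by auto
  have eq: "rownorms ?x = (\<lambda>k. Tstar_norm a * unitv i k)" unfolding row by (auto simp: unitv_apply)
  show "?x \<in> TT" unfolding TT_iff eq
    using a Tstar_scale(1)[OF Tstar_c00[OF c00_unitv]] by (simp add: row)
  show "TT_norm ?x = Tstar_norm a" unfolding TT_norm_def eq
    using Tstar_norm_nonneg[OF a] by (simp add: Tstar_scale(2)[OF Tstar_c00] Tstar_norm_unitv)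
qed

lemma corner_kernel_fin_codim: "fin_codim TT (corner_kernel R)"
proof -
  define U :: "nat \<Rightarrow> vv" where
    "U i = (\<lambda>k j. if k = i div R then unitv (i mod R) j else 0)" for i
  have UT: "U i \<in> TT" for i unfolding U_def by (rule row_TT(1)[OF Tstar_c00[OF c00_unitv]])
  have "TT \<subseteq> vspan (corner_kernel R \<union> U ` {..<R * R})"
  proof
    fix x assume x: "x \<in> TT"
    \<comment> \<open>Index 0 carries the part off the corner; index \<open>Suc i\<close> carries
      the corner entry in row \<open>i div R\<close> and column \<open>i mod R\<close>.\<close>
    define y where "y i = (case i of 0 \<Rightarrow> off_corner R x | Suc i \<Rightarrow> U i)" for i
    define a where "a i = (case i of 0 \<Rightarrow> 1 | Suc i \<Rightarrow> x (i div R) (i mod R))" for i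
    have "x = vlincomb (Suc (R * R)) a y"
    proof (intro ext)
      fix k j
      have "vlincomb (Suc (R * R)) a y k j
          = off_corner R x k j + (\<Sum>i<R * R. x (i div R) (i mod R) * U i k j)"
        unfolding vlincomb_def sum.lessThan_Suc_shift by (simp add: a_def y_def)
      also have "(\<Sum>i<R * R. x (i div R) (i mod R) * U i k j) = corner R x k j"
      proof (cases "k < R \<and> j < R")
        case True
        have iff: "k = i div R \<and> j = i mod R \<longleftrightarrow> i = k * R + j" for i
          using True by (auto simp: div_mult_mod_eq)
        have "k * R + j < Suc k * R" using True by simp
        also have "\<dots> \<le> R * R" using True by (intro mult_le_mono1) simp
        finally have lt: "k * R + j < R * R" .
        have "(\<Sum>i<R * R. x (i div R) (i mod R) * U i k j) = (\<Sum>i<R * R. if i = k * R + j then x k j else 0)"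
        proof (rule sum.cong[OF refl])
          fix i
          show "x (i div R) (i mod R) * U i k j = (if i = k * R + j then x k j else 0)"
            using iff[of i] by (auto simp: U_def unitv_apply)
        qed
        then show ?thesis using lt True by (simp add: corner_def)
      next
        case False
        have "U i k j = 0" if "i < R * R" for i
        proof -
          have "R > 0" using that by (cases R) auto
          then have "i div R < R" "i mod R < R" using that by (simp_all add: less_mult_imp_div_less)
          then show ?thesis using False by (auto simp: U_def unitv_apply)
        qed
        moreover have "corner R x k j = 0" using False by (auto simp: corner_def)
        ultimately show ?thesis by simp
      qed
      finally show "x k j = vlincomb (Suc (R * R)) a y k j" by (simp add: corner_def off_corner_def)
    qed
    moreover have "y i \<in> corner_kernel R \<union> U ` {..<R * R}" if "i < Suc (R * R)" for i
      using that off_corner_TT[OF x, of R]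
      by (cases i) (auto simp: y_def corner_kernel_def off_corner_def)
    ultimately show "x \<in> vspan (corner_kernel R \<union> U ` {..<R * R})" unfolding vspan_def by blast
  qed
  then show ?thesis unfolding fin_codim_def using UT by (intro exI[of _ "U ` {..<R * R}"]) auto
qed

lemma corner_kernel_closed_fincodim: "closed_fincodim TT TT_norm (corner_kernel R)"
proof -
  have "lin_subspace TT (corner_kernel R)"
    unfolding lin_subspace_def corner_kernel_def
    using TT_zero(1) TT_add(1) TT_scale(1) by auto
  moreover have "closed_in_space TT TT_norm (corner_kernel R)"
    unfolding closed_in_space_def
  proof (intro allI impI)
    fix s x assume s: "\<forall>n. s n \<in> corner_kernel R" and x: "x \<in> TT"
      and lim: "(\<lambda>n. TT_norm (\<lambda>k j. s n k j - x k j)) \<longlonglongrightarrow> 0"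
    have "x k j = 0" if kj: "k < R" "j < R" for k j
    proof -
      have "\<bar>x k j\<bar> \<le> TT_norm (\<lambda>k j. s n k j - x k j)" for n
      proof -
        have "(\<lambda>k j. s n k j + (-1) * x k j) \<in> TT"
          using s by (intro TT_add(1) TT_scale(1)[OF x]) (simp add: corner_kernel_def)
        then have "(\<lambda>k j. s n k j - x k j) \<in> TT" by simp
        from TT_coord[OF this, of k j] show ?thesis using s kj by (simp add: corner_kernel_def)
      qed
      then have "\<bar>x k j\<bar> \<le> 0" by (intro LIMSEQ_le_const[OF lim]) blast
      then show ?thesis by simp
    qed
    then show "x \<in> corner_kernel R" using x by (simp add: corner_kernel_def)
  qed
  ultimately show ?thesis unfolding closed_fincodim_def using corner_kernel_fin_codim by blast
qed

definition subspace_vv :: "vv set \<Rightarrow> bool" where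
  "subspace_vv W \<longleftrightarrow> (\<lambda>k j. 0) \<in> W \<and>
     (\<forall>x\<in>W. \<forall>y\<in>W. (\<lambda>k j. x k j + y k j) \<in> W) \<and> (\<forall>x\<in>W. \<forall>c. (\<lambda>k j. c * x k j) \<in> W)"

lemma vspan_mono: "S \<subseteq> S' \<Longrightarrow> vspan S \<subseteq> vspan S'"
  unfolding vspan_def by blast

lemma vspan_subspace:
  assumes W: "subspace_vv W" shows "vspan W \<subseteq> W"
proof
  fix v assume "v \<in> vspan W"
  then obtain m a x where x: "\<forall>i<m. x i \<in> W" and v: "v = vlincomb m a x" unfolding vspan_def by blast
  have "n \<le> m \<Longrightarrow> vlincomb n a x \<in> W" for n
  proof (induction n)
    case 0 then show ?case using W by (simp add: vlincomb_def subspace_vv_def)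
  next
    case (Suc n)
    have "(\<lambda>k j. a n * x n k j) \<in> W" using W x Suc.prems by (simp add: subspace_vv_def)
    then have "(\<lambda>k j. vlincomb n a x k j + a n * x n k j) \<in> W"
      using W Suc unfolding subspace_vv_def by simp
    then show ?case by (simp add: vlincomb_def)
  qed
  then show "v \<in> W" using v by simp
qed

text \<open>The induction on \<open>B\<close> eliminates one vector at a time; arbitrarily late starting points \<open>n\<close>
  provide the two independent sequences to be combined.\<close>

lemma row_in_fincodim:
  assumes "finite B" "subspace_vv W"
    "\<And>a. a \<in> c00 \<Longrightarrow> (\<lambda>k j. if k = i then a j else 0) \<in> vspan (W \<union> B)"
  shows "\<exists>a\<in>c00. a \<noteq> (\<lambda>_. 0) \<and> (\<forall>j<n. a j = 0) \<and> (\<lambda>k j. if k = i then a j else 0) \<in> W"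
  using assms
proof (induction B arbitrary: W n rule: finite_induct)
  case empty
  have "(\<lambda>k j. if k = i then unitv n j else 0) \<in> W"
    using empty.prems(2)[of "unitv n"] vspan_subspace[OF empty.prems(1)] by auto
  moreover have "unitv n \<noteq> (\<lambda>_. 0)" by (metis unitv_apply zero_neq_one)
  moreover have "\<forall>j<n. unitv n j = 0" by (simp add: unitv_apply)
  ultimately show ?case by (intro bexI[of _ "unitv n"]) simp_all
next
  case (insert b B)
  \<comment> \<open>Adjoining the line of \<open>b\<close> to \<open>W\<close> shortens the list of
    extra vectors. The induction hypothesis yields rows in \<open>W'\<close>, whose
    \<open>b\<close>-components must then be cancelled.\<close>
  define W' where "W' = {(\<lambda>k j. w k j + c * b k j) | w c. w \<in> W}"
  have W0: "(\<lambda>k j. 0) \<in> W" and Wadd: "\<And>x y. x \<in> W \<Longrightarrow> y \<in> W \<Longrightarrow> (\<lambda>k j. x k j + y k j) \<in> W"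
    and Wsc: "\<And>x c. x \<in> W \<Longrightarrow> (\<lambda>k j. c * x k j) \<in> W"
    using insert.prems(1) unfolding subspace_vv_def by blast+
  have inW': "(\<lambda>k j. w k j + c * b k j) \<in> W'" if "w \<in> W" for w c using that unfolding W'_def by blast
  have "subspace_vv W'" unfolding subspace_vv_def
  proof (intro conjI ballI allI)
    show "(\<lambda>k j. 0) \<in> W'" using inW'[OF W0, of 0] by simp
  next
    fix x y assume "x \<in> W'" "y \<in> W'"
    then obtain w c w' c' where w: "w \<in> W" "x = (\<lambda>k j. w k j + c * b k j)"
      "w' \<in> W" "y = (\<lambda>k j. w' k j + c' * b k j)" unfolding W'_def by blast
    show "(\<lambda>k j. x k j + y k j) \<in> W'"
      using inW'[OF Wadd[OF w(1,3)], of "c + c'"] unfolding w(2,4) by (simp add: algebra_simps)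
  next
    fix x d assume "x \<in> W'"
    then obtain w c where w: "w \<in> W" "x = (\<lambda>k j. w k j + c * b k j)" unfolding W'_def by blast
    show "(\<lambda>k j. d * x k j) \<in> W'"
      using inW'[OF Wsc[OF w(1), of d], of "d * c"] unfolding w(2) by (simp add: algebra_simps)
  qed
  moreover have "W \<union> insert b B \<subseteq> W' \<union> B"
  proof -
    have "W \<subseteq> W'" using inW'[of _ 0] by auto
    moreover have "b \<in> W'" using inW'[OF W0, of 1] by simp
    ultimately show ?thesis by blast
  qed
  then have "\<And>a. a \<in> c00 \<Longrightarrow> (\<lambda>k j. if k = i then a j else 0) \<in> vspan (W' \<union> B)"
    using insert.prems(2) vspan_mono by blast
  ultimately have IH: "\<And>n. \<exists>a\<in>c00. a \<noteq> (\<lambda>_. 0) \<and> (\<forall>j<n. a j = 0) \<and> (\<lambda>k j. if k = i then a j else 0) \<in> W'"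
    by (rule insert.IH)
  obtain a where a: "a \<in> c00" "a \<noteq> (\<lambda>_. 0)" "\<forall>j<n. a j = 0" "(\<lambda>k j. if k = i then a j else 0) \<in> W'"
    using IH[of n] by blast
  obtain p where p: "\<And>j. p \<le> j \<Longrightarrow> a j = 0" using c00_bound[OF a(1)] by blast
  \<comment> \<open>Since \<open>a'\<close> starts after \<open>a\<close> ends, the combination
    \<open>d\<close> that cancels \<open>b\<close> still equals \<open>c' * a j\<close> on the
    support of \<open>a\<close>, hence is nonzero when \<open>c'\<close> is. If \<open>c'\<close>
    vanishes, the row of \<open>a'\<close> is itself in \<open>W\<close>.\<close>
  obtain a' where a': "a' \<in> c00" "a' \<noteq> (\<lambda>_. 0)" "\<forall>j<max n p. a' j = 0" "(\<lambda>k j. if k = i then a' j else 0) \<in> W'"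
    using IH[of "max n p"] by blast
  obtain w c where w: "w \<in> W" "(\<lambda>k j. if k = i then a j else 0) = (\<lambda>k j. w k j + c * b k j)"
    using a(4) unfolding W'_def by blast
  obtain w' c' where w': "w' \<in> W" "(\<lambda>k j. if k = i then a' j else 0) = (\<lambda>k j. w' k j + c' * b k j)"
    using a'(4) unfolding W'_def by blast
  show ?case
  proof (cases "c' = 0")
    case True
    then have "(\<lambda>k j. if k = i then a' j else 0) \<in> W" using w' by simp
    then show ?thesis using a' by (intro bexI[of _ a']) auto
  next
    case False
    define d where "d = (\<lambda>j. c' * a j + (- c) * a' j)"
    have "d \<in> c00" unfolding d_def using a(1) a'(1) by (intro c00_add c00_scale)
    moreover have "d \<noteq> (\<lambda>_. 0)"
    proof -
      obtain j where j: "a j \<noteq> 0" using a(2) by auto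
      then have "j < p" using p[of j] by (rule_tac ccontr) simp
      then have "d j = c' * a j" using a'(3) by (simp add: d_def)
      then have "d j \<noteq> 0" using j False by simp
      then show ?thesis by auto
    qed
    moreover have "\<forall>j<n. d j = 0" using a(3) a'(3) by (simp add: d_def)
    moreover have "(\<lambda>k j. if k = i then d j else 0) = (\<lambda>k j. c' * w k j + (- c) * w' k j)"
    proof (intro ext)
      fix k j
      have e: "(if k = i then a j else 0) = w k j + c * b k j" "(if k = i then a' j else 0) = w' k j + c' * b k j"
        using fun_cong[OF fun_cong[OF w(2), of k], of j] fun_cong[OF fun_cong[OF w'(2), of k], of j] .
      have "(if k = i then d j else 0) = c' * (if k = i then a j else 0) + (- c) * (if k = i then a' j else 0)"
        by (simp add: d_def)
      also have "\<dots> = c' * w k j + (- c) * w' k j" unfolding e by (simp add: algebra_simps)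
      finally show "(if k = i then d j else 0) = c' * w k j + (- c) * w' k j" .
    qed
    moreover have "(\<lambda>k j. c' * w k j + (- c) * w' k j) \<in> W" by (rule Wadd[OF Wsc[OF w(1)] Wsc[OF w'(1)]])
    ultimately show ?thesis by (intro bexI[of _ d]) auto
  qed
qed

text \<open>If finitely many vectors spanned the space, the zero subspace would be of finite
  codimension and would contain a nonzero row.\<close>

lemma infinite_dim_TT: "infinite_dim TT"
  unfolding infinite_dim_def
proof (intro allI impI notI)
  fix B assume B: "finite B" "TT \<subseteq> vspan B"
  have "subspace_vv {\<lambda>k j. 0}" by (simp add: subspace_vv_def)
  moreover have "(\<lambda>k j. if k = 0 then a j else 0) \<in> vspan ({\<lambda>k j. 0} \<union> B)" if "a \<in> c00" for a
    using row_TT(1)[OF Tstar_c00[OF that], of 0] B(2) vspan_mono[of B "{\<lambda>k j. 0} \<union> B"] by blast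
  ultimately have "\<exists>a\<in>c00. a \<noteq> (\<lambda>_. 0) \<and> (\<forall>j<0. a j = 0) \<and>
      (\<lambda>k j. if k = 0 then a j else 0) \<in> {\<lambda>(k::nat) j. 0}"
    by (rule row_in_fincodim[OF B(1)])
  then obtain a :: "nat \<Rightarrow> real" where a: "a \<noteq> (\<lambda>_. 0)"
      "(\<lambda>k j. if k = 0 then a j else 0) \<in> {\<lambda>(k::nat) j. 0}"
    by blast
  have eq: "(\<lambda>k j. if k = 0 then a j else 0) = (\<lambda>(k::nat) j. 0)" using a(2) by (rule singletonD)
  have "a j = 0" for j using fun_cong[OF fun_cong[OF eq, of 0], of j] by simp
  then show False using a(1) by auto
qed

lemma unit_row_in_fincodim:
  assumes W: "closed_fincodim TT TT_norm W"
  obtains a where "a \<in> Tstar" "Tstar_norm a = 1" "(\<lambda>k j. if k = i then a j else 0) \<in> W"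
proof -
  obtain B where B: "finite B" "TT \<subseteq> vspan (W \<union> B)"
    using W unfolding closed_fincodim_def fin_codim_def by blast
  have sub: "subspace_vv W" using W unfolding closed_fincodim_def lin_subspace_def subspace_vv_def by blast
  have "(\<lambda>k j. if k = i then a j else 0) \<in> vspan (W \<union> B)" if "a \<in> c00" for a
    using row_TT(1)[OF Tstar_c00[OF that], of i] B(2) by blast
  then obtain a where a: "a \<in> c00" "a \<noteq> (\<lambda>_. 0)" "(\<lambda>k j. if k = i then a j else 0) \<in> W"
    using row_in_fincodim[OF B(1) sub, of i 0] by blast
  have aT: "a \<in> Tstar" using a(1) by (rule Tstar_c00)
  obtain j where "a j \<noteq> 0" using a(2) by auto
  then have pos: "Tstar_norm a > 0" using Tstar_norm_coord[OF aT, of j] by linarith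
  let ?b = "\<lambda>j. 1 / Tstar_norm a * a j"
  have "(\<lambda>k j. 1 / Tstar_norm a * (if k = i then a j else 0)) \<in> W"
    using sub[unfolded subspace_vv_def, THEN conjunct2, THEN conjunct2, rule_format, OF a(3)] .
  moreover have "(\<lambda>k j. 1 / Tstar_norm a * (if k = i then a j else 0)) = (\<lambda>k j. if k = i then ?b j else 0)"
    by (intro ext) simp
  ultimately have "(\<lambda>k j. if k = i then ?b j else 0) \<in> W" by simp
  moreover have "Tstar_norm ?b = 1" using pos by (simp only: Tstar_scale(2)[OF aT]) simp
  ultimately show ?thesis using that[of ?b] Tstar_scale(1)[OF aT] by blast
qed

subsection \<open>Asymptotic structures\<close>

lemma supp_in_c00: "supp_in N a \<Longrightarrow> a \<in> c00"
proof -
  assume "supp_in N a"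
  then have "{j. a j \<noteq> 0} \<subseteq> {..<N}" unfolding supp_in_def by (metis (mono_tags, lifting) lessThan_iff mem_Collect_eq not_le subsetI)
  then show ?thesis unfolding c00_def by (simp add: finite_subset)
qed

lemma Tstar_norm_basis: "normed_monotone_basis N Tstar_norm"
  unfolding normed_monotone_basis_def
proof (intro conjI allI impI)
  fix a assume a: "supp_in N a"
  note T = Tstar_c00[OF supp_in_c00[OF a]]
  show "0 \<le> Tstar_norm a" by (rule Tstar_norm_nonneg[OF T])
  show "(Tstar_norm a = 0) = (a = (\<lambda>_. 0))"
  proof
    assume "Tstar_norm a = 0"
    then show "a = (\<lambda>_. 0)" using Tstar_norm_coord[OF T] by (intro ext) simp
  qed simp
next
  fix a c assume "supp_in N a"
  then show "Tstar_norm (\<lambda>j. c * a j) = \<bar>c\<bar> * Tstar_norm a" by (intro Tstar_scale(2) Tstar_c00 supp_in_c00)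
next
  fix a b assume "supp_in N a" "supp_in N b"
  then show "Tstar_norm (\<lambda>j. a j + b j) \<le> Tstar_norm a + Tstar_norm b"
    by (intro Tstar_add(2) Tstar_c00 supp_in_c00)
next
  fix i show "Tstar_norm (unitv i) = 1" by (rule Tstar_norm_unitv)
next
  fix a m assume "supp_in N a"
  then show "Tstar_norm (trunc m a) \<le> Tstar_norm a"
    by (intro Tstar_mono(2) Tstar_c00 supp_in_c00) (auto simp: trunc_def)
qed

text \<open>The invariant is that move \<open>i\<close> is a normalized vector in row
  \<open>i\<close> alone. The row norms of a linear combination are then the absolute values of its
  coefficients, so every final position is isometric to the initial basis segment of
  \<open>T*\<close>.\<close>

lemma Tstar_norm_game:
  assumes eps: "eps > 0"
    and xs: "\<forall>i<length xs. \<exists>a\<in>Tstar. Tstar_norm a = 1 \<and> xs ! i = (\<lambda>k j. if k = i then a j else 0)"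
  shows "asym_game TT TT_norm Tstar_norm eps m xs"
  using xs
proof (induction m arbitrary: xs)
  case 0
  let ?n = "length xs"
  obtain b where b: "\<And>i. i < ?n \<Longrightarrow> b i \<in> Tstar" "\<And>i. i < ?n \<Longrightarrow> Tstar_norm (b i) = 1"
      "\<And>i. i < ?n \<Longrightarrow> xs ! i = (\<lambda>k j. if k = i then b i j else 0)"
    using 0 by metis
  have "TT_norm (vlincomb ?n a (\<lambda>i. xs ! i)) = Tstar_norm a" if a: "\<forall>i\<ge>?n. a i = 0" for a
  proof -
    have row: "vlincomb ?n a (\<lambda>i. xs ! i) k = (if k < ?n then (\<lambda>j. a k * b k j) else (\<lambda>_. 0))" for k
    proof
      fix j
      have "vlincomb ?n a (\<lambda>i. xs ! i) k j = (\<Sum>i<?n. if i = k then a k * b k j else 0)"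
        unfolding vlincomb_def using b(3) by (intro sum.cong) auto
      then show "vlincomb ?n a (\<lambda>i. xs ! i) k j = (if k < ?n then (\<lambda>j. a k * b k j) else (\<lambda>_. 0)) j" by simp
    qed
    have eq: "rownorms (vlincomb ?n a (\<lambda>i. xs ! i)) = mag a"
    proof
      fix k show "Tstar_norm (vlincomb ?n a (\<lambda>i. xs ! i) k) = mag a k"
        unfolding row using a b Tstar_scale(2)[of "b k" "a k"] by (simp add: mag_apply)
    qed
    have aT: "a \<in> Tstar" using a by (intro Tstar_c00 supp_in_c00) (simp add: supp_in_def)
    have "mag a \<in> Tstar" "Tstar_norm (mag a) \<le> Tstar_norm a"
      by (rule Tstar_mono[OF aT]; simp add: mag_apply)+
    moreover have "Tstar_norm a \<le> Tstar_norm (mag a)"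
      by (rule Tstar_mono(2)) (simp_all add: calculation mag_apply)
    ultimately show ?thesis unfolding TT_norm_def eq by simp
  qed
  then show ?case using eps unfolding asym_game.simps equiv_seq_def by (intro exI[of _ 1]) simp
next
  case (Suc m)
  show ?case unfolding asym_game.simps
  proof (intro allI impI)
    fix W assume "closed_fincodim TT TT_norm W"
    then obtain a where a: "a \<in> Tstar" "Tstar_norm a = 1" "(\<lambda>k j. if k = length xs then a j else 0) \<in> W"
      by (rule unit_row_in_fincodim)
    let ?x = "\<lambda>k j. if k = length xs then a j else 0"
    have "TT_norm ?x = 1" using row_TT(2)[OF a(1)] a(2) by simp
    moreover have "asym_game TT TT_norm Tstar_norm eps m (xs @ [?x])"
    proof (rule Suc.IH, intro allI impI)
      fix i assume "i < length (xs @ [?x])"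
      then consider "i < length xs" | "i = length xs" by fastforce
      then show "\<exists>a\<in>Tstar. Tstar_norm a = 1 \<and> (xs @ [?x]) ! i = (\<lambda>k j. if k = i then a j else 0)"
      proof cases
        case 1 then show ?thesis using Suc.prems by (simp add: nth_append)
      next
        case 2 then show ?thesis using a by (intro bexI[of _ a]) simp_all
      qed
    qed
    ultimately show "\<exists>x\<in>W. TT_norm x = 1 \<and> asym_game TT TT_norm Tstar_norm eps m (xs @ [x])"
      using a(3) by blast
  qed
qed

lemma Tstar_norm_asym_struct: "Tstar_norm \<in> asym_struct TT TT_norm N"
  unfolding asym_struct_def using Tstar_norm_basis Tstar_norm_game by simp

section \<open>Failure of the uniform \<open>c0\<close> estimate\<close>

lemma linf_upper: "k < n \<Longrightarrow> \<bar>a k\<bar> \<le> linf n a"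
  unfolding linf_def by (intro Max_ge) auto

lemma linf_least: "0 \<le> c \<Longrightarrow> (\<And>k. k < n \<Longrightarrow> \<bar>a k\<bar> \<le> c) \<Longrightarrow> linf n a \<le> c"
  unfolding linf_def by (subst Max_le_iff) auto

lemma linf_nonneg: "0 \<le> linf n a"
  unfolding linf_def by (intro Max_ge) auto

lemma not_asymptotic_c0_TT: "\<not> asymptotic_c0 TT TT_norm"
proof
  assume "asymptotic_c0 TT TT_norm"
  then obtain c where c: "\<And>k. equiv_seq c k Tstar_norm (linf k)" "c \<ge> 1"
    unfolding asymptotic_c0_def using Tstar_norm_asym_struct by blast
  obtain N where N: "Tstar_norm (\<lambda>j. if j < N then 1 else 0) > c" using Tstar_norm_ones_unbounded by blast
  have "N \<noteq> 0" using N c(2) by (intro notI) simp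
  obtain A B where AB: "A > 0" "B > 0" "A * B \<le> c"
    "\<And>a. \<forall>i\<ge>N. a i = 0 \<Longrightarrow> 1 / A * Tstar_norm a \<le> linf N a \<and> linf N a \<le> B * Tstar_norm a"
    using c(1)[of N] unfolding equiv_seq_def by blast
  \<comment> \<open>The first unit vector has norm 1 on both sides. This normalizes the two
    equivalence constants and leaves \<open>A \<le> c\<close>, to be contradicted by the vector of
    ones.\<close>
  have "1 \<le> linf N (unitv 0)" using linf_upper[of 0 N "unitv 0"] \<open>N \<noteq> 0\<close> by (simp add: unitv_apply)
  also have "\<dots> \<le> B" using AB(4)[of "unitv 0"] \<open>N \<noteq> 0\<close> by (simp add: Tstar_norm_unitv unitv_apply)
  finally have "A \<le> c" using AB(1,3) by (meson mult_le_cancel_left1 order_trans not_less_iff_gr_or_eq)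
  moreover have "1 / A * Tstar_norm (\<lambda>j. if j < N then 1 else 0) \<le> 1"
    using AB(4)[of "\<lambda>j. if j < N then 1 else 0"] linf_least[of 1 N "\<lambda>j. if j < N then 1 else 0"] by simp
  then have "Tstar_norm (\<lambda>j. if j < N then 1 else 0) \<le> A" using AB(1) by (simp add: field_simps)
  ultimately show False using N by simp
qed

section \<open>Plays against corner kernels and the subsequential \<open>c0\<close> estimate\<close>

text \<open>The plays against the corner kernels: up to \<open>\<delta>\<close>, the \<open>i\<close>-th vector lives on the square of side
  \<open>R (Suc i)\<close> without the square of side \<open>R i\<close>.\<close>

definition staircase :: "nat \<Rightarrow> real \<Rightarrow> vv list \<Rightarrow> (nat \<Rightarrow> nat) \<Rightarrow> bool" where
  "staircase R0 \<delta> xs R \<longleftrightarrow> R0 \<le> R 0 \<and> (\<forall>i<length xs. R i \<le> R (Suc i) \<and> xs ! i \<in> TT \<and> TT_norm (xs ! i) = 1 \<and>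
     (\<forall>k<R i. \<forall>j<R i. (xs ! i) k j = 0) \<and> TT_norm (off_corner (R (Suc i)) (xs ! i)) \<le> \<delta>)"

text \<open>The next corner is chosen only after the last vector is known:
  \<open>off_corner_small\<close> supplies a corner that nearly carries the vector, and the next
  subspace played is the kernel of that corner.\<close>

lemma asym_game_staircase:
  assumes "asym_game TT TT_norm E eps m xs" "staircase R0 \<delta> xs R" "\<delta> > 0"
  shows "\<exists>ys R'. length ys = length xs + m \<and> staircase R0 \<delta> ys R' \<and> asym_game TT TT_norm E eps 0 ys"
  using assms
proof (induction m arbitrary: xs R)
  case 0 then show ?case by (intro exI[of _ xs] exI[of _ R]) simp
next
  case (Suc m)
  let ?n = "length xs"
  obtain x where x: "x \<in> corner_kernel (R ?n)" "TT_norm x = 1" "asym_game TT TT_norm E eps m (xs @ [x])"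
    using Suc.prems(1) corner_kernel_closed_fincodim by (meson asym_game.simps(2))
  have xT: "x \<in> TT" using x(1) by (simp add: corner_kernel_def)
  obtain S where S: "\<And>r. S \<le> r \<Longrightarrow> TT_norm (off_corner r x) \<le> \<delta>"
    using off_corner_small[OF xT Suc.prems(3)] by blast
  \<comment> \<open>\<open>staircase\<close> constrains \<open>R\<close> only up to index
    \<open>length xs\<close>, so the next value can still be set.\<close>
  define R' where "R' = R(Suc ?n := max (R ?n) S)"
  have "staircase R0 \<delta> (xs @ [x]) R'" unfolding staircase_def
  proof (intro conjI[of "R0 \<le> R' 0"] allI impI)
    show "R0 \<le> R' 0" using Suc.prems(2) by (simp add: staircase_def R'_def)
    fix i assume "i < length (xs @ [x])"
    then consider "i < ?n" | "i = ?n" by fastforce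
    then show "R' i \<le> R' (Suc i) \<and> (xs @ [x]) ! i \<in> TT \<and> TT_norm ((xs @ [x]) ! i) = 1 \<and>
      (\<forall>k<R' i. \<forall>j<R' i. ((xs @ [x]) ! i) k j = 0) \<and> TT_norm (off_corner (R' (Suc i)) ((xs @ [x]) ! i)) \<le> \<delta>"
    proof cases
      case 1
      then have "R' i = R i" "R' (Suc i) = R (Suc i)" "(xs @ [x]) ! i = xs ! i"
        by (simp_all add: R'_def nth_append)
      then show ?thesis using Suc.prems(2) 1 unfolding staircase_def by simp
    next
      case 2
      then have "R' i = R ?n" "R' (Suc i) = max (R ?n) S" "(xs @ [x]) ! i = x"
        by (simp_all add: R'_def)
      then show ?thesis using x S xT by (simp add: corner_kernel_def)
    qed
  qed
  from Suc.IH[OF x(3) this Suc.prems(3)] show ?case by simp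
qed

text \<open>Here \<open>z l\<close> is row \<open>p\<close> of the \<open>l\<close>-th vector. At
  most one \<open>l\<close> satisfies \<open>r l \<le> p < r' l\<close>, which costs 1. Any other
  nonzero term lies in the columns from \<open>r l\<close> up to \<open>r' l\<close>, and these
  blocks are admissible because \<open>n \<le> r l\<close>, which costs 2.\<close>

lemma row_upper_estimate:
  assumes z: "\<And>l. l < n \<Longrightarrow> z l \<in> Tstar" "\<And>l. l < n \<Longrightarrow> Tstar_norm (z l) \<le> u" and u: "0 \<le> u"
    and r: "\<And>l. l < n \<Longrightarrow> n \<le> r l" "\<And>l l'. l < l' \<Longrightarrow> l' < n \<Longrightarrow> r' l \<le> r l'"
    and supp: "\<And>l j. l < n \<Longrightarrow> z l j \<noteq> 0 \<Longrightarrow> p < r' l \<and> j < r' l \<and> (r l \<le> p \<or> r l \<le> j)"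
  shows "(\<lambda>j. \<Sum>l<n. z l j) \<in> Tstar" "Tstar_norm (\<lambda>j. \<Sum>l<n. z l j) \<le> 3 * u"
proof -
  define f1 where "f1 l = (if r l \<le> p then z l else (\<lambda>_. 0))" for l
  define f2 where "f2 l = (if r l \<le> p then (\<lambda>_. 0) else z l)" for l
  have T1: "f1 l \<in> Tstar" "Tstar_norm (f1 l) \<le> u" and T2: "f2 l \<in> Tstar" "Tstar_norm (f2 l) \<le> u"
    if "l < n" for l using z that u by (simp_all add: f1_def f2_def)
  have S1: "(\<lambda>j. \<Sum>l<n. f1 l j) \<in> Tstar" using T1 Tstar_sum[of "{..<n}" f1] by simp
  have S2: "(\<lambda>j. \<Sum>l<n. f2 l j) \<in> Tstar" using T2 Tstar_sum[of "{..<n}" f2] by simp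
  have eq: "(\<lambda>j. \<Sum>l<n. z l j) = (\<lambda>j. (\<Sum>l<n. f1 l j) + (\<Sum>l<n. f2 l j))"
    unfolding sum.distrib[symmetric] by (intro ext sum.cong) (auto simp: f1_def f2_def)
  show "(\<lambda>j. \<Sum>l<n. z l j) \<in> Tstar" unfolding eq by (rule Tstar_add(1)[OF S1 S2])
  have "Tstar_norm (\<lambda>j. \<Sum>l<n. f1 l j) \<le> u"
  proof (cases "\<exists>l<n. \<exists>j. f1 l j \<noteq> 0")
    case False
    then have "(\<lambda>j. \<Sum>l<n. f1 l j) = (\<lambda>_. 0)" by (intro ext sum.neutral) auto
    then show ?thesis using u by simp
  next
    case True
    then obtain l j where l: "l < n" "f1 l j \<noteq> 0" by blast
    then have lp: "r l \<le> p" "p < r' l" using supp[of l j] by (auto simp: f1_def split: if_splits)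
    have other: "f1 l' i = 0" if l': "l' < n" "l' \<noteq> l" for l' i
    proof (rule ccontr)
      assume "f1 l' i \<noteq> 0"
      then have lp': "r l' \<le> p" "p < r' l'" using supp[of l' i] l' by (auto simp: f1_def split: if_splits)
      show False using r(2)[of l l'] r(2)[of l' l] lp lp' l(1) l' by (cases l l' rule: linorder_cases) auto
    qed
    have "(\<Sum>l<n. f1 l i) = (\<Sum>l'<n. if l' = l then f1 l i else 0)" for i
      using other by (intro sum.cong) auto
    then have "(\<lambda>i. \<Sum>l<n. f1 l i) = f1 l" using l(1) by (intro ext) simp
    then show ?thesis using T1(2)[OF l(1)] by simp
  qed
  moreover have "Tstar_norm (\<lambda>j. \<Sum>l<n. f2 l j) \<le> 2 * u"
  proof (rule Tstar_block[OF T2(1) T2(2) u])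
    have s2: "r l \<le> j \<and> j < r' l" if "l < n" "f2 l j \<noteq> 0" for l j
      using supp[of l j] that by (auto simp: f2_def split: if_splits)
    show "n \<le> Suc j" if "l < n" "f2 l j \<noteq> 0" for l j using s2[OF that] r(1)[OF that(1)] by simp
    show "successive n f2" unfolding successive_def
    proof (intro allI impI)
      fix l l' i j assume *: "l < l'" "l' < n" "f2 l i \<noteq> 0" "f2 l' j \<noteq> 0"
      then have "i < r' l" "r l' \<le> j" using s2[of l i] s2[of l' j] by auto
      then show "i < j" using r(2)[OF *(1,2)] by simp
    qed
  qed
  ultimately show "Tstar_norm (\<lambda>j. \<Sum>l<n. z l j) \<le> 3 * u"
    unfolding eq using Tstar_add(2)[OF S1 S2] by simp
qed

text \<open>On the first \<open>L\<close> coordinates all \<open>v l\<close> lie within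
  \<open>1 / L\<close> of \<open>v 0\<close>, and \<open>L\<close> errors of that size have total
  norm at most 1, which makes 2. Beyond them \<open>Tstar_max\<close> gives 8.\<close>

lemma close_max_norm:
  fixes v :: "nat \<Rightarrow> nat \<Rightarrow> real" and n :: nat
  defines "L \<equiv> 2 * n + 2"
  assumes n: "0 < n" and v: "\<And>l. l < n \<Longrightarrow> v l \<in> Tstar" "\<And>l. l < n \<Longrightarrow> Tstar_norm (v l) \<le> 1"
    and close: "\<And>l k. l < n \<Longrightarrow> k < L \<Longrightarrow> \<bar>v l k - v 0 k\<bar> \<le> 1 / L"
    and u: "\<And>k. 0 \<le> u k" "\<And>k. \<exists>l<n. u k \<le> v l k"
  shows "u \<in> Tstar" "Tstar_norm u \<le> 10"
proof -
  have "0 < L" by (simp add: L_def)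
  let ?u1 = "restr {..<L} u" and ?u2 = "restr {L..} u"
  let ?g = "\<lambda>k. mag (v 0) k + (\<Sum>i<L. 1 / L * unitv i k)"
  have m: "mag (v 0) \<in> Tstar" "Tstar_norm (mag (v 0)) \<le> 1"
    using Tstar_mono[OF v(1)[OF n], of "mag (v 0)"] v(2)[OF n] by (auto simp: mag_apply)
  have uT: "(\<lambda>k. 1 / L * unitv i k) \<in> Tstar" "Tstar_norm (\<lambda>k. 1 / L * unitv i k) = 1 / L" for i
    using Tstar_scale[OF Tstar_c00[OF c00_unitv], of "1 / L" i] by (simp_all add: Tstar_norm_unitv)
  have sT: "(\<lambda>k. \<Sum>i<L. 1 / L * unitv i k) \<in> Tstar" "Tstar_norm (\<lambda>k. \<Sum>i<L. 1 / L * unitv i k) \<le> 1"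
    using Tstar_sum[of "{..<L}" "\<lambda>i k. 1 / L * unitv i k"] uT \<open>0 < L\<close> by simp_all
  have g: "?g \<in> Tstar" "Tstar_norm ?g \<le> 2" using Tstar_add[OF m(1) sT(1)] m(2) sT(2) by auto
  have le: "?u1 k \<le> ?g k" for k
  proof (cases "k < L")
    case True
    obtain l where l: "l < n" "u k \<le> v l k" using u(2) by blast
    have "(\<Sum>i<L. 1 / L * unitv i k) = (\<Sum>i<L. if i = k then 1 / L else 0)"
      by (intro sum.cong) (auto simp: unitv_apply)
    then have "(\<Sum>i<L. 1 / L * unitv i k) = 1 / L" using True by simp
    then show ?thesis using close[OF l(1) True] l(2) True by (simp add: restr_apply mag_apply)
  next
    case False
    then show ?thesis by (simp add: restr_apply sum_nonneg unitv_apply)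
  qed
  have "0 \<le> ?u1 k" for k using u(1) by (simp add: restr_apply)
  from Tstar_dominated[OF g(1) this le] have u1: "?u1 \<in> Tstar" "Tstar_norm ?u1 \<le> 2" using g(2) by auto
  have "?u2 p \<noteq> 0 \<Longrightarrow> 2 * n + 2 \<le> p \<and> (\<exists>i<n. \<bar>?u2 p\<bar> \<le> \<bar>v i p\<bar>)" for p
  proof -
    assume "?u2 p \<noteq> 0"
    moreover obtain l where "l < n" "u p \<le> v l p" using u(2) by blast
    ultimately show ?thesis using u(1)[of p]
      by (intro conjI exI[of _ l]) (auto simp: restr_apply L_def split: if_splits)
  qed
  from Tstar_max[OF v _ this] have u2: "?u2 \<in> Tstar" "Tstar_norm ?u2 \<le> 8" by auto
  have eq: "u = (\<lambda>k. ?u1 k + ?u2 k)" by (auto simp: restr_apply)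
  show "u \<in> Tstar" by (subst eq) (rule Tstar_add(1)[OF u1(1) u2(1)])
  have "Tstar_norm u \<le> Tstar_norm ?u1 + Tstar_norm ?u2"
    by (subst eq) (rule Tstar_add(2)[OF u1(1) u2(1)])
  then show "Tstar_norm u \<le> 10" using u1(2) u2(2) by simp
qed


lemma pigeonhole_subseq:
  fixes code :: "nat \<Rightarrow> 'c"
  assumes C: "finite C" "\<And>i. i < N \<Longrightarrow> code i \<in> C" and N: "n * card C < N"
  obtains \<sigma> where "\<And>k l. k < l \<Longrightarrow> l < n \<Longrightarrow> \<sigma> k < \<sigma> l" "\<And>k. k < n \<Longrightarrow> \<sigma> k < N"
    "\<And>k l. k < n \<Longrightarrow> l < n \<Longrightarrow> code (\<sigma> k) = code (\<sigma> l)"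
proof -
  define F where "F c = {i. i < N \<and> code i = c}" for c
  have "\<exists>c\<in>C. n < card (F c)"
  proof (rule ccontr)
    assume "\<not> ?thesis"
    then have le: "card (F c) \<le> n" if "c \<in> C" for c using that by (auto simp: not_less)
    have "{..<N} = (\<Union>c\<in>C. F c)" using C(2) by (auto simp: F_def)
    then have "N \<le> (\<Sum>c\<in>C. card (F c))" using card_UN_le[OF C(1), of F] by (metis card_lessThan)
    also have "\<dots> \<le> card C * n" using sum_bounded_above[of C "\<lambda>c. card (F c)" n] le by simp
    finally show False using N by (simp add: mult.commute)
  qed
  then obtain c where c: "n < card (F c)" by blast
  have "finite (F c)" by (simp add: F_def)
  then obtain \<sigma> where \<sigma>: "bij_betw \<sigma> {..<card (F c)} (F c)" "strict_mono_on {..<card (F c)} \<sigma>"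
    by (rule ex_bij_betw_strict_mono_card)
  have inF: "\<sigma> k \<in> F c" if "k < n" for k
    using \<sigma>(1) c that unfolding bij_betw_def by (metis image_eqI lessThan_iff less_trans)
  show ?thesis
  proof (rule that[of \<sigma>])
    show "\<sigma> k < \<sigma> l" if "k < l" "l < n" for k l
      using \<sigma>(2) c that by (auto simp: strict_mono_on_def)
    show "\<sigma> k < N" if "k < n" for k using inF[OF that] by (simp add: F_def)
    show "code (\<sigma> k) = code (\<sigma> l)" if "k < n" "l < n" for k l
      using inF[OF that(1)] inF[OF that(2)] by (simp add: F_def)
  qed
qed

lemma pigeonhole_close:
  fixes v :: "nat \<Rightarrow> nat \<Rightarrow> real"
  assumes v: "\<And>i k. i < N \<Longrightarrow> 0 \<le> v i k \<and> v i k \<le> 1" and L: "0 < L" and N: "n * Suc L ^ L < N"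
  obtains \<sigma> where "\<And>k l. k < l \<Longrightarrow> l < n \<Longrightarrow> \<sigma> k < \<sigma> l" "\<And>k. k < n \<Longrightarrow> \<sigma> k < N"
    "\<And>l l' k. l < n \<Longrightarrow> l' < n \<Longrightarrow> k < L \<Longrightarrow> \<bar>v (\<sigma> l) k - v (\<sigma> l') k\<bar> \<le> 1 / L"
proof -
  \<comment> \<open>Rounding down to multiples of \<open>1 / L\<close> leaves
    \<open>Suc L ^ L\<close> possible codes for the first \<open>L\<close> coordinates, and equal
    codes mean a difference of at most \<open>1 / L\<close> in each.\<close>
  define code where "code i = map (\<lambda>k. nat \<lfloor>L * v i k\<rfloor>) [0..<L]" for i
  define C where "C = {xs. set xs \<subseteq> {..L} \<and> length xs = L}"
  have C: "finite C" "card C = Suc L ^ L"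
    unfolding C_def by (simp_all add: finite_lists_length_eq card_lists_length_eq)
  have "code i \<in> C" if i: "i < N" for i
  proof -
    have "nat \<lfloor>L * v i k\<rfloor> \<le> L" for k
    proof -
      have "L * v i k \<le> L" using v[OF i, of k] by (simp add: mult_left_le)
      then show ?thesis by (simp add: nat_le_iff floor_le_iff)
    qed
    then show ?thesis by (auto simp: C_def code_def)
  qed
  then obtain \<sigma> where \<sigma>: "\<And>k l. k < l \<Longrightarrow> l < n \<Longrightarrow> \<sigma> k < \<sigma> l" "\<And>k. k < n \<Longrightarrow> \<sigma> k < N"
    "\<And>k l. k < n \<Longrightarrow> l < n \<Longrightarrow> code (\<sigma> k) = code (\<sigma> l)"
    using pigeonhole_subseq[OF C(1), of N code n] N C(2) by metis
  show ?thesis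
  proof (rule that[OF \<sigma>(1,2)])
    fix l l' k assume l: "l < n" "l' < n" "k < L"
    have "nat \<lfloor>L * v (\<sigma> l) k\<rfloor> = nat \<lfloor>L * v (\<sigma> l') k\<rfloor>"
      using arg_cong[OF \<sigma>(3)[OF l(1,2)], of "\<lambda>xs. xs ! k"] l(3) by (simp add: code_def)
    moreover have "0 \<le> L * v (\<sigma> l) k" "0 \<le> L * v (\<sigma> l') k"
      using v[OF \<sigma>(2)[OF l(1)], of k] v[OF \<sigma>(2)[OF l(2)], of k] by simp_all
    ultimately have "\<lfloor>L * v (\<sigma> l) k\<rfloor> = \<lfloor>L * v (\<sigma> l') k\<rfloor>"
      by (metis eq_nat_nat_iff zero_le_floor)
    then have "\<bar>L * v (\<sigma> l) k - L * v (\<sigma> l') k\<bar> \<le> 1" by linarith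
    then have "L * \<bar>v (\<sigma> l) k - v (\<sigma> l') k\<bar> \<le> 1"
      unfolding right_diff_distrib[symmetric] by (simp add: abs_mult)
    then show "\<bar>v (\<sigma> l) k - v (\<sigma> l') k\<bar> \<le> 1 / L" using L by (simp add: field_simps)
  qed
qed

text \<open>The constant is \<open>3 * 10 + 1\<close>: a sum within a row costs 3 times the largest
  row norm, the sequence \<open>u\<close> of largest row norms has norm at most 10, and the
  \<open>n\<close> parts off the corners, each of norm at most \<open>1 / n\<close>, add up to at
  most \<open>linf n b\<close>.\<close>

lemma staircase_upper_estimate:
  assumes st: "staircase n (1 / n) ys R" and n: "0 < n"
    and N: "n * Suc (2 * n + 2) ^ (2 * n + 2) < length ys"
  shows "\<exists>\<sigma>. (\<forall>k l. k < l \<longrightarrow> l < n \<longrightarrow> \<sigma> k < \<sigma> l) \<and> (\<forall>k<n. \<sigma> k < length ys) \<and>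
    (\<forall>b. TT_norm (\<lambda>k j. \<Sum>l<n. b l * (ys ! \<sigma> l) k j) \<le> 31 * linf n b)"
proof -
  let ?N = "length ys" and ?L = "2 * n + 2"
  have R0: "n \<le> R 0" and Rmono: "\<And>i. i < ?N \<Longrightarrow> R i \<le> R (Suc i)"
    and yT: "\<And>i. i < ?N \<Longrightarrow> ys ! i \<in> TT" and y1: "\<And>i. i < ?N \<Longrightarrow> TT_norm (ys ! i) = 1"
    and y0: "\<And>i k j. i < ?N \<Longrightarrow> k < R i \<Longrightarrow> j < R i \<Longrightarrow> (ys ! i) k j = 0"
    and off: "\<And>i. i < ?N \<Longrightarrow> TT_norm (off_corner (R (Suc i)) (ys ! i)) \<le> 1 / n"
    using st unfolding staircase_def by blast+
  have Rle: "R i \<le> R i'" if "i \<le> i'" "i' \<le> ?N" for i i'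
    using that by (induction i' rule: dec_induct) (auto intro: order_trans[OF _ Rmono])
  define z where "z i = corner (R (Suc i)) (ys ! i)" for i
  define v where "v i = rownorms (z i)" for i
  have zT: "z i \<in> TT" "TT_norm (z i) \<le> 1" if "i < ?N" for i
    using corner_TT[OF yT[OF that], of "R (Suc i)"] y1[OF that] by (simp_all add: z_def)
  have vT: "v i \<in> Tstar" "Tstar_norm (v i) \<le> 1" if "i < ?N" for i
    using TT_rownorms[OF zT(1)[OF that]] zT(2)[OF that] by (simp_all add: v_def TT_norm_def)
  have v01: "0 \<le> v i k \<and> v i k \<le> 1" if "i < ?N" for i k
    using Tstar_norm_nonneg[OF TT_row[OF zT(1)[OF that]]] Tstar_norm_coord[OF vT(1)[OF that], of k] vT(2)[OF that]
    by (simp add: v_def)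
  have zsupp: "k < R (Suc i) \<and> j < R (Suc i) \<and> (R i \<le> k \<or> R i \<le> j)" if "i < ?N" "z i k j \<noteq> 0" for i k j
    using that y0[OF that(1), of k j] by (auto simp: z_def corner_def split: if_splits intro: leI)
  obtain \<sigma> where \<sigma>: "\<And>k l. k < l \<Longrightarrow> l < n \<Longrightarrow> \<sigma> k < \<sigma> l" "\<And>k. k < n \<Longrightarrow> \<sigma> k < ?N"
    "\<And>l l' k. l < n \<Longrightarrow> l' < n \<Longrightarrow> k < ?L \<Longrightarrow> \<bar>v (\<sigma> l) k - v (\<sigma> l') k\<bar> \<le> 1 / ?L"
    using pigeonhole_close[of ?N v ?L n] v01 N by (metis zero_less_Suc add_2_eq_Suc')
  define u where "u k = Max ((\<lambda>l. v (\<sigma> l) k) ` {..<n})" for k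
  have vu: "v (\<sigma> l) k \<le> u k" if "l < n" for l k unfolding u_def by (rule Max_ge) (use that in auto)
  have uex: "\<exists>l<n. u k \<le> v (\<sigma> l) k" for k
  proof -
    have "u k \<in> (\<lambda>l. v (\<sigma> l) k) ` {..<n}" unfolding u_def by (rule Max_in) (use n in auto)
    then show ?thesis by auto
  qed
  have u0: "0 \<le> u k" for k using vu[OF n, of k] v01[OF \<sigma>(2)[OF n], of k] by simp
  have uT: "u \<in> Tstar" "Tstar_norm u \<le> 10"
    by (rule close_max_norm[of n "\<lambda>l. v (\<sigma> l)" u, OF n]; use vT \<sigma>(2,3) u0 uex n in blast)+
  have "TT_norm (\<lambda>k j. \<Sum>l<n. b l * (ys ! \<sigma> l) k j) \<le> 31 * linf n b" for b
  proof -
    let ?A = "linf n b"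
    have A0: "0 \<le> ?A" by (rule linf_nonneg)
    let ?X = "\<lambda>k j. \<Sum>l<n. b l * z (\<sigma> l) k j"
    let ?Y = "\<lambda>k j. \<Sum>l<n. b l * off_corner (R (Suc (\<sigma> l))) (ys ! \<sigma> l) k j"
    have row: "?X k \<in> Tstar \<and> Tstar_norm (?X k) \<le> 3 * (?A * u k)" for k
    proof -
      have s: "b l * z (\<sigma> l) k j \<noteq> 0 \<Longrightarrow>
          k < R (Suc (\<sigma> l)) \<and> j < R (Suc (\<sigma> l)) \<and> (R (\<sigma> l) \<le> k \<or> R (\<sigma> l) \<le> j)" if "l < n" for l j
        using zsupp[OF \<sigma>(2)[OF that], of k j] by simp
      have t: "(\<lambda>j. b l * z (\<sigma> l) k j) \<in> Tstar" "Tstar_norm (\<lambda>j. b l * z (\<sigma> l) k j) \<le> ?A * u k" if l: "l < n" for l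
      proof -
        note zr = TT_row[OF zT(1)[OF \<sigma>(2)[OF l]], of k]
        show "(\<lambda>j. b l * z (\<sigma> l) k j) \<in> Tstar" by (rule Tstar_scale(1)[OF zr])
        have "\<bar>b l\<bar> * v (\<sigma> l) k \<le> ?A * u k"
          using linf_upper[OF l, of b] vu[OF l, of k] A0 v01[OF \<sigma>(2)[OF l], of k] by (intro mult_mono) auto
        then show "Tstar_norm (\<lambda>j. b l * z (\<sigma> l) k j) \<le> ?A * u k"
          unfolding Tstar_scale(2)[OF zr] by (simp add: v_def)
      qed
      have r1: "n \<le> R (\<sigma> l)" if "l < n" for l using Rle[of 0 "\<sigma> l"] R0 \<sigma>(2)[OF that] by simp
      have r2: "R (Suc (\<sigma> l)) \<le> R (\<sigma> l')" if "l < l'" "l' < n" for l l'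
        using Rle[of "Suc (\<sigma> l)" "\<sigma> l'"] \<sigma>(1)[OF that] \<sigma>(2)[OF that(2)] by simp
      have Au: "0 \<le> ?A * u k" using A0 u0 by simp
      from row_upper_estimate[where n = n and z = "\<lambda>l j. b l * z (\<sigma> l) k j" and u = "?A * u k"
          and r = "\<lambda>l. R (\<sigma> l)" and r' = "\<lambda>l. R (Suc (\<sigma> l))" and p = k, OF t Au r1 r2 s]
      show ?thesis by blast
    qed
    have gT: "(\<lambda>k. 3 * ?A * u k) \<in> Tstar" "Tstar_norm (\<lambda>k. 3 * ?A * u k) = 3 * ?A * Tstar_norm u"
      using Tstar_scale[OF uT(1), of "3 * ?A"] A0 by simp_all
    have X: "?X \<in> TT" "TT_norm ?X \<le> 3 * ?A * Tstar_norm u"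
      using TT_leI[of ?X, OF conjunct1[OF row] gT(1)] row gT(2) by (simp_all add: mult.assoc)
    have "3 * ?A * Tstar_norm u \<le> 3 * ?A * 10" by (rule mult_left_mono) (use uT(2) A0 in auto)
    also have "3 * ?A * 10 = 30 * ?A" by simp
    finally have X30: "TT_norm ?X \<le> 30 * ?A" using X(2) by (rule order_trans[rotated])
    have oT: "(\<lambda>k j. b l * off_corner (R (Suc (\<sigma> l))) (ys ! \<sigma> l) k j) \<in> TT"
      "TT_norm (\<lambda>k j. b l * off_corner (R (Suc (\<sigma> l))) (ys ! \<sigma> l) k j) \<le> ?A * (1 / n)" if l: "l < n" for l
    proof -
      note o = off_corner_TT[OF yT[OF \<sigma>(2)[OF l]], of "R (Suc (\<sigma> l))"]
      show "(\<lambda>k j. b l * off_corner (R (Suc (\<sigma> l))) (ys ! \<sigma> l) k j) \<in> TT" by (rule TT_scale(1)[OF o])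
      have "0 \<le> TT_norm (off_corner (R (Suc (\<sigma> l))) (ys ! \<sigma> l))"
        unfolding TT_norm_def by (rule Tstar_norm_nonneg[OF TT_rownorms[OF o]])
      then show "TT_norm (\<lambda>k j. b l * off_corner (R (Suc (\<sigma> l))) (ys ! \<sigma> l) k j) \<le> ?A * (1 / n)"
        unfolding TT_scale(2)[OF o] using off[OF \<sigma>(2)[OF l]] linf_upper[OF l, of b] A0
        by (intro mult_mono) auto
    qed
    have Y: "?Y \<in> TT" "TT_norm ?Y \<le> (\<Sum>l<n. ?A * (1 / n))"
    proof -
      note s = TT_sum[of "{..<n}" "\<lambda>l k j. b l * off_corner (R (Suc (\<sigma> l))) (ys ! \<sigma> l) k j"]
      show "?Y \<in> TT" using s oT(1) by simp
      have "TT_norm ?Y \<le> (\<Sum>l<n. TT_norm (\<lambda>k j. b l * off_corner (R (Suc (\<sigma> l))) (ys ! \<sigma> l) k j))"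
        using s oT(1) by simp
      also have "\<dots> \<le> (\<Sum>l<n. ?A * (1 / n))" using oT(2) by (intro sum_mono) simp
      finally show "TT_norm ?Y \<le> (\<Sum>l<n. ?A * (1 / n))" .
    qed
    have "(\<lambda>k j. \<Sum>l<n. b l * (ys ! \<sigma> l) k j) = (\<lambda>k j. ?X k j + ?Y k j)"
      unfolding sum.distrib[symmetric] distrib_left[symmetric]
      unfolding z_def corner_def off_corner_def by (intro ext sum.cong) auto
    then have "TT_norm (\<lambda>k j. \<Sum>l<n. b l * (ys ! \<sigma> l) k j) \<le> TT_norm ?X + TT_norm ?Y"
      using TT_add(2)[OF X(1) Y(1)] by simp
    also have "\<dots> \<le> 30 * ?A + ?A" using X30 Y(2) n by simp
    finally show ?thesis by simp
  qed
  then show ?thesis using \<sigma>(1,2) by blast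
qed

text \<open>A coordinate is the difference of two consecutive truncations, neither of which
  increases the norm.\<close>

lemma monotone_basis_coord_le:
  assumes E: "normed_monotone_basis N E" and a: "supp_in N a" and m: "m < N"
  shows "\<bar>a m\<bar> \<le> 2 * E a"
proof -
  have sc: "\<And>a c. supp_in N a \<Longrightarrow> E (\<lambda>j. c * a j) = \<bar>c\<bar> * E a"
    and tri: "\<And>a b. supp_in N a \<Longrightarrow> supp_in N b \<Longrightarrow> E (\<lambda>j. a j + b j) \<le> E a + E b"
    and un: "E (unitv m) = 1"
    and tr: "\<And>a m. supp_in N a \<Longrightarrow> m \<le> N \<Longrightarrow> E (trunc m a) \<le> E a"
    using E m unfolding normed_monotone_basis_def by blast+
  have supp: "supp_in N (trunc r a)" "supp_in N (\<lambda>j. (-1) * trunc r a j)" for r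
    using a by (auto simp: supp_in_def trunc_def)
  have "supp_in N (unitv m)" using m by (auto simp: supp_in_def unitv_apply)
  from sc[OF this, of "a m"] have "\<bar>a m\<bar> = E (\<lambda>j. a m * unitv m j)" using un by simp
  also have "(\<lambda>j. a m * unitv m j) = (\<lambda>j. trunc (Suc m) a j + (-1) * trunc m a j)"
    by (auto simp: trunc_def unitv_apply less_Suc_eq)
  also have "E \<dots> \<le> E (trunc (Suc m) a) + E (\<lambda>j. (-1) * trunc m a j)" by (rule tri[OF supp])
  also have "E (\<lambda>j. (-1) * trunc m a j) = E (trunc m a)" using sc[OF supp(1), of "-1" m] by simp
  finally show ?thesis using tr[OF a, of "Suc m"] tr[OF a, of m] m by simp
qed

lemma asymptotic_subsequential_c0_TT: "asymptotic_subsequential_c0 TT TT_norm"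
proof -
  have main: "\<exists>N. \<forall>E\<in>asym_struct TT TT_norm N.
        \<exists>\<sigma>. (\<forall>k l. k < l \<longrightarrow> l < n \<longrightarrow> \<sigma> k < \<sigma> l) \<and> (\<forall>k<n. \<sigma> k < N) \<and>
            equiv_seq 124 n (\<lambda>a. E (\<lambda>j. \<Sum>k<n. if \<sigma> k = j then a k else 0)) (linf n)" for n :: nat
  proof (cases "n = 0")
    case True
    have "equiv_seq 124 0 (\<lambda>a. E (\<lambda>j. 0)) (linf 0)" if "E \<in> asym_struct TT TT_norm 0" for E
    proof -
      have "E (\<lambda>_. 0) = 0" using that
        unfolding asym_struct_def normed_monotone_basis_def supp_in_def by auto
      then show ?thesis unfolding equiv_seq_def linf_def by (intro exI[of _ 1]) simp
    qed
    then show ?thesis using True by (intro exI[of _ 0]) simp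
  next
    case False
    then have n: "0 < n" by simp
    \<comment> \<open>One more than \<open>n\<close> times the number of codes, so that some code
      occurs more than \<open>n\<close> times.\<close>
    define N where "N = Suc (n * Suc (2 * n + 2) ^ (2 * n + 2))"
    show ?thesis
    proof (intro exI[of _ N] ballI)
      fix E assume E: "E \<in> asym_struct TT TT_norm N"
      then have basis: "normed_monotone_basis N E" and game: "asym_game TT TT_norm E 1 N []"
        unfolding asym_struct_def by auto
      have "staircase n (1 / n) [] (\<lambda>_. n)" by (simp add: staircase_def)
      from asym_game_staircase[OF game this] n
      obtain ys R where ys: "length ys = N" "staircase n (1 / n) ys R" "asym_game TT TT_norm E 1 0 ys"
        by auto
      obtain A B where AB: "A > 0" "B > 0" "A * B \<le> 2"
        and eqv: "\<And>a. supp_in N a \<Longrightarrow> 1 / A * TT_norm (vlincomb N a (\<lambda>i. ys ! i)) \<le> E a \<and>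
          E a \<le> B * TT_norm (vlincomb N a (\<lambda>i. ys ! i))"
        using ys(1,3) unfolding asym_game.simps equiv_seq_def supp_in_def by auto
      \<comment> \<open>Both first vectors have norm 1, hence \<open>A\<close> is at least 1. Since
        the game was entered with \<open>eps = 1\<close>, this leaves
        \<open>B \<le> 2\<close>.\<close>
      have "1 / A \<le> 1"
      proof -
        have N0: "0 < N" by (simp add: N_def)
        then have u: "supp_in N (unitv 0)" by (simp add: supp_in_def unitv_apply)
        have "vlincomb N (unitv 0) (\<lambda>i. ys ! i) = ys ! 0"
        proof (intro ext)
          fix k j
          have "vlincomb N (unitv 0) (\<lambda>i. ys ! i) k j = (\<Sum>i<N. if i = 0 then (ys ! 0) k j else 0)"
            unfolding vlincomb_def by (intro sum.cong) (auto simp: unitv_apply)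
          then show "vlincomb N (unitv 0) (\<lambda>i. ys ! i) k j = (ys ! 0) k j" using N0 by simp
        qed
        moreover have "TT_norm (ys ! 0) = 1" using ys(1,2) N0 unfolding staircase_def by blast
        moreover have "E (unitv 0) = 1" using basis N0 unfolding normed_monotone_basis_def by blast
        ultimately show ?thesis using eqv[OF u] by simp
      qed
      then have "1 * B \<le> A * B" using AB(1,2) by (intro mult_right_mono) (auto simp: field_simps)
      then have B: "B \<le> 2" using AB(3) by simp
      have "n * Suc (2 * n + 2) ^ (2 * n + 2) < length ys" using ys(1) by (simp add: N_def)
      from staircase_upper_estimate[OF ys(2) n this] obtain \<sigma> where
        "\<forall>k l. k < l \<longrightarrow> l < n \<longrightarrow> \<sigma> k < \<sigma> l" "\<forall>k<n. \<sigma> k < N"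
        "\<forall>b. TT_norm (\<lambda>k j. \<Sum>l<n. b l * (ys ! \<sigma> l) k j) \<le> 31 * linf n b"
        unfolding ys(1) by blast
      then have \<sigma>: "\<And>k l. k < l \<Longrightarrow> l < n \<Longrightarrow> \<sigma> k < \<sigma> l" "\<And>k. k < n \<Longrightarrow> \<sigma> k < N"
        and up: "\<And>b. TT_norm (\<lambda>k j. \<Sum>l<n. b l * (ys ! \<sigma> l) k j) \<le> 31 * linf n b"
        by simp_all
      \<comment> \<open>The factor 62 is \<open>B \<le> 2\<close> times 31 and needs the selected
        play; the factor 2 in the lower estimate comes from monotonicity of the basis. Their product
        is 124.\<close>
      have "1 / 62 * E (\<lambda>j. \<Sum>k<n. if \<sigma> k = j then b k else 0) \<le> linf n b \<and>
          linf n b \<le> 2 * E (\<lambda>j. \<Sum>k<n. if \<sigma> k = j then b k else 0)" for b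
      proof
        let ?a = "\<lambda>j. \<Sum>k<n. if \<sigma> k = j then b k else 0"
        have a: "supp_in N ?a" unfolding supp_in_def
          by (intro allI impI sum.neutral) (use \<sigma>(2) in fastforce)
        have "vlincomb N ?a (\<lambda>i. ys ! i) = (\<lambda>k j. \<Sum>l<n. b l * (ys ! \<sigma> l) k j)"
        proof (intro ext)
          fix k j
          have "vlincomb N ?a (\<lambda>i. ys ! i) k j = (\<Sum>i<N. \<Sum>l<n. if \<sigma> l = i then b l * (ys ! \<sigma> l) k j else 0)"
            unfolding vlincomb_def sum_distrib_right by (intro sum.cong) auto
          also have "\<dots> = (\<Sum>l<n. \<Sum>i<N. if \<sigma> l = i then b l * (ys ! \<sigma> l) k j else 0)" by (rule sum.swap)
          also have "\<dots> = (\<Sum>l<n. b l * (ys ! \<sigma> l) k j)" using \<sigma>(2) by (intro sum.cong) auto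
          finally show "vlincomb N ?a (\<lambda>i. ys ! i) k j = (\<Sum>l<n. b l * (ys ! \<sigma> l) k j)" .
        qed
        then have "E ?a \<le> B * TT_norm (\<lambda>k j. \<Sum>l<n. b l * (ys ! \<sigma> l) k j)" using eqv[OF a] by simp
        also have "\<dots> \<le> B * (31 * linf n b)" using up AB(2) by (intro mult_left_mono) auto
        also have "\<dots> \<le> 2 * (31 * linf n b)" using B linf_nonneg[of n b] by (intro mult_right_mono) auto
        finally show "1 / 62 * E ?a \<le> linf n b" by simp
        have inj: "\<sigma> k = \<sigma> l \<longleftrightarrow> k = l" if "k < n" "l < n" for k l
          using \<sigma>(1)[of k l] \<sigma>(1)[of l k] that by (cases k l rule: linorder_cases) auto
        have coord: "\<bar>b l\<bar> \<le> 2 * E ?a" if l: "l < n" for l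
        proof -
          have "?a (\<sigma> l) = (\<Sum>k<n. if k = l then b l else 0)" using inj l by (intro sum.cong) auto
          then have "?a (\<sigma> l) = b l" using l by simp
          then show ?thesis using monotone_basis_coord_le[OF basis a \<sigma>(2)[OF l]] by simp
        qed
        show "linf n b \<le> 2 * E ?a"
        proof (rule linf_least)
          show "0 \<le> 2 * E ?a" using coord[OF n] by linarith
        qed (rule coord)
      qed
      then have "equiv_seq 124 n (\<lambda>a. E (\<lambda>j. \<Sum>k<n. if \<sigma> k = j then a k else 0)) (linf n)"
        unfolding equiv_seq_def by (intro exI[of _ 62] exI[of _ 2]) simp
      then show "\<exists>\<sigma>. (\<forall>k l. k < l \<longrightarrow> l < n \<longrightarrow> \<sigma> k < \<sigma> l) \<and> (\<forall>k<n. \<sigma> k < N) \<and>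
            equiv_seq 124 n (\<lambda>a. E (\<lambda>j. \<Sum>k<n. if \<sigma> k = j then a k else 0)) (linf n)"
        using \<sigma> by blast
    qed
  qed
  show ?thesis unfolding asymptotic_subsequential_c0_def
    by (intro conjI infinite_dim_TT exI[of _ 124] allI main) simp
qed

theorem theoremC:
  shows "asymptotic_subsequential_c0 TT TT_norm \<and> \<not> asymptotic_c0 TT TT_norm"
  using asymptotic_subsequential_c0_TT not_asymptotic_c0_TT by blast

end
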